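(* Let $u\in\mathfrak{S}$ with $0\in\Sigma_\kappa(u)$, $\kappa=2m$, $m\in\mathbb{N}$. Then for arbitrary $p_\kappa\in\mathfrak{P}_\kappa$ the function $$r\mapsto M_\kappa(r,u,p_\kappa)=\frac{1}{r^{n-1+2\kappa}}\int_{\partial B_r}(u-p_\kappa)^2$$ is nondecreasing for $0<r<1$.
   Context: Notation: $n\ge 2$, $\mathbb{N}=\{1,2,\dots\}$, $x=(x',x_n)\in\mathbb{R}^{n-1}\times\mathbb{R}$; $B_r$ is the open ball of radius $r$ about $0$ in $\mathbb{R}^n$; $B_1^+=B_1\cap\{x_n>0\}$; $B_r'=B_r\cap(\mathbb{R}^{n-1}\times\{0\})$. On $\{x_n=0\}$, $\partial_{x_n}u$ always denotes the limit from inside $\{x_n>0\}$. Class $\mathfrak{S}$ (normalized solutions of the Signorini problem with zero obstacle): $u\in C^{1,\alpha}_{\mathrm{loc}}(B_1^+\cup B_1')$ for some $\alpha\in(0,1)$, with $\Delta u=0$ in $B_1^+$; $u\ge0$, $-\partial_{x_n}u\ge0$, $u\,\partial_{x_n}u=0$ on $B_1'$; and $0\in\Gamma(u)$, where $\Lambda(u)=\{(x',0)\in B_1': u(x',0)=0\}$ and $\Gamma(u)$ is the boundary of $\Lambda(u)$ in the relative topology of $B_1'$. Every $u\in\mathfrak{S}$ is extended to $B_1$ by $u(x',-x_n)=u(x',x_n)$. Put $N(r,u)=\dfrac{r\int_{B_r}|\nabla u|^2}{\int_{\partial B_r}u^2}$; this is nondecreasing in $r$, so $N(0+,u)=\lim_{r\to0+}N(r,u)$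 exists. The condition $0\in\Sigma_\kappa(u)$ means that $N(0+,u)=\kappa$ and that $0$ is a singular point, i.e. $\lim_{r\to0+}\mathcal{H}^{n-1}(\Lambda(u)\cap B_r')/\mathcal{H}^{n-1}(B_r')=0$. For $\kappa=2m$, $\mathfrak{P}_\kappa$ is the class of homogeneous polynomials $p$ of degree $\kappa$ on $\mathbb{R}^n$ with $\Delta p=0$, $p(x',0)\ge0$ for all $x'$, and $p(x',-x_n)=p(x',x_n)$. *)

theory Defs
  imports "HOL-Analysis.Analysis"
begin

section \<open>Gradient, Laplacian, harmonic functions\<close>

definition grad :: "('a::euclidean_space \<Rightarrow> real) \<Rightarrow> 'a \<Rightarrow> 'a"
  where "grad f x = (THE D. GDERIV f x :> D)"

definition laplacian :: "('a::euclidean_space \<Rightarrow> real) \<Rightarrow> 'a \<Rightarrow> real"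
  where "laplacian f x = (\<Sum>b\<in>Basis. grad (\<lambda>y. grad f y \<bullet> b) x \<bullet> b)"

text \<open>The next three definitions are meant for open sets \<open>S\<close>.\<close>

definition C1_on :: "'a::euclidean_space set \<Rightarrow> ('a \<Rightarrow> real) \<Rightarrow> bool"
  where "C1_on S f \<longleftrightarrow> f differentiable_on S \<and> continuous_on S (grad f)"

definition C2_on :: "'a::euclidean_space set \<Rightarrow> ('a \<Rightarrow> real) \<Rightarrow> bool"
  where "C2_on S f \<longleftrightarrow> C1_on S f \<and> (\<forall>b\<in>Basis. C1_on S (\<lambda>x. grad f x \<bullet> b))"

definition harmonic_on :: "'a::euclidean_space set \<Rightarrow> ('a \<Rightarrow> real) \<Rightarrow> bool"
  where "harmonic_on S f \<longleftrightarrow> C2_on S f \<and> (\<forall>x\<in>S. laplacian f x = 0)"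

text \<open>\<open>C\<^sup>1\<^sup>,\<^sup>\<alpha>\<close> on compact subsets of \<open>S\<close>. Here \<open>S\<close> need not be open, only contained in the
  closure of its interior: \<open>g\<close> is the gradient, one-sided at points of \<open>S\<close> that are not interior.\<close>

definition C1_alpha_loc :: "real \<Rightarrow> 'a::euclidean_space set \<Rightarrow> ('a \<Rightarrow> real) \<Rightarrow> bool"
  where "C1_alpha_loc \<alpha> S f \<longleftrightarrow>
    (\<exists>g. (\<forall>x\<in>S. (f has_derivative (\<lambda>h. g x \<bullet> h)) (at x within S)) \<and>
         (\<forall>K. compact K \<and> K \<subseteq> S \<longrightarrow>
            (\<exists>C. \<forall>x\<in>K. \<forall>y\<in>K. norm (g x - g y) \<le> C * dist x y powr \<alpha>)))"


section \<open>Surface integrals over spheres and Hausdorff measure\<close>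

text \<open>\<open>sphere_measure r\<close> is the surface measure of the sphere of radius \<open>r > 0\<close> about the origin in
  dimension \<open>n = DIM('a)\<close>. It is given by polar coordinates: the surface area of \<open>A\<close> is \<open>n / r\<close>
  times the volume of the cone \<open>{t *\<^sub>R a | a t. a \<in> A \<and> 0 < t \<and> t < 1}\<close>, i.e.
  \<open>n * r ^ (n - 1)\<close> times the volume of the set of those \<open>x\<close> in the unit ball whose radial
  projection to the sphere lies in \<open>A\<close>.\<close>

definition sphere_measure :: "real \<Rightarrow> 'a::euclidean_space measure"
  where "sphere_measure r =
    distr (density lborel
             (\<lambda>x. ennreal (real DIM('a) * r ^ (DIM('a) - 1)) * indicator (ball 0 1) x))
          borel (\<lambda>x. (r / norm x) *\<^sub>R x)"

text \<open>\<open>f\<close> may be arbitrary off the sphere, so the integrand has to be cut off there in order to be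
  measurable.\<close>

definition sphere_integral :: "real \<Rightarrow> ('a::euclidean_space \<Rightarrow> real) \<Rightarrow> real"
  where "sphere_integral r f = (LINT x:sphere 0 r|sphere_measure r. f x)"

text \<open>\<open>k\<close>-dimensional Hausdorff (outer) measure for \<open>k \<ge> 1\<close>, normalized to agree with Lebesgue
  measure on \<open>k\<close>-dimensional space.\<close>

definition hausdorff_pre :: "nat \<Rightarrow> real \<Rightarrow> 'a::euclidean_space set \<Rightarrow> ennreal"
  where "hausdorff_pre k \<delta> A =
    (INF U\<in>{U :: nat \<Rightarrow> 'a set. A \<subseteq> (\<Union>i. U i) \<and> (\<forall>i. bounded (U i) \<and> diameter (U i) \<le> \<delta>)}.
       \<Sum>i. ennreal (unit_ball_vol (real k) * (diameter (U i) / 2) ^ k))"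

definition hausdorff_measure :: "nat \<Rightarrow> 'a::euclidean_space set \<Rightarrow> ennreal"
  where "hausdorff_measure k A = (SUP \<delta>\<in>{0<..}. hausdorff_pre k \<delta> A)"


section \<open>The Signorini problem\<close>

text \<open>The space of points \<open>(x', x\<^sub>n)\<close>; here \<open>n = CARD('m) + 1\<close>, hence \<open>n \<ge> 2\<close>, and the norm of the
  product type is the Euclidean one.\<close>

type_synonym 'm space = "(real ^ 'm) \<times> real"

definition half_ball :: "'m::finite space set"
  where "half_ball = {x \<in> ball 0 1. snd x > 0}"

definition thin_ball :: "real \<Rightarrow> 'm::finite space set"
  where "thin_ball r = {x \<in> ball 0 r. snd x = 0}"

text \<open>The normal derivative on \<open>{x. snd x = 0}\<close>: limit of the last partial derivative from
  \<open>{x. snd x > 0}\<close>.\<close>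

definition normal_deriv :: "('m::finite space \<Rightarrow> real) \<Rightarrow> 'm space \<Rightarrow> real"
  where "normal_deriv u x = Lim (at x within {y. snd y > 0}) (\<lambda>y. grad u y \<bullet> (0, 1))"

definition contact_set :: "('m::finite space \<Rightarrow> real) \<Rightarrow> 'm space set"
  where "contact_set u = {x \<in> thin_ball 1. u x = 0}"

definition free_boundary :: "('m::finite space \<Rightarrow> real) \<Rightarrow> 'm space set"
  where "free_boundary u = (top_of_set (thin_ball 1)) frontier_of (contact_set u)"

text \<open>The members are the solutions after even reflection to the whole unit ball; values outside
  the unit ball are irrelevant.\<close>

definition signorini_class :: "('m::finite space \<Rightarrow> real) set"
  where "signorini_class = {u.
    (\<exists>\<alpha>. 0 < \<alpha> \<and> \<alpha> < 1 \<and> C1_alpha_loc \<alpha> (half_ball \<union> thin_ball 1) u) \<and>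
    harmonic_on half_ball u \<and>
    (\<forall>x\<in>thin_ball 1. u x \<ge> 0 \<and> - normal_deriv u x \<ge> 0 \<and> u x * normal_deriv u x = 0) \<and>
    0 \<in> free_boundary u \<and>
    (\<forall>x'. \<forall>t. (x', t) \<in> ball 0 1 \<longrightarrow> u (x', - t) = u (x', t))}"

text \<open>Almgren's frequency. The gradient of an evenly reflected solution may fail to exist on the
  null set \<open>{x. snd x = 0}\<close>; the completed measure makes this harmless.\<close>

definition frequency :: "real \<Rightarrow> ('a::euclidean_space \<Rightarrow> real) \<Rightarrow> real"
  where "frequency r u =
    r * (LINT x:ball 0 r|lebesgue. (norm (grad u x))\<^sup>2) / sphere_integral r (\<lambda>x. (u x)\<^sup>2)"

definition origin_singular :: "('m::finite space \<Rightarrow> real) \<Rightarrow> bool"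
  where "origin_singular u \<longleftrightarrow>
    ((\<lambda>r. hausdorff_measure CARD('m) (contact_set u \<inter> thin_ball r) /
          hausdorff_measure CARD('m) (thin_ball r :: 'm space set)) \<longlongrightarrow> 0) (at_right 0)"

definition origin_in_Sigma :: "real \<Rightarrow> ('m::finite space \<Rightarrow> real) \<Rightarrow> bool"
  where "origin_in_Sigma \<kappa> u \<longleftrightarrow>
    ((\<lambda>r. frequency r u) \<longlongrightarrow> \<kappa>) (at_right 0) \<and> origin_singular u"

text \<open>The zero polynomial counts as homogeneous of every degree.\<close>

definition homogeneous_polynomial :: "nat \<Rightarrow> ('a::real_normed_vector \<Rightarrow> real) \<Rightarrow> bool"
  where "homogeneous_polynomial k p \<longleftrightarrow>
    real_polynomial_function p \<and> (\<forall>c x. p (c *\<^sub>R x) = c ^ k * p x)"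

definition P_class :: "nat \<Rightarrow> ('m::finite space \<Rightarrow> real) set"
  where "P_class k = {p. homogeneous_polynomial k p \<and> (\<forall>x. laplacian p x = 0) \<and>
    (\<forall>x'. p (x', 0) \<ge> 0) \<and> (\<forall>x' t. p (x', - t) = p (x', t))}"

definition monneau :: "nat \<Rightarrow> real \<Rightarrow> ('a::euclidean_space \<Rightarrow> real) \<Rightarrow> ('a \<Rightarrow> real) \<Rightarrow> real"
  where "monneau k r u p =
    1 / r ^ (DIM('a) - 1 + 2 * k) * sphere_integral r (\<lambda>x. (u x - p x)\<^sup>2)"

end

theory Submission
  imports Defs
begin

text \<open>With \<open>E = x \<bullet> \<nabla>u\<close>, Euler's identity for \<open>p\<close> turns the derivative of \<open>M\<^sub>\<kappa>\<close> into
  a positive multiple of \<open>\<integral> (u - p) (E - \<kappa> u)\<close> over the sphere. Green's formula and the Signorini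
  conditions (\<open>u \<partial>\<^sub>nu = 0\<close> and \<open>p \<partial>\<^sub>nu \<le> 0\<close> on the thin ball) bound this from below by
  \<open>r \<integral> |\<nabla>u|\<^sup>2 - \<kappa> \<integral> u\<^sup>2\<close>, which is nonnegative once the frequency of \<open>u\<close> at \<open>r\<close> is at least \<open>\<kappa>\<close>.

  For the latter Almgren's monotonicity formula is not needed. The solution \<open>u\<close> has no more energy in
  the ball of radius \<open>r\<close> than the \<open>k\<close>-homogeneous extension of its values on the sphere, and this
  makes the Weiss functional \<open>W\<^sub>k\<close> nondecreasing for every real \<open>k > 1\<close>. If \<open>k\<close> is smaller than
  the frequency limit \<open>\<kappa>\<close>, then \<open>W\<^sub>k > 0\<close> near \<open>0\<close>, hence \<open>W\<^sub>k \<ge> 0\<close> on all of \<open>(0,1)\<close>; let \<open>k\<close>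
  tend to \<open>\<kappa>\<close>.\<close>

section \<open>Integrals of derivatives, balls and spheres\<close>

text \<open>The gradient of \<open>u\<close> is continuous up to the thin ball, but its second
  derivatives may blow up there, so no integral over the thin ball is ever formed. Green's formula
  is kept as an inequality for a divergence-free field \<open>V\<close> times a \<open>C^1\<close>
  function \<open>\<eta>\<close>, and the Signorini conditions enter only through the sign of
  \<open>V\<^sub>n \<eta>\<close>. The energy comparison is of this form too; the Rellich identity,
  the usual way to the derivative of the energy, is not, its field being quadratic in the gradient.
  The surface measure is a pushforward of volume from the unit ball. Up to a power of the radius,
  sphere integrals thus live on a fixed domain and are differentiated under the integral sign, ray
  by ray. Functions are folded to the upper half ball, since the reflected solution may have a kink.
  The gradient of the \<open>k\<close>-homogeneous extension has degree \<open>k - 1\<close>;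
  \<open>k > 1\<close> makes it continuous at the origin, and \<open>\<kappa> \<ge> 2\<close> leaves
  such \<open>k\<close> below \<open>\<kappa>\<close>. For \<open>k = \<kappa>\<close> itself the
  limit of the frequency would not decide the sign of \<open>W\<^sub>k\<close> near the
  origin.\<close>

lemma tendsto_integral_bounded:
  fixes F :: "'b::first_countable_topology \<Rightarrow> 'a \<Rightarrow> real"
  assumes A: "A \<in> sets M" "emeasure M A < \<infinity>"
    and meas: "\<And>t. t \<in> T \<Longrightarrow> F t \<in> borel_measurable M" "f \<in> borel_measurable M"
    and bnd: "\<And>t. t \<in> T \<Longrightarrow> AE x in M. x \<in> A \<longrightarrow> \<bar>F t x\<bar> \<le> C"
    and zero: "\<And>t x. t \<in> T \<Longrightarrow> x \<notin> A \<Longrightarrow> F t x = 0"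
    and lim: "AE x in M. ((\<lambda>t. F t x) \<longlongrightarrow> f x) (at t0 within T)"
  shows "((\<lambda>t. \<integral>x. F t x \<partial>M) \<longlongrightarrow> (\<integral>x. f x \<partial>M)) (at t0 within T)"
  unfolding tendsto_at_iff_sequentially comp_def
proof (intro allI impI)
  fix X :: "nat \<Rightarrow> 'b"
  assume X: "\<forall>i. X i \<in> T - {t0}" "X \<longlonglongrightarrow> t0"
  show "(\<lambda>i. \<integral>x. F (X i) x \<partial>M) \<longlonglongrightarrow> (\<integral>x. f x \<partial>M)"
  \<comment> \<open>First countability has reduced the limit to sequences; the constant
    \<open>\<bar>C\<bar>\<close> on the set \<open>A\<close> of finite measure is the
    majorant.\<close>
  proof (rule integral_dominated_convergence[where w = "\<lambda>x. \<bar>C\<bar> * indicator A x"])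
    show "integrable M (\<lambda>x. \<bar>C\<bar> * indicator A x)"
      using A by (intro integrable_mult_right) (auto simp: integrable_indicator_iff)
    show "AE x in M. (\<lambda>i. F (X i) x) \<longlonglongrightarrow> f x"
      using lim
    proof eventually_elim
      case (elim x)
      then show ?case using X unfolding tendsto_at_iff_sequentially comp_def by blast
    qed
    show "AE x in M. norm (F (X i) x) \<le> \<bar>C\<bar> * indicator A x" for i
    proof -
      have Xi: "X i \<in> T" using X by auto
      show ?thesis using bnd[OF Xi]
      proof eventually_elim
        case (elim x)
        then show ?case using zero[OF Xi, of x] by (cases "x \<in> A") auto
      qed
    qed
  qed (use meas X in auto)
qed

lemma integral_translate:
  fixes g :: "'a::euclidean_space \<Rightarrow> real"
  assumes "g \<in> borel_measurable borel"
  shows "(\<integral>x. g (x + v) \<partial>lborel) = (\<integral>x. g x \<partial>lborel)"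
proof -
  have "(\<integral>x. g x \<partial>lborel) = (\<integral>x. g x \<partial>distr lborel borel ((+) v))"
    by (simp add: lborel_distr_plus)
  also have "\<dots> = (\<integral>x. g (v + x) \<partial>lborel)"
    using assms by (intro integral_distr) auto
  finally show ?thesis by (simp add: add.commute)
qed

text \<open>The integral of every difference quotient of \<open>g\<close> vanishes by translation invariance.\<close>

lemma integral_directional_derivative_eq_0:
  fixes g :: "'a::euclidean_space \<Rightarrow> real"
  assumes der: "\<And>x. GDERIV g x :> G x" and cont: "continuous_on UNIV G"
    and K: "compact K" "\<And>x. x \<notin> K \<Longrightarrow> g x = 0" "\<And>x. x \<notin> K \<Longrightarrow> G x = 0"
  shows "(\<integral>x. G x \<bullet> e \<partial>lborel) = 0"
proof -
  have "compact (G ` K)"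
    using K(1) cont by (meson compact_continuous_image continuous_on_subset subset_UNIV)
  then obtain C0 where C0: "\<And>x. x \<in> K \<Longrightarrow> norm (G x) \<le> C0"
    by (meson bounded_iff compact_imp_bounded imageI)
  define C where "C = \<bar>C0\<bar>"
  have C: "norm (G x) \<le> C" for x
    using C0[of x] K(3)[of x] by (cases "x \<in> K") (auto simp: C_def)
  have lip: "\<bar>g y - g x\<bar> \<le> C * norm (y - x)" for x y
  proof -
    have "norm (g y - g x) \<le> C * norm (y - x)"
    proof (rule differentiable_bound[where S = UNIV and f' = "\<lambda>x h. h \<bullet> G x"])
      show "(g has_derivative (\<lambda>h. h \<bullet> G z)) (at z within UNIV)" for z
        using der[of z] by (simp add: gderiv_def)
      show "onorm (\<lambda>h. h \<bullet> G z) \<le> C" for z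
      proof (rule onorm_le)
        fix h
        have "norm (h \<bullet> G z) \<le> norm h * norm (G z)"
          using Cauchy_Schwarz_ineq2 by auto
        also have "\<dots> \<le> norm h * C" using C by (intro mult_left_mono) auto
        finally show "norm (h \<bullet> G z) \<le> C * norm h" by (simp add: mult.commute)
      qed
    qed auto
    then show ?thesis by simp
  qed
  have gc: "continuous_on UNIV g"
    using der by (meson gderiv_def continuous_at_imp_continuous_on has_derivative_continuous)
  have gm: "g \<in> borel_measurable borel" using gc by (rule borel_measurable_continuous_onI)
  have Gm: "(\<lambda>x. G x \<bullet> e) \<in> borel_measurable borel"
    using cont by (intro borel_measurable_continuous_onI continuous_intros)
  have "compact (g ` K)"
    using K(1) gc by (meson compact_continuous_image continuous_on_subset subset_UNIV)
  then obtain B where B: "\<And>x. x \<in> K \<Longrightarrow> norm (g x) \<le> B"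
    by (meson bounded_iff compact_imp_bounded imageI)
  have gint: "integrable lborel g"
  proof (rule integrableI_bounded_set)
    show "K \<in> sets lborel" using K(1) by (simp add: borel_compact)
    show "emeasure lborel K < \<infinity>" using K(1) by (intro emeasure_bounded_finite compact_imp_bounded)
    show "AE x in lborel. x \<in> K \<longrightarrow> norm (g x) \<le> B" using B by auto
  qed (use gm K in auto)
  define T where "T = {0<..<(1::real)}"
  \<comment> \<open>The Minkowski sum of \<open>K\<close> and a ball of radius \<open>norm e\<close>
    contains the supports of all difference quotients with \<open>0 < t < 1\<close>, so one bounded
    set serves for the passage to the limit.\<close>
  define A where "A = {x + y | x y. x \<in> K \<and> y \<in> cball 0 (norm e)}"
  have Acomp: "compact A"
    unfolding A_def using K(1) by (intro compact_sums) auto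
  have KA: "x \<in> A" if "x \<in> K" for x
    unfolding A_def using that by (force intro: exI[of _ x] exI[of _ "0::'a"])
  have lim: "((\<lambda>t. \<integral>x. (g (x + t *\<^sub>R e) - g x) / t \<partial>lborel) \<longlongrightarrow> (\<integral>x. G x \<bullet> e \<partial>lborel)) (at 0 within T)"
  proof (rule tendsto_integral_bounded[where A = A and C = "C * norm e"])
    show "A \<in> sets lborel" using Acomp by (simp add: borel_compact)
    show "emeasure lborel A < \<infinity>" using Acomp by (intro emeasure_bounded_finite compact_imp_bounded)
    show "(\<lambda>x. (g (x + t *\<^sub>R e) - g x) / t) \<in> borel_measurable lborel" for t
      using gm by measurable
    show "(\<lambda>x. G x \<bullet> e) \<in> borel_measurable lborel" using Gm by simp
    show "AE x in lborel. x \<in> A \<longrightarrow> \<bar>(g (x + t *\<^sub>R e) - g x) / t\<bar> \<le> C * norm e" if "t \<in> T" for t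
    proof (intro AE_I2 impI)
      fix x
      show "\<bar>(g (x + t *\<^sub>R e) - g x) / t\<bar> \<le> C * norm e"
        using lip[of "x + t *\<^sub>R e" x] that by (auto simp: T_def divide_simps mult_ac)
    qed
    show "(g (x + t *\<^sub>R e) - g x) / t = 0" if "t \<in> T" "x \<notin> A" for t x
    proof -
      have "x + t *\<^sub>R e \<notin> K"
      proof
        assume "x + t *\<^sub>R e \<in> K"
        moreover have "- (t *\<^sub>R e) \<in> cball 0 (norm e)"
          using that by (auto simp: T_def mult_left_le_one_le)
        ultimately have "(x + t *\<^sub>R e) + (- (t *\<^sub>R e)) \<in> A"
          unfolding A_def by blast
        then show False using that by simp
      qed
      moreover have "x \<notin> K" using KA that by blast
      ultimately show ?thesis using K by simp
    qed
    show "AE x in lborel. ((\<lambda>t. (g (x + t *\<^sub>R e) - g x) / t) \<longlongrightarrow> G x \<bullet> e) (at 0 within T)"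
    proof (rule AE_I2)
      fix x
      have "((\<lambda>t. g (x + t *\<^sub>R e)) has_derivative (\<lambda>h. (h *\<^sub>R e) \<bullet> G x)) (at 0)"
        by (rule has_derivative_compose[where f = "\<lambda>t. x + t *\<^sub>R e" and g = g])
          (use der[of x] in \<open>auto simp: gderiv_def intro!: derivative_eq_intros\<close>)
      then have "((\<lambda>t. g (x + t *\<^sub>R e)) has_field_derivative (G x \<bullet> e)) (at 0)"
        by (simp add: has_field_derivative_def inner_commute mult_commute_abs)
      then have "((\<lambda>t. (g (x + t *\<^sub>R e) - g x) / t) \<longlongrightarrow> G x \<bullet> e) (at 0)"
        by (simp add: has_field_derivative_iff)
      then show "((\<lambda>t. (g (x + t *\<^sub>R e) - g x) / t) \<longlongrightarrow> G x \<bullet> e) (at 0 within T)"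
        by (rule tendsto_within_subset) auto
    qed
  qed
  have zero: "(\<integral>x. (g (x + t *\<^sub>R e) - g x) / t \<partial>lborel) = 0" for t
  proof -
    have "integrable (distr lborel borel ((+) (t *\<^sub>R e))) g"
      using gint by (simp add: lborel_distr_plus)
    then have "integrable lborel (\<lambda>x. g (t *\<^sub>R e + x))"
      using gm by (subst (asm) integrable_distr_eq) auto
    then have "integrable lborel (\<lambda>x. g (x + t *\<^sub>R e))" by (simp add: add.commute)
    then show ?thesis using gint integral_translate[OF gm, of "t *\<^sub>R e"] by simp
  qed
  have "((\<lambda>t. 0) \<longlongrightarrow> (\<integral>x. G x \<bullet> e \<partial>lborel)) (at 0 within T)"
    using lim by (simp only: zero)
  moreover have "(at 0 within T) \<noteq> bot"
    unfolding trivial_limit_within T_def by (simp add: islimpt_greaterThanLessThan1)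
  ultimately show ?thesis by (metis tendsto_const tendsto_unique)
qed

text \<open>Up to the factor \<open>DIM('a)\<close> this is the integral of \<open>\<theta> \<mapsto> f (r \<theta>)\<close> over the unit sphere.\<close>

definition cone_integral :: "real \<Rightarrow> ('a::euclidean_space \<Rightarrow> real) \<Rightarrow> real"
  where "cone_integral r f = (LINT x:ball 0 1|lborel. f ((r / norm x) *\<^sub>R x))"

text \<open>The projection is continuous only away from the origin, and there
  \<open>r / 0 = 0\<close> sends the origin to itself, where \<open>f\<close> is arbitrary. So this
  single point is split off with the constant value \<open>f 0\<close>.\<close>

lemma measurable_radial_projection:
  fixes f :: "'a::euclidean_space \<Rightarrow> real"
  assumes r: "r > 0" and f: "continuous_on (sphere 0 r) f"
  shows "(\<lambda>x. f ((r / norm x) *\<^sub>R x)) \<in> borel_measurable borel"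
proof -
  let ?T = "\<lambda>x::'a. (r / norm x) *\<^sub>R x"
  have "(\<lambda>x. indicator (- {0}) x *\<^sub>R f (?T x)) \<in> borel_measurable borel"
    by (intro borel_measurable_continuous_on_indicator continuous_on_compose2[OF f] continuous_intros)
       (use r in \<open>auto split: if_splits\<close>)
  moreover have "(\<lambda>x::'a. indicator {0} x *\<^sub>R f 0) \<in> borel_measurable borel" by measurable
  ultimately have "(\<lambda>x. indicator (- {0}) x *\<^sub>R f (?T x) + indicator {0} x *\<^sub>R f 0) \<in> borel_measurable borel"
    by (rule borel_measurable_add)
  also have "(\<lambda>x. indicator (- {0}) x *\<^sub>R f (?T x) + indicator {0} x *\<^sub>R f 0) = (\<lambda>x. f (?T x))"
    by (auto simp: fun_eq_iff indicator_def)
  finally show ?thesis .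
qed

lemma integral_scale_ball:
  fixes f :: "'a::euclidean_space \<Rightarrow> real"
  assumes c: "c > 0" and f: "set_borel_measurable borel (ball 0 (c * s)) f"
  shows "(LINT x:ball 0 (c * s)|lborel. f x) = c ^ DIM('a) * (LINT x:ball 0 s|lborel. f (c *\<^sub>R x))"
proof -
  define F where "F = (\<lambda>x. indicator (ball 0 (c * s)) x *\<^sub>R f x)"
  have Fm: "F \<in> borel_measurable borel"
    using f by (simp add: F_def set_borel_measurable_def)
  have "(\<integral>x. F x \<partial>lborel) =
      (\<integral>x. F x \<partial>density (distr lborel borel (\<lambda>x. 0 + c *\<^sub>R x)) (\<lambda>_. ennreal (c ^ DIM('a))))"
    by (subst lborel_affine[of c 0]) (use c in auto)
  also have "\<dots> = (\<integral>x. c ^ DIM('a) *\<^sub>R F x \<partial>distr lborel borel (\<lambda>x. 0 + c *\<^sub>R x))"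
    using c Fm by (intro integral_density) auto
  also have "\<dots> = (\<integral>x. c ^ DIM('a) *\<^sub>R F (0 + c *\<^sub>R x) \<partial>lborel)"
    using Fm by (intro integral_distr) auto
  also have "\<dots> = c ^ DIM('a) * (\<integral>x. F (c *\<^sub>R x) \<partial>lborel)" by simp
  also have "(\<lambda>x. F (c *\<^sub>R x)) = (\<lambda>x. indicator (ball 0 s) x *\<^sub>R f (c *\<^sub>R x))"
    using c by (auto simp: F_def fun_eq_iff indicator_def)
  finally show ?thesis by (simp add: set_lebesgue_integral_def F_def)
qed

text \<open>Only a change of variables, since \<open>sphere_measure\<close> is a pushforward. The
  cutoff to the sphere in \<open>sphere_integral\<close> disappears because the origin is the only
  point whose projection misses the sphere.\<close>

lemma sphere_integral_eq:
  fixes f :: "'a::euclidean_space \<Rightarrow> real"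
  assumes r: "r > 0" and f: "continuous_on (sphere 0 r) f"
  shows "sphere_integral r f =
    real DIM('a) * r ^ (DIM('a) - 1) * cone_integral r f"
proof -
  let ?c = "real DIM('a) * r ^ (DIM('a) - 1)"
  let ?T = "\<lambda>x::'a. (r / norm x) *\<^sub>R x"
  define F where "F = (\<lambda>x. indicator (sphere 0 r) x *\<^sub>R f x)"
  have Fm: "F \<in> borel_measurable borel"
    unfolding F_def using f by (intro borel_measurable_continuous_on_indicator) auto
  have Tm: "?T \<in> borel_measurable borel" by measurable
  have dens: "(\<lambda>x::'a. ennreal ?c * indicator (ball 0 1) x) = (\<lambda>x. ennreal (?c * indicator (ball 0 1) x))"
    by (auto simp: indicator_def)
  have "sphere_integral r f = (\<integral>x. F x \<partial>sphere_measure r)"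
    by (simp add: sphere_integral_def set_lebesgue_integral_def F_def)
  also have "\<dots> = (\<integral>x. F (?T x) \<partial>density lborel (\<lambda>x. ennreal (?c * indicator (ball 0 1) x)))"
    unfolding sphere_measure_def dens using Fm Tm by (intro integral_distr) auto
  also have "\<dots> = (\<integral>x. (?c * indicator (ball 0 1) x) *\<^sub>R F (?T x) \<partial>lborel)"
  proof (rule integral_density)
    show "(\<lambda>x. F (?T x)) \<in> borel_measurable lborel" using Fm Tm by measurable
    show "(\<lambda>x. ?c * indicator (ball 0 1) x) \<in> borel_measurable lborel"
      by (intro borel_measurable_times borel_measurable_const borel_measurable_indicator) auto
  qed (use r in auto)
  also have "\<dots> = (\<integral>x. ?c * (indicator (ball 0 1) x *\<^sub>R f (?T x)) \<partial>lborel)"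
  proof (rule integral_cong_AE)
    show "AE x in lborel. (?c * indicator (ball 0 1) x) *\<^sub>R F (?T x) = ?c * (indicator (ball 0 1) x *\<^sub>R f (?T x))"
    proof -
      have "AE x in lborel. x \<noteq> (0::'a)" by (rule AE_lborel_singleton)
      then show ?thesis
      proof eventually_elim
        case (elim x)
        then have "?T x \<in> sphere 0 r" using r by simp
        then show ?case by (simp add: F_def)
      qed
    qed
    have "(\<lambda>x. F (?T x)) \<in> borel_measurable lborel" using Fm Tm by measurable
    then show "(\<lambda>x. (?c * indicator (ball 0 1) x) *\<^sub>R F (?T x)) \<in> borel_measurable lborel"
      by (intro borel_measurable_scaleR borel_measurable_times borel_measurable_const borel_measurable_indicator) auto
    show "(\<lambda>x. ?c * (indicator (ball 0 1) x *\<^sub>R f (?T x))) \<in> borel_measurable lborel"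
      using measurable_radial_projection[OF r f]
      by (intro borel_measurable_times borel_measurable_const borel_measurable_scaleR borel_measurable_indicator) auto
  qed
  also have "\<dots> = ?c * (LINT x:ball 0 1|lborel. f (?T x))"
    by (simp add: set_lebesgue_integral_def cone_integral_def)
  finally show ?thesis by (simp add: cone_integral_def)
qed

text \<open>Extension by zero reduces this to the whole space. It is differentiable because the open
  sets \<open>U\<close> and \<open>- K\<close> cover everything; on their overlap, uniqueness of the
  derivative forces \<open>G = 0\<close>, so the extended gradient is continuous.\<close>

lemma set_integral_directional_derivative_eq_0:
  fixes g :: "'a::euclidean_space \<Rightarrow> real"
  assumes U: "open U" and K: "compact K" "K \<subseteq> U"
    and der: "\<And>x. x \<in> U \<Longrightarrow> GDERIV g x :> G x" and cont: "continuous_on U G"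
    and zero: "\<And>x. x \<in> U - K \<Longrightarrow> g x = 0"
  shows "(LINT x:U|lborel. G x \<bullet> e) = 0" and "set_integrable lborel U (\<lambda>x. G x \<bullet> e)"
proof -
  define g0 where "g0 = (\<lambda>x. if x \<in> U then g x else 0)"
  define G0 where "G0 = (\<lambda>x. if x \<in> U then G x else 0)"
  have oK: "open (- K)" using K(1) by (simp add: compact_imp_closed open_Compl)
  have g0K: "g0 x = 0" if "x \<in> - K" for x using that zero by (auto simp: g0_def)
  have d1: "GDERIV g0 x :> G x" if "x \<in> U" for x
    using der[OF that] unfolding gderiv_def
    by (rule has_derivative_transform_within_open[OF _ U that]) (simp add: g0_def)
  have d2: "GDERIV g0 x :> 0" if "x \<in> - K" for x
    unfolding gderiv_def
    by (rule has_derivative_transform_within_open[of "\<lambda>_. 0", OF _ oK that]) (use g0K in auto)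
  have GK: "G x = 0" if "x \<in> U" "x \<notin> K" for x
  proof -
    have "(\<lambda>h. h \<bullet> G x) = (\<lambda>h. h \<bullet> 0)"
      using d1[of x] d2[of x] that unfolding gderiv_def by (intro has_derivative_unique) auto
    then have "G x \<bullet> G x = 0" by (metis inner_zero_right)
    then show ?thesis by simp
  qed
  have "continuous_on (U \<union> - K) G0"
  proof (rule continuous_on_open_Un[OF U oK])
    show "continuous_on U G0"
      using cont by (rule continuous_on_eq) (simp add: G0_def)
    show "continuous_on (- K) G0"
      by (rule continuous_on_eq[of _ "\<lambda>_. 0"]) (auto simp: G0_def GK)
  qed
  moreover have "U \<union> - K = UNIV" using K(2) by auto
  ultimately have c: "continuous_on UNIV G0" by simp
  have "(\<integral>x. G0 x \<bullet> e \<partial>lborel) = 0"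
  proof (rule integral_directional_derivative_eq_0[OF _ c K(1)])
    show "GDERIV g0 x :> G0 x" for x
      using d1[of x] d2[of x] K(2) by (cases "x \<in> U") (auto simp: G0_def)
    show "x \<notin> K \<Longrightarrow> g0 x = 0" for x using g0K by auto
    show "x \<notin> K \<Longrightarrow> G0 x = 0" for x using GK by (auto simp: G0_def)
  qed
  moreover have eq: "(\<lambda>x. indicator U x *\<^sub>R (G x \<bullet> e)) = (\<lambda>x. G0 x \<bullet> e)"
    by (auto simp: G0_def indicator_def)
  ultimately show "(LINT x:U|lborel. G x \<bullet> e) = 0" by (simp only: set_lebesgue_integral_def)
  have "compact ((\<lambda>x. G0 x \<bullet> e) ` K)"
    using c by (intro compact_continuous_image K(1) continuous_on_inner continuous_on_const) (auto intro: continuous_on_subset)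
  then obtain B where B: "\<And>x. x \<in> K \<Longrightarrow> norm (G0 x \<bullet> e) \<le> B"
    by (meson bounded_iff compact_imp_bounded imageI)
  have "integrable lborel (\<lambda>x. G0 x \<bullet> e)"
  proof (rule integrableI_bounded_set)
    show "K \<in> sets lborel" using K(1) by (simp add: borel_compact)
    show "emeasure lborel K < \<infinity>" using K(1) by (intro emeasure_bounded_finite compact_imp_bounded)
    show "(\<lambda>x. G0 x \<bullet> e) \<in> borel_measurable lborel"
      using borel_measurable_continuous_onI[OF continuous_on_inner[OF c continuous_on_const]] by simp
    show "AE x in lborel. x \<in> K \<longrightarrow> norm (G0 x \<bullet> e) \<le> B" using B by auto
    show "AE x in lborel. x \<notin> K \<longrightarrow> G0 x \<bullet> e = 0" using GK by (auto simp: G0_def)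
  qed
  then show "set_integrable lborel U (\<lambda>x. G x \<bullet> e)"
    by (simp only: set_integrable_def eq)
qed

section \<open>Integrals over balls and spheres as functions of the radius\<close>

lemma set_integrable_bounded:
  fixes f :: "'a::euclidean_space \<Rightarrow> real"
  assumes "set_borel_measurable borel A f" "A \<in> sets borel" "bounded A" "\<And>x. x \<in> A \<Longrightarrow> \<bar>f x\<bar> \<le> C"
  shows "set_integrable lborel A f"
  unfolding set_integrable_def
proof (rule integrableI_bounded_set[where A = A and B = C])
  show "(\<lambda>x. indicat_real A x *\<^sub>R f x) \<in> borel_measurable lborel"
    using assms(1) by (simp add: set_borel_measurable_def)
  show "emeasure lborel A < \<infinity>" using assms(3) by (rule emeasure_bounded_finite)
qed (use assms in auto)

lemma set_borel_measurable_continuous_borel: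
  fixes f :: "'a::euclidean_space \<Rightarrow> real"
  assumes "A \<in> sets borel" "continuous_on A f"
  shows "set_borel_measurable borel A f"
  unfolding set_borel_measurable_def using assms by (intro borel_measurable_continuous_on_indicator) auto

lemma continuous_ball_bounded:
  fixes f :: "'a::euclidean_space \<Rightarrow> real"
  assumes "continuous_on (ball 0 \<rho>) f" "t < \<rho>"
  obtains C where "C \<ge> 0" "\<And>x. norm x \<le> t \<Longrightarrow> \<bar>f x\<bar> \<le> C"
proof -
  have "compact (f ` cball 0 t)"
    using assms by (intro compact_continuous_image continuous_on_subset[OF assms(1)]) auto
  then obtain B where "\<And>x. x \<in> cball 0 t \<Longrightarrow> norm (f x) \<le> B"
    by (meson bounded_iff compact_imp_bounded imageI)
  then show ?thesis by (intro that[of "\<bar>B\<bar>"]) force+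
qed

lemma set_integrable_ball:
  fixes f :: "'a::euclidean_space \<Rightarrow> real"
  assumes "continuous_on (ball 0 \<rho>) f" "t < \<rho>"
  shows "set_integrable lborel (ball 0 t) f"
proof -
  obtain C where C: "\<And>x. norm x \<le> t \<Longrightarrow> \<bar>f x\<bar> \<le> C" using continuous_ball_bounded[OF assms] by blast
  show ?thesis
    by (rule set_integrable_bounded[where C = C])
       (use C assms in \<open>auto intro!: set_borel_measurable_continuous_borel intro: continuous_on_subset\<close>)
qed

lemma set_integrable_radial:
  fixes f :: "'a::euclidean_space \<Rightarrow> real"
  assumes "continuous_on (ball 0 \<rho>) f" "0 < r" "r < \<rho>"
  shows "set_integrable lborel (ball 0 t) (\<lambda>x. f ((r / norm x) *\<^sub>R x))"
proof -
  obtain C where C: "\<And>x. norm x \<le> r \<Longrightarrow> \<bar>f x\<bar> \<le> C" using continuous_ball_bounded[OF assms(1,3)] by blast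
  have "continuous_on (sphere 0 r) f" using assms by (intro continuous_on_subset[OF assms(1)]) auto
  from measurable_radial_projection[OF assms(2) this]
  have "set_borel_measurable borel (ball 0 t) (\<lambda>x. f ((r / norm x) *\<^sub>R x))"
    unfolding set_borel_measurable_def by (intro borel_measurable_scaleR borel_measurable_indicator) auto
  then show ?thesis
    by (rule set_integrable_bounded[where C = C]) (use C assms in auto)
qed

text \<open>The integrand is homogeneous of degree zero, so scaling the ball contributes the volume
  factor only.\<close>

lemma ball_integral_radial:
  fixes f :: "'a::euclidean_space \<Rightarrow> real"
  assumes f: "continuous_on (ball 0 \<rho>) f" and r: "0 < r" "r < \<rho>" and t: "t > 0"
  shows "(LINT x:ball 0 t|lborel. f ((r / norm x) *\<^sub>R x)) = t ^ DIM('a) * cone_integral r f"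
proof -
  have "(LINT x:ball 0 (t * 1)|lborel. f ((r / norm x) *\<^sub>R x)) =
      t ^ DIM('a) * (LINT x:ball 0 1|lborel. f ((r / norm (t *\<^sub>R x)) *\<^sub>R (t *\<^sub>R x)))"
  proof (rule integral_scale_ball[OF t])
    have "set_integrable lborel (ball 0 (t * 1)) (\<lambda>x. f ((r / norm x) *\<^sub>R x))"
      by (rule set_integrable_radial[OF f r])
    then show "set_borel_measurable borel (ball 0 (t * 1)) (\<lambda>x. f ((r / norm x) *\<^sub>R x))"
      unfolding set_integrable_def set_borel_measurable_def using borel_measurable_integrable by fastforce
  qed
  then show ?thesis using t by (simp add: cone_integral_def field_simps)
qed

text \<open>Only the shell between the two radii contributes, and \<open>d\<close> is bounded by
  \<open>\<epsilon>\<close> there. This estimates the error of replacing a function by its radially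
  constant extension from a sphere.\<close>

lemma ball_integral_diff:
  fixes d :: "'a::euclidean_space \<Rightarrow> real"
  assumes "0 < r" "0 < t"
    and int: "set_integrable lborel (ball 0 r) d" "set_integrable lborel (ball 0 t) d"
    and bnd: "\<And>x. \<bar>norm x - r\<bar> \<le> \<bar>t - r\<bar> \<Longrightarrow> \<bar>d x\<bar> \<le> \<epsilon>" and "\<epsilon> \<ge> 0"
  shows "\<bar>(LINT x:ball 0 t|lborel. d x) - (LINT x:ball 0 r|lborel. d x)\<bar>
    \<le> \<epsilon> * (unit_ball_vol (real DIM('a)) * \<bar>t ^ DIM('a) - r ^ DIM('a)\<bar>)"
proof -
  have aux: "\<bar>(LINT x:ball 0 b|lborel. d x) - (LINT x:ball 0 a|lborel. d x)\<bar>
    \<le> \<epsilon> * (unit_ball_vol (real DIM('a)) * (b ^ DIM('a) - a ^ DIM('a)))"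
    if "0 < a" "a \<le> b" and int: "set_integrable lborel (ball 0 a) d" "set_integrable lborel (ball 0 b) d"
    and bnd: "\<And>x. a \<le> norm x \<Longrightarrow> norm x < b \<Longrightarrow> \<bar>d x\<bar> \<le> \<epsilon>" for a b
  proof -
    have I: "set_integrable lborel (ball 0 s) (\<lambda>x::'a. 1::real)" for s
      by (rule set_integrable_bounded[where C = 1])
         (auto intro!: set_borel_measurable_continuous_borel)
    have V: "(LINT x:ball (0::'a) s|lborel. 1::real) = unit_ball_vol (real DIM('a)) * s ^ DIM('a)" if "s > 0" for s
      using that by (simp add: set_lebesgue_integral_def content_ball)
    have "\<bar>(LINT x:ball 0 b|lborel. d x) - (LINT x:ball 0 a|lborel. d x)\<bar>
      = \<bar>\<integral>x. indicator (ball 0 b) x *\<^sub>R d x - indicator (ball 0 a) x *\<^sub>R d x \<partial>lborel\<bar>"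
      using int by (simp add: set_lebesgue_integral_def set_integrable_def)
    also have "\<dots> \<le> (\<integral>x. \<epsilon> * (indicator (ball 0 b) x - indicator (ball (0::'a) a) x) \<partial>lborel)"
    proof (rule integral_abs_bound_integral)
      show "integrable lborel (\<lambda>x. indicator (ball 0 b) x *\<^sub>R d x - indicator (ball 0 a) x *\<^sub>R d x)"
        using int unfolding set_integrable_def by (intro Bochner_Integration.integrable_diff) auto
      show "integrable lborel (\<lambda>x. \<epsilon> * (indicator (ball 0 b) x - indicator (ball (0::'a) a) x))"
        using I[of a] I[of b] unfolding set_integrable_def
        by (intro integrable_mult_right Bochner_Integration.integrable_diff) auto
      show "\<bar>indicator (ball 0 b) x *\<^sub>R d x - indicator (ball 0 a) x *\<^sub>R d x\<bar>
         \<le> \<epsilon> * (indicator (ball 0 b) x - indicator (ball 0 a) x)" for x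
        using bnd[of x] that(1,2) by (auto simp: indicator_def)
    qed
    also have "\<dots> = \<epsilon> * (unit_ball_vol (real DIM('a)) * (b ^ DIM('a) - a ^ DIM('a)))"
      using I[of a] I[of b] V[of a] V[of b] that(1,2)
      by (simp add: set_lebesgue_integral_def set_integrable_def algebra_simps)
    finally show ?thesis .
  qed
  show ?thesis
  proof (cases "r \<le> t")
    case True
    have "r ^ DIM('a) \<le> t ^ DIM('a)" using True assms by (intro power_mono) auto
    then show ?thesis using aux[of r t] True assms by auto
  next
    case False
    have "t ^ DIM('a) \<le> r ^ DIM('a)" using False assms by (intro power_mono) auto
    then show ?thesis using aux[of t r] False assms by (auto simp: abs_minus_commute)
  qed
qed

text \<open>Let \<open>h\<close> extend the values of \<open>f\<close> on the sphere of radius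
  \<open>r\<close> constantly along rays. The integral of \<open>h\<close> over the ball of radius
  \<open>t\<close> is exactly a multiple of \<open>t ^ n\<close>. The rest \<open>d = f - h\<close>
  vanishes on that sphere and is uniformly small near it, so its contribution to the shell is of
  smaller order than \<open>t - r\<close>.\<close>

theorem has_derivative_ball_integral:
  fixes f :: "'a::euclidean_space \<Rightarrow> real"
  assumes f: "continuous_on (ball 0 \<rho>) f" and r: "0 < r" "r < \<rho>"
  shows "((\<lambda>t. LINT x:ball 0 t|lborel. f x) has_real_derivative sphere_integral r f) (at r)"
proof -
  define n where "n = DIM('a)"
  define h where "h = (\<lambda>x::'a. f ((r / norm x) *\<^sub>R x))"
  define d where "d = (\<lambda>x. f x - h x)"
  define \<omega> where "\<omega> = unit_ball_vol (real n)"
  have \<omega>: "\<omega> > 0" by (simp add: \<omega>_def)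
  define s where "s = (r + \<rho>) / 2"
  have s: "r < s" "s < \<rho>" using r by (auto simp: s_def)
  have hint: "set_integrable lborel (ball 0 t) h" for t
    unfolding h_def by (rule set_integrable_radial[OF f r])
  have fint: "set_integrable lborel (ball 0 t) f" if "t < \<rho>" for t
    using set_integrable_ball[OF f that] .
  have dint: "set_integrable lborel (ball 0 t) d" if "t < \<rho>" for t
    unfolding d_def using fint[OF that] hint by (rule set_integral_diff(1))
  have dpow: "((\<lambda>t. t ^ n) has_real_derivative real n * r ^ (n - 1)) (at r)"
    by (auto intro!: derivative_eq_intros)
  have "((\<lambda>t. LINT x:ball 0 t|lborel. d x) has_derivative (\<lambda>h. 0)) (at r)"
    unfolding has_derivative_at_alt
  proof (intro conjI allI impI)
    show "bounded_linear (\<lambda>h::real. 0::real)" by simp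
    fix e :: real assume e: "0 < e"
    \<comment> \<open>\<open>L\<close> will bound the difference quotients of \<open>t ^ n\<close>
      at \<open>r\<close>, the summand \<open>1\<close> absorbing the linearization error. The
      tolerance \<open>e / (\<omega> * L)\<close> then turns the shell estimate into
      \<open>e * \<bar>t - r\<bar>\<close>.\<close>
    define L where "L = real n * r ^ (n - 1) + 1"
    have L: "L > 0" using r by (simp add: L_def add_nonneg_pos)
    have "uniformly_continuous_on (cball 0 s) f"
      using s by (intro compact_uniformly_continuous continuous_on_subset[OF f]) auto
    then obtain \<delta>1 where \<delta>1: "\<delta>1 > 0"
      "\<And>x y. x \<in> cball 0 s \<Longrightarrow> y \<in> cball 0 s \<Longrightarrow> dist y x < \<delta>1 \<Longrightarrow> dist (f y) (f x) < e / (\<omega> * L)"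
      unfolding uniformly_continuous_on_def using e \<omega> L by (metis divide_pos_pos mult_pos_pos)
    obtain \<delta>2 where \<delta>2: "\<delta>2 > 0"
      "\<And>t. norm (t - r) < \<delta>2 \<Longrightarrow> norm (t ^ n - r ^ n - (t - r) * (real n * r ^ (n - 1))) \<le> 1 * norm (t - r)"
      using dpow unfolding has_field_derivative_def has_derivative_at_alt by (metis zero_less_one mult.commute)
    show "\<exists>\<delta>>0. \<forall>y. norm (y - r) < \<delta> \<longrightarrow> norm ((LINT x:ball 0 y|lborel. d x) -
        (LINT x:ball 0 r|lborel. d x) - 0) \<le> e * norm (y - r)"
    proof (intro exI[of _ "min (min \<delta>1 \<delta>2) (min r (s - r))"] conjI allI impI)
      show "0 < min (min \<delta>1 \<delta>2) (min r (s - r))" using \<delta>1 \<delta>2 r s by auto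
      fix t assume "norm (t - r) < min (min \<delta>1 \<delta>2) (min r (s - r))"
      then have t: "\<bar>t - r\<bar> < \<delta>1" "\<bar>t - r\<bar> < \<delta>2" "\<bar>t - r\<bar> < r" "\<bar>t - r\<bar> < s - r" by auto
      have t0: "0 < t" "t < \<rho>" using t s by auto
      have pw: "\<bar>t ^ n - r ^ n\<bar> \<le> L * \<bar>t - r\<bar>"
      proof -
        have "\<bar>t ^ n - r ^ n\<bar> \<le> \<bar>(t - r) * (real n * r ^ (n - 1))\<bar> + \<bar>t - r\<bar>"
          using \<delta>2(2)[of t] t by (auto simp: abs_if split: if_splits)
        also have "\<dots> = L * \<bar>t - r\<bar>" using r by (subst abs_mult) (simp add: L_def algebra_simps)
        finally show ?thesis .
      qed
      have "\<bar>(LINT x:ball 0 t|lborel. d x) - (LINT x:ball 0 r|lborel. d x)\<bar>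
         \<le> e / (\<omega> * L) * (unit_ball_vol (real DIM('a)) * \<bar>t ^ DIM('a) - r ^ DIM('a)\<bar>)"
      proof (rule ball_integral_diff[OF r(1) t0(1) dint dint])
        fix x :: 'a assume x: "\<bar>norm x - r\<bar> \<le> \<bar>t - r\<bar>"
        have x0: "norm x > 0" using x t by auto
        have "dist ((r / norm x) *\<^sub>R x) x = norm ((r / norm x - 1) *\<^sub>R x)"
          by (simp add: dist_norm scaleR_left_diff_distrib)
        also have "\<dots> = \<bar>r - norm x\<bar>"
        proof -
          have "r / norm x - 1 = (r - norm x) / norm x" using x0 by (simp add: divide_simps)
          then show ?thesis using x0 by (simp add: abs_divide)
        qed
        finally have "dist x ((r / norm x) *\<^sub>R x) < \<delta>1" using x t by (simp add: dist_commute)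
        then have "dist (f x) (f ((r / norm x) *\<^sub>R x)) < e / (\<omega> * L)"
          by (intro \<delta>1(2)) (use x t x0 r s in auto)
        then show "\<bar>d x\<bar> \<le> e / (\<omega> * L)" by (simp add: d_def h_def dist_real_def)
      qed (use e \<omega> L t0 r in auto)
      also have "\<dots> = e / L * \<bar>t ^ n - r ^ n\<bar>" unfolding n_def[symmetric] \<omega>_def[symmetric] using \<omega> L by (simp add: field_simps)
      also have "\<dots> \<le> e / L * (L * \<bar>t - r\<bar>)" using pw e L by (intro mult_left_mono) auto
      also have "\<dots> = e * \<bar>t - r\<bar>" using L by simp
      finally show "norm ((LINT x:ball 0 t|lborel. d x) - (LINT x:ball 0 r|lborel. d x) - 0) \<le> e * norm (t - r)"
        by simp
    qed
  qed
  then have "((\<lambda>t. LINT x:ball 0 t|lborel. d x) has_real_derivative 0) (at r)"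
    by (simp add: has_field_derivative_def lambda_zero)
  moreover have "((\<lambda>t. t ^ n * cone_integral r f) has_real_derivative real n * r ^ (n - 1) * cone_integral r f) (at r)"
    using dpow by (rule DERIV_cmult_right)
  ultimately have D: "((\<lambda>t. (LINT x:ball 0 t|lborel. d x) + t ^ n * cone_integral r f)
      has_real_derivative 0 + real n * r ^ (n - 1) * cone_integral r f) (at r)"
    by (rule DERIV_add)
  have "0 + real n * r ^ (n - 1) * cone_integral r f = sphere_integral r f"
    using r by (subst sphere_integral_eq) (auto simp: n_def intro!: continuous_on_subset[OF f])
  with D have D: "((\<lambda>t. (LINT x:ball 0 t|lborel. d x) + t ^ n * cone_integral r f)
      has_real_derivative sphere_integral r f) (at r)" by simp
  show ?thesis
  proof (rule has_field_derivative_transform_within_open[OF D, of "{0<..<\<rho>}"])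
    fix t assume t: "t \<in> {0<..<\<rho>}"
    have "(LINT x:ball 0 t|lborel. d x) = (LINT x:ball 0 t|lborel. f x) - (LINT x:ball 0 t|lborel. h x)"
      unfolding d_def using fint hint t by (intro set_integral_diff(2)) auto
    moreover have "(LINT x:ball 0 t|lborel. h x) = t ^ n * cone_integral r f"
      unfolding h_def n_def using t by (intro ball_integral_radial[OF f r]) auto
    ultimately show "(LINT x:ball 0 t|lborel. d x) + t ^ n * cone_integral r f = (LINT x:ball 0 t|lborel. f x)"
      by simp
  qed (use r in auto)
qed

lemma tendsto_cone_integral:
  fixes f :: "'a::euclidean_space \<Rightarrow> real"
  assumes f: "continuous_on (ball 0 \<rho>) f" and r: "0 < r" "r < \<rho>"
  shows "((\<lambda>t. cone_integral t f) \<longlongrightarrow> cone_integral r f) (at r)"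
proof -
  define s where "s = (r + \<rho>) / 2"
  have s: "r < s" "s < \<rho>" using r by (auto simp: s_def)
  obtain C where C: "C \<ge> 0" "\<And>x. norm x \<le> s \<Longrightarrow> \<bar>f x\<bar> \<le> C" using continuous_ball_bounded[OF f s(2)] by blast
  have meas: "(\<lambda>x. indicator (ball 0 1) x *\<^sub>R f ((t / norm x) *\<^sub>R x)) \<in> borel_measurable lborel"
    if "t \<in> {0<..<s}" for t
    using set_integrable_radial[OF f, of t 1] that s unfolding set_integrable_def by auto
  have "((\<lambda>t. \<integral>x. indicator (ball 0 1) x *\<^sub>R f ((t / norm x) *\<^sub>R x) \<partial>lborel) \<longlongrightarrow>
      (\<integral>x. indicator (ball 0 1) x *\<^sub>R f ((r / norm x) *\<^sub>R x) \<partial>lborel)) (at r within {0<..<s})"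
  proof (rule tendsto_integral_bounded[where A = "ball 0 1" and C = C])
    show "AE x in lborel. x \<in> ball 0 1 \<longrightarrow> \<bar>indicator (ball 0 1) x *\<^sub>R f ((t / norm x) *\<^sub>R x)\<bar> \<le> C"
      if "t \<in> {0<..<s}" for t
      using that C by (intro AE_I2) (auto simp: indicator_def)
    show "AE x in lborel. ((\<lambda>t. indicator (ball 0 1) x *\<^sub>R f ((t / norm x) *\<^sub>R x)) \<longlongrightarrow>
        indicator (ball 0 1) x *\<^sub>R f ((r / norm x) *\<^sub>R x)) (at r within {0<..<s})"
    proof (intro AE_I2 tendsto_scaleR tendsto_const)
      fix x :: 'a
      have "isCont f ((r / norm x) *\<^sub>R x)"
        using f r by (intro continuous_on_interior) (auto simp: interior_open)
      then show "((\<lambda>t. f ((t / norm x) *\<^sub>R x)) \<longlongrightarrow> f ((r / norm x) *\<^sub>R x)) (at r within {0<..<s})"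
        by (rule isCont_tendsto_compose) (unfold divide_inverse, intro tendsto_scaleR tendsto_mult tendsto_ident_at tendsto_const)
    qed
    show "emeasure lborel (ball (0::'a) 1) < \<infinity>" by (rule emeasure_bounded_finite) auto
  qed (use meas r s in auto)
  then show ?thesis
    using r s by (simp add: cone_integral_def set_lebesgue_integral_def at_within_open[of r "{0<..<s}"])
qed

lemma continuous_on_sphere_integral:
  fixes f :: "'a::euclidean_space \<Rightarrow> real"
  assumes f: "continuous_on (ball 0 \<rho>) f"
  shows "continuous_on {0<..<\<rho>} (\<lambda>t. sphere_integral t f)"
proof (rule continuous_on_eq)
  show "continuous_on {0<..<\<rho>} (\<lambda>t. real DIM('a) * t ^ (DIM('a) - 1) * cone_integral t f)"
    by (intro continuous_intros continuous_at_imp_continuous_on ballI)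
       (use tendsto_cone_integral[OF f] in \<open>auto simp: isCont_def\<close>)
  show "real DIM('a) * t ^ (DIM('a) - 1) * cone_integral t f = sphere_integral t f" if "t \<in> {0<..<\<rho>}" for t
    using that by (subst sphere_integral_eq) (auto intro!: continuous_on_subset[OF f])
qed

text \<open>\<open>E\<close> stands for \<open>x \<bullet> \<nabla>f\<close>; divided by the radius
  it is the derivative along a ray. The mean value theorem on each ray gives the majorant of the
  difference quotients. Almost every ray is enough, which leaves out the rays inside the thin
  hyperplane, where no derivative will be available.\<close>

lemma has_derivative_cone_integral:
  fixes f E :: "'a::euclidean_space \<Rightarrow> real"
  assumes f: "continuous_on (ball 0 \<rho>) f" and E: "continuous_on (ball 0 \<rho>) E" and r: "0 < r" "r < \<rho>"
    and der: "AE x in lborel. \<forall>t\<in>{0<..<\<rho>}. ((\<lambda>s. f ((s / norm x) *\<^sub>R x)) has_real_derivative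
      E ((t / norm x) *\<^sub>R x) / t) (at t)"
  shows "((\<lambda>s. cone_integral s f) has_real_derivative cone_integral r E / r) (at r)"
proof -
  define s where "s = (r + \<rho>) / 2"
  have s: "r < s" "s < \<rho>" using r by (auto simp: s_def)
  obtain C where C: "C \<ge> 0" "\<And>x. norm x \<le> s \<Longrightarrow> \<bar>E x\<bar> \<le> C" using continuous_ball_bounded[OF E s(2)] by blast
  \<comment> \<open>Radii above \<open>r / 2\<close> give the bound \<open>2 * C / r\<close> for
    \<open>E / t\<close>. Removing \<open>r\<close> keeps the difference quotients meaningful and
    does not change the filter \<open>at r\<close>.\<close>
  define T where "T = {r / 2<..<s} - {r}"
  have int: "set_integrable lborel (ball 0 1) (\<lambda>x. f ((t / norm x) *\<^sub>R x))" if "0 < t" "t < s" for t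
    using that s by (intro set_integrable_radial[OF f]) auto
  have "((\<lambda>t. \<integral>x. indicator (ball 0 1) x *\<^sub>R ((f ((t / norm x) *\<^sub>R x) - f ((r / norm x) *\<^sub>R x)) / (t - r)) \<partial>lborel) \<longlongrightarrow>
      (\<integral>x. indicator (ball 0 1) x *\<^sub>R (E ((r / norm x) *\<^sub>R x) / r) \<partial>lborel)) (at r within T)"
  proof (rule tendsto_integral_bounded[where A = "ball 0 1" and C = "2 * C / r"])
    show "AE x in lborel. x \<in> ball 0 1 \<longrightarrow> \<bar>indicator (ball 0 1) x *\<^sub>R
        ((f ((t / norm x) *\<^sub>R x) - f ((r / norm x) *\<^sub>R x)) / (t - r))\<bar> \<le> 2 * C / r"
      if t: "t \<in> T" for t
      using der
    proof eventually_elim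
      case (elim x)
      have "norm (f ((t / norm x) *\<^sub>R x) - f ((r / norm x) *\<^sub>R x)) \<le> 2 * C / r * norm (t - r)"
      proof (rule field_differentiable_bound[of "{r / 2<..<s}" "\<lambda>s. f ((s / norm x) *\<^sub>R x)"
            "\<lambda>t. E ((t / norm x) *\<^sub>R x) / t"])
        fix z assume z: "z \<in> {r / 2<..<s}"
        then have "z \<in> {0<..<\<rho>}" using r s by auto
        with elim have "((\<lambda>s. f ((s / norm x) *\<^sub>R x)) has_field_derivative E ((z / norm x) *\<^sub>R x) / z) (at z)"
          by (rule bspec)
        then show "((\<lambda>s. f ((s / norm x) *\<^sub>R x)) has_field_derivative E ((z / norm x) *\<^sub>R x) / z) (at z within {r / 2<..<s})"
          by (rule has_field_derivative_at_within)
        have "norm (E ((z / norm x) *\<^sub>R x) / z) \<le> C / (r / 2)"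
          unfolding norm_divide using z r C by (intro frac_le) (auto simp: C)
        then show "norm (E ((z / norm x) *\<^sub>R x) / z) \<le> 2 * C / r" by (simp add: mult.commute)
      qed (use t r s in \<open>auto simp: T_def\<close>)
      moreover have "t \<noteq> r" using t by (simp add: T_def)
      ultimately have "\<bar>(f ((t / norm x) *\<^sub>R x) - f ((r / norm x) *\<^sub>R x)) / (t - r)\<bar> \<le> 2 * C / r"
        by (simp add: abs_divide pos_divide_le_eq del: times_divide_eq_left)
      then show ?case by simp
    qed
    show "AE x in lborel. ((\<lambda>t. indicator (ball 0 1) x *\<^sub>R
        ((f ((t / norm x) *\<^sub>R x) - f ((r / norm x) *\<^sub>R x)) / (t - r))) \<longlongrightarrow>
        indicator (ball 0 1) x *\<^sub>R (E ((r / norm x) *\<^sub>R x) / r)) (at r within T)"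
      using der
    proof eventually_elim
      case (elim x)
      moreover have "r \<in> {0<..<\<rho>}" using r by simp
      ultimately have "((\<lambda>s. f ((s / norm x) *\<^sub>R x)) has_field_derivative E ((r / norm x) *\<^sub>R x) / r) (at r)"
        by (rule bspec)
      then have "((\<lambda>t. (f ((t / norm x) *\<^sub>R x) - f ((r / norm x) *\<^sub>R x)) / (t - r)) \<longlongrightarrow>
          E ((r / norm x) *\<^sub>R x) / r) (at r within T)"
        unfolding has_field_derivative_iff by (rule tendsto_within_subset) auto
      then show ?case by (intro tendsto_scaleR tendsto_const)
    qed
    show "emeasure lborel (ball (0::'a) 1) < \<infinity>" by (rule emeasure_bounded_finite) auto
    show "(\<lambda>x. indicator (ball 0 1) x *\<^sub>R ((f ((t / norm x) *\<^sub>R x) - f ((r / norm x) *\<^sub>R x)) / (t - r)))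
        \<in> borel_measurable lborel" if "t \<in> T" for t
    proof -
      have "set_integrable lborel (ball 0 1) (\<lambda>x. (f ((t / norm x) *\<^sub>R x) - f ((r / norm x) *\<^sub>R x)) / (t - r))"
        using that r s by (intro set_integrable_divide set_integral_diff(1) int) (auto simp: T_def)
      then show ?thesis unfolding set_integrable_def by auto
    qed
    have "set_integrable lborel (ball 0 1) (\<lambda>x. E ((r / norm x) *\<^sub>R x) / r)"
      using set_integrable_radial[OF E r, of 1] by (intro set_integrable_divide) auto
    then show "(\<lambda>x. indicator (ball 0 1) x *\<^sub>R (E ((r / norm x) *\<^sub>R x) / r)) \<in> borel_measurable lborel"
      unfolding set_integrable_def by auto
  qed auto
  then have "((\<lambda>t. \<integral>x. indicator (ball 0 1) x *\<^sub>R ((f ((t / norm x) *\<^sub>R x) - f ((r / norm x) *\<^sub>R x)) / (t - r)) \<partial>lborel) \<longlongrightarrow>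
      cone_integral r E / r) (at r within T)"
    by (simp add: cone_integral_def set_lebesgue_integral_def)
  then have "((\<lambda>t. (cone_integral t f - cone_integral r f) / (t - r)) \<longlongrightarrow> cone_integral r E / r) (at r within T)"
  proof (rule Lim_transform_eventually)
    have "\<forall>\<^sub>F t in at r within T. t \<in> T" by (simp add: eventually_at_filter)
    then show "\<forall>\<^sub>F t in at r within T. (\<integral>x. indicator (ball 0 1) x *\<^sub>R ((f ((t / norm x) *\<^sub>R x) - f ((r / norm x) *\<^sub>R x)) / (t - r)) \<partial>lborel)
        = (cone_integral t f - cone_integral r f) / (t - r)"
    proof eventually_elim
      case (elim t)
      have "(LINT x:ball 0 1|lborel. (f ((t / norm x) *\<^sub>R x) - f ((r / norm x) *\<^sub>R x)) / (t - r))
         = (cone_integral t f - cone_integral r f) / (t - r)"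
        unfolding cone_integral_def set_integral_divide_zero
        by (subst set_integral_diff(2)) (use int elim r s in \<open>auto simp: T_def\<close>)
      then show ?case by (simp add: set_lebesgue_integral_def)
    qed
  qed
  moreover have "at r within T = at r"
  proof -
    have "at r within T = at r within {r / 2<..<s}" unfolding T_def by (simp only: at_within_def Diff_idemp)
    also have "\<dots> = at r" using r s by (intro at_within_open) auto
    finally show ?thesis .
  qed
  ultimately show ?thesis by (simp add: has_field_derivative_iff)
qed

lemma sphere_integral_cong:
  assumes "\<And>x. norm x = r \<Longrightarrow> f x = g x"
  shows "sphere_integral r f = sphere_integral r g"
  unfolding sphere_integral_def set_lebesgue_integral_def
  by (rule Bochner_Integration.integral_cong) (use assms in \<open>auto simp: indicator_def\<close>)

lemma sphere_integral_linear:
  fixes f g :: "'a::euclidean_space \<Rightarrow> real"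
  assumes f: "continuous_on (ball 0 \<rho>) f" and g: "continuous_on (ball 0 \<rho>) g" and r: "0 < r" "r < \<rho>"
  shows "sphere_integral r (\<lambda>x. a * f x + b * g x) = a * sphere_integral r f + b * sphere_integral r g"
proof -
  have sub: "sphere (0::'a) r \<subseteq> ball 0 \<rho>" using r by auto
  have "cone_integral r (\<lambda>x. a * f x + b * g x) = a * cone_integral r f + b * cone_integral r g"
    using set_integrable_radial[OF f r, of 1] set_integrable_radial[OF g r, of 1]
    by (simp add: cone_integral_def set_integral_add)
  moreover have "continuous_on (sphere 0 r) f" "continuous_on (sphere 0 r) g"
    using f g sub by (auto intro: continuous_on_subset)
  ultimately show ?thesis
    using r by (simp add: sphere_integral_eq continuous_on_add continuous_on_mult_left algebra_simps)
qed

lemma sphere_integral_nonneg: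
  fixes f :: "'a::euclidean_space \<Rightarrow> real"
  assumes "r > 0" "continuous_on (sphere 0 r) f" "\<And>x. norm x = r \<Longrightarrow> 0 \<le> f x"
  shows "0 \<le> sphere_integral r f"
  unfolding sphere_integral_def set_lebesgue_integral_def
  by (rule Bochner_Integration.integral_nonneg) (use assms in \<open>auto simp: indicator_def\<close>)

section \<open>Reflection in the thin hyperplane\<close>

definition upper :: "'m::finite space set"
  where "upper = {x \<in> ball 0 1. snd x \<ge> 0}"

text \<open>Composition with this map turns data on the upper half ball into an even function on the
  full ball. It preserves norms and commutes with positive scaling, so it respects spheres and
  rays.\<close>

definition fold_up :: "'m::finite space \<Rightarrow> 'm space"
  where "fold_up x = (fst x, \<bar>snd x\<bar>)"

definition reflect :: "'m::finite space \<Rightarrow> 'm space"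
  where "reflect x = (fst x, - snd x)"

lemma norm_fold_up [simp]: "norm (fold_up x) = norm x"
  by (cases x) (simp add: fold_up_def norm_Pair)

lemma norm_reflect [simp]: "norm (reflect x) = norm x"
  by (cases x) (simp add: reflect_def norm_Pair)

lemma snd_fold_up [simp]: "snd (fold_up x) = \<bar>snd x\<bar>"
  by (simp add: fold_up_def)

lemma fold_up_scaleR: "c \<ge> 0 \<Longrightarrow> fold_up (c *\<^sub>R x) = c *\<^sub>R fold_up x"
  by (simp add: fold_up_def prod_eq_iff abs_mult)

lemma fold_up_nonneg: "snd x \<ge> 0 \<Longrightarrow> fold_up x = x"
  by (simp add: fold_up_def prod_eq_iff)

lemma fold_up_nonpos: "snd x \<le> 0 \<Longrightarrow> fold_up x = reflect x"
  by (simp add: fold_up_def reflect_def)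

lemma fold_up_upper: "norm x < 1 \<Longrightarrow> fold_up x \<in> upper"
  by (simp add: upper_def)

lemma fold_up_half_ball: "norm x < 1 \<Longrightarrow> snd x \<noteq> 0 \<Longrightarrow> fold_up x \<in> half_ball"
  by (simp add: half_ball_def)

lemma continuous_on_fold_up: "continuous_on S fold_up"
  unfolding fold_up_def by (intro continuous_intros)

lemma continuous_on_compose_fold_up:
  assumes "continuous_on upper f"
  shows "continuous_on (ball 0 1) (\<lambda>x. f (fold_up x))"
  by (rule continuous_on_compose2[OF assms continuous_on_fold_up]) (auto simp: fold_up_upper)

lemma half_ball_subset: "half_ball \<subseteq> upper"
  by (auto simp: half_ball_def upper_def)

lemma upper_eq: "upper = half_ball \<union> thin_ball 1"
  by (auto simp: half_ball_def upper_def thin_ball_def)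

lemma open_half_ball: "open (half_ball :: 'm::finite space set)"
proof -
  have eq: "half_ball = ball 0 1 \<inter> (snd :: 'm space \<Rightarrow> real) -` {0<..}"
    by (auto simp: half_ball_def)
  show ?thesis
    unfolding eq by (intro open_Int open_vimage open_ball open_greaterThan continuous_on_snd continuous_on_id)
qed

lemma snd_eq_inner: "snd x = x \<bullet> (0, 1 :: real)"
  by (simp add: inner_prod_def)

lemma zero_one_in_Basis: "(0, 1 :: real) \<in> Basis"
  by (simp add: Basis_prod_def)

lemma AE_snd_nonzero: "AE x in lborel. snd (x :: 'm::finite space) \<noteq> 0"
proof -
  have "negligible {x :: 'm space. (0, 1) \<bullet> x = 0}"
    by (rule negligible_hyperplane) (simp add: zero_prod_def)
  also have "{x :: 'm space. (0, 1) \<bullet> x = 0} = {x. snd x = 0}"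
    by (simp add: inner_prod_def)
  finally have "{x :: 'm space. snd x = 0} \<in> null_sets lebesgue"
    by (simp add: negligible_iff_null_sets)
  moreover have "closed {x :: 'm space. snd x = 0}"
    by (intro closed_Collect_eq continuous_intros)
  ultimately have "{x :: 'm space. snd x = 0} \<in> null_sets lborel"
    by (simp add: null_sets_completion_iff)
  then show ?thesis by (auto dest: AE_not_in)
qed

text \<open>The reflection is the diagonal map with entry \<open>-1\<close> in the last coordinate
  and \<open>1\<close> elsewhere, so its determinant has modulus one.\<close>

lemma distr_reflect: "distr lborel borel reflect = (lborel :: 'm::finite space measure)"
proof -
  let ?e = "(0, 1) :: 'm space"
  define c where "c = (\<lambda>j :: 'm space. if j = ?e then -1 else 1 :: real)"
  have T: "(0 + (\<Sum>j\<in>Basis. (c j * (x \<bullet> j)) *\<^sub>R j)) = reflect x" for x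
  proof -
    have "(\<Sum>j\<in>Basis. (c j * (x \<bullet> j)) *\<^sub>R j) =
        (\<Sum>j\<in>Basis. (x \<bullet> j) *\<^sub>R j - (if j = ?e then (2 * (x \<bullet> ?e)) *\<^sub>R ?e else 0))"
      by (intro sum.cong) (auto simp: c_def algebra_simps simp flip: scaleR_add_left)
    also have "\<dots> = x - (2 * snd x) *\<^sub>R ?e"
      by (simp add: sum_subtractf euclidean_representation zero_one_in_Basis snd_eq_inner)
    also have "\<dots> = reflect x" by (simp add: reflect_def prod_eq_iff)
    finally show ?thesis by simp
  qed
  have "lborel = density (distr lborel borel (\<lambda>x. 0 + (\<Sum>j\<in>Basis. (c j * (x \<bullet> j)) *\<^sub>R j)))
      (\<lambda>_. (\<Prod>j\<in>Basis. \<bar>c j\<bar>))"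
    by (rule lborel_affine_euclidean) (simp add: c_def)
  also have "(\<Prod>j\<in>Basis. \<bar>c j\<bar>) = 1" by (rule prod.neutral) (simp add: c_def)
  also have "(\<lambda>x. 0 + (\<Sum>j\<in>Basis. (c j * (x \<bullet> j)) *\<^sub>R j)) = reflect"
    using T by (intro ext)
  finally show ?thesis by (simp add: density_1)
qed

lemma measurable_reflect: "reflect \<in> borel_measurable borel"
  unfolding reflect_def by (intro borel_measurable_continuous_onI continuous_intros)

lemma integral_reflect:
  fixes f :: "'m::finite space \<Rightarrow> real"
  assumes "f \<in> borel_measurable borel"
  shows "(\<integral>x. f (reflect x) \<partial>lborel) = (\<integral>x. f x \<partial>lborel)"
  using integral_distr[of reflect lborel borel f, symmetric] measurable_reflect assms
  by (simp add: distr_reflect)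

lemma integrable_reflect:
  fixes f :: "'m::finite space \<Rightarrow> real"
  assumes "integrable lborel f"
  shows "integrable lborel (\<lambda>x. f (reflect x))"
  using integrable_distr_eq[of reflect lborel borel f] measurable_reflect assms
  by (simp add: distr_reflect)

text \<open>The folded integrand is the integrand on the upper half plus its mirror image on the
  lower half. Vanishing on the thin hyperplane makes this decomposition hold at every point.\<close>

lemma integral_fold_up_eq_0:
  fixes f :: "'m::finite space \<Rightarrow> real"
  assumes int: "set_integrable lborel half_ball f" "(LINT x:half_ball|lborel. f x) = 0"
    and thin: "\<And>x. snd x = 0 \<Longrightarrow> f x = 0"
  shows "(LINT x:ball 0 1|lborel. f (fold_up x)) = 0"
proof -
  define F where "F = (\<lambda>x. indicator half_ball x *\<^sub>R f x)"
  have I: "integrable lborel F" "(\<integral>x. F x \<partial>lborel) = 0"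
    using int by (simp_all add: F_def set_integrable_def set_lebesgue_integral_def)
  have "indicator (ball 0 1) x *\<^sub>R f (fold_up x) = F x + F (reflect x)" for x
  proof (cases "snd x" "0::real" rule: linorder_cases)
    case less
    then show ?thesis
      by (simp add: F_def indicator_def half_ball_def fold_up_nonpos) (simp add: reflect_def)
  next
    case equal
    then show ?thesis using thin[of "fold_up x"] thin[of x]
      by (simp add: F_def indicator_def half_ball_def) (simp add: reflect_def)
  next
    case greater
    then show ?thesis
      by (simp add: F_def indicator_def half_ball_def fold_up_nonneg) (simp add: reflect_def)
  qed
  then have "(LINT x:ball 0 1|lborel. f (fold_up x)) = (\<integral>x. F x + F (reflect x) \<partial>lborel)"
    by (simp add: set_lebesgue_integral_def)
  also have "\<dots> = 0"
    using I integrable_reflect[OF I(1)] integral_reflect[of F] borel_measurable_integrable[OF I(1)] by simp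
  finally show ?thesis .
qed

text \<open>The gradient is a parameter because on the thin ball only the continuous extension of
  the interior gradient is meant; no derivative is demanded at the points of the thin ball
  themselves.\<close>

definition C1_up_to_thin :: "('m::finite space \<Rightarrow> real) \<Rightarrow> ('m space \<Rightarrow> 'm space) \<Rightarrow> bool"
  where "C1_up_to_thin f g \<longleftrightarrow> continuous_on upper f \<and> continuous_on upper g \<and>
    (\<forall>x\<in>half_ball. GDERIV f x :> g x)"

text \<open>A ray off the thin hyperplane folds onto the ray of \<open>\<theta>\<close> inside the
  open half ball, where the chain rule applies. All other rays form a null set.\<close>

lemma has_derivative_cone_integral_fold_up:
  fixes f :: "'m::finite space \<Rightarrow> real"
  assumes fg: "C1_up_to_thin f g" and r: "0 < r" "r < 1"
  shows "((\<lambda>s. cone_integral s (\<lambda>x. f (fold_up x))) has_real_derivative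
    cone_integral r (\<lambda>x. fold_up x \<bullet> g (fold_up x)) / r) (at r)"
proof (rule has_derivative_cone_integral[where \<rho> = 1])
  show "continuous_on (ball 0 1) (\<lambda>x. f (fold_up x))"
    using fg by (intro continuous_on_compose_fold_up) (simp add: C1_up_to_thin_def)
  show "continuous_on (ball 0 1) (\<lambda>x. fold_up x \<bullet> g (fold_up x))"
    using fg by (intro continuous_on_inner continuous_on_fold_up continuous_on_compose_fold_up)
      (simp add: C1_up_to_thin_def)
  show "AE x in lborel. \<forall>t\<in>{0<..<1}. ((\<lambda>s. f (fold_up ((s / norm x) *\<^sub>R x))) has_real_derivative
      fold_up ((t / norm x) *\<^sub>R x) \<bullet> g (fold_up ((t / norm x) *\<^sub>R x)) / t) (at t)"
    using AE_snd_nonzero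
  proof eventually_elim
    case (elim x)
    then have x: "norm x > 0" by auto
    define \<theta> where "\<theta> = (1 / norm x) *\<^sub>R fold_up x"
    have \<theta>: "fold_up ((t / norm x) *\<^sub>R x) = t *\<^sub>R \<theta>" if "t > 0" for t
      using that by (simp add: \<theta>_def fold_up_scaleR)
    show ?case
    proof
      fix t :: real assume t: "t \<in> {0<..<1}"
      have "t *\<^sub>R \<theta> \<in> half_ball"
        unfolding \<theta>[symmetric, of t] using t elim x \<theta>[of t, symmetric]
        by (auto intro!: fold_up_half_ball)
      then have "GDERIV f (t *\<^sub>R \<theta>) :> g (t *\<^sub>R \<theta>)" using fg by (simp add: C1_up_to_thin_def)
      then have "((\<lambda>s. f (s *\<^sub>R \<theta>)) has_derivative (\<lambda>h. (h *\<^sub>R \<theta>) \<bullet> g (t *\<^sub>R \<theta>))) (at t)"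
        by (intro has_derivative_compose[where f = "\<lambda>s. s *\<^sub>R \<theta>" and g = f])
           (auto simp: gderiv_def intro!: derivative_eq_intros)
      then have "((\<lambda>s. f (s *\<^sub>R \<theta>)) has_real_derivative \<theta> \<bullet> g (t *\<^sub>R \<theta>)) (at t)"
        by (simp add: has_field_derivative_def mult_commute_abs)
      then have "((\<lambda>s. f (fold_up ((s / norm x) *\<^sub>R x))) has_real_derivative \<theta> \<bullet> g (t *\<^sub>R \<theta>)) (at t)"
        by (rule has_field_derivative_transform_within_open[where S = "{0<..}"]) (use t \<theta> in auto)
      then show "((\<lambda>s. f (fold_up ((s / norm x) *\<^sub>R x))) has_real_derivative
          fold_up ((t / norm x) *\<^sub>R x) \<bullet> g (fold_up ((t / norm x) *\<^sub>R x)) / t) (at t)"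
        using t \<theta>[of t] by simp
    qed
  qed
qed (use r in auto)

text \<open>The usual quotient \<open>q t / (q t + q (1 - t))\<close>, with
  \<open>(max 0 t)\<^sup>2\<close> for \<open>q\<close> in place of \<open>exp (- 1 / t)\<close>,
  since one continuous derivative is enough for the cutoffs. Strict positivity of \<open>s'\<close>
  on \<open>(0,1)\<close> later makes a radial cutoff strictly decreasing across a shell.\<close>

lemma smooth_step_exists:
  obtains s s' :: "real \<Rightarrow> real" where
    "\<And>t. (s has_real_derivative s' t) (at t)" "continuous_on UNIV s'"
    "\<And>t. t \<le> 0 \<Longrightarrow> s t = 0" "\<And>t. t \<ge> 1 \<Longrightarrow> s t = 1"
    "\<And>t. t \<le> 0 \<Longrightarrow> s' t = 0" "\<And>t. t \<ge> 1 \<Longrightarrow> s' t = 0"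
    "\<And>t. s' t \<ge> 0" "\<And>t. 0 < t \<Longrightarrow> t < 1 \<Longrightarrow> s' t > 0" "\<And>t. 0 \<le> s t" "\<And>t. s t \<le> 1"
proof -
  define q where "q = (\<lambda>t::real. (max 0 t)\<^sup>2)"
  define q' where "q' = (\<lambda>t::real. 2 * max 0 t)"
  have q: "(q has_real_derivative q' t) (at t)" for t
  proof (cases t "0::real" rule: linorder_cases)
    case less
    have "((\<lambda>t. 0) has_real_derivative q' t) (at t)" using less by (simp add: q'_def)
    then show ?thesis
      by (rule has_field_derivative_transform_within_open[where S = "{..<0}"]) (use less in \<open>auto simp: q_def\<close>)
  next
    case equal
    have lim: "((\<lambda>h::real. max 0 h) \<longlongrightarrow> max 0 0) (at 0)" by (intro tendsto_intros)
    have "((\<lambda>h. (q h - q 0) / (h - 0)) \<longlongrightarrow> max 0 0) (at 0)"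
    proof (rule Lim_transform_eventually[OF lim])
      show "\<forall>\<^sub>F h in at 0. max 0 h = (q h - q 0) / (h - 0)"
        by (auto simp: eventually_at_filter q_def max_def power2_eq_square)
    qed
    then show ?thesis using equal by (simp add: has_field_derivative_iff q'_def)
  next
    case greater
    have "((\<lambda>t. t\<^sup>2) has_real_derivative q' t) (at t)"
      using greater by (auto simp: q'_def intro!: derivative_eq_intros)
    then show ?thesis
      by (rule has_field_derivative_transform_within_open[where S = "{0<..}"]) (use greater in \<open>auto simp: q_def\<close>)
  qed
  have qc: "continuous_on UNIV q" "continuous_on UNIV q'" unfolding q_def q'_def by (intro continuous_intros)+
  have nn: "q t \<ge> 0" "q' t \<ge> 0" for t by (auto simp: q_def q'_def)
  have q1: "((\<lambda>t. q (1 - t)) has_real_derivative - q' (1 - t)) (at t)" for t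
  proof -
    have "((\<lambda>t::real. 1 - t) has_real_derivative -1) (at t)" by (auto intro!: derivative_eq_intros)
    from DERIV_chain2[OF q this] show ?thesis by simp
  qed
  define D where "D = (\<lambda>t. q t + q (1 - t))"
  have D: "D t > 0" for t
  proof (cases "t > 0")
    case True then have "q t > 0" by (simp add: q_def) then show ?thesis using nn[of "1 - t"] by (simp add: D_def)
  next
    case False then have "q (1 - t) > 0" by (simp add: q_def) then show ?thesis using nn[of t] by (simp add: D_def)
  qed
  define s where "s = (\<lambda>t. q t / D t)"
  define s' where "s' = (\<lambda>t. (q' t * q (1 - t) + q t * q' (1 - t)) / (D t)\<^sup>2)"
  show ?thesis
  proof (rule that[of s s'])
    show "(s has_real_derivative s' t) (at t)" for t
    proof -
      have "((\<lambda>t. q t + q (1 - t)) has_real_derivative q' t + - q' (1 - t)) (at t)"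
        by (intro DERIV_add q q1)
      then have "(D has_real_derivative q' t + - q' (1 - t)) (at t)" by (simp add: D_def)
      then have "(s has_real_derivative (q' t * D t - q t * (q' t + - q' (1 - t))) / (D t * D t)) (at t)"
        unfolding s_def using D[of t] by (intro DERIV_divide q) auto
      also have "(q' t * D t - q t * (q' t + - q' (1 - t))) / (D t * D t) = s' t"
        by (simp add: s'_def D_def power2_eq_square algebra_simps)
      finally show ?thesis .
    qed
    have c1: "continuous_on UNIV (\<lambda>t. q (1 - t))" "continuous_on UNIV (\<lambda>t. q' (1 - t))"
      by (rule continuous_on_compose2[OF qc(1)], auto intro!: continuous_intros)
         (rule continuous_on_compose2[OF qc(2)], auto intro!: continuous_intros)
    show "continuous_on UNIV s'"
      unfolding s'_def
    proof (intro continuous_on_divide continuous_on_add continuous_on_mult continuous_on_power qc c1 ballI)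
      show "continuous_on UNIV D" unfolding D_def by (intro continuous_on_add qc c1)
      show "(D t)\<^sup>2 \<noteq> 0" for t using D[of t] by simp
    qed
    show "t \<ge> 1 \<Longrightarrow> s t = 1" for t using D[of t] by (simp add: s_def D_def q_def)
    show "0 < t \<Longrightarrow> t < 1 \<Longrightarrow> s' t > 0" for t
      using D[of t] by (auto simp: s'_def q_def q'_def intro!: divide_pos_pos add_pos_pos)
    show "s' t \<ge> 0" for t using D[of t] nn by (auto simp: s'_def)
    show "0 \<le> s t" for t using D[of t] nn by (auto simp: s_def)
    show "s t \<le> 1" for t using D[of t] nn[of "1 - t"] by (simp add: s_def D_def divide_simps)
  qed (auto simp: s_def s'_def q_def q'_def)
qed

section \<open>Green inequality in the half ball\<close>

text \<open>Divergence free, with \<open>DV b\<close> the gradient of the component along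
  \<open>b\<close>. The first derivatives are continuous in the open half ball only, whereas
  \<open>V\<close> is continuous up to the thin ball: this is the regularity of the gradient of a
  Signorini solution.\<close>

definition solenoidal :: "('m::finite space \<Rightarrow> 'm space) \<Rightarrow> bool"
  where "solenoidal V \<longleftrightarrow> continuous_on upper V \<and>
    (\<exists>DV. (\<forall>b\<in>Basis. continuous_on half_ball (DV b) \<and> (\<forall>x\<in>half_ball. GDERIV (\<lambda>y. V y \<bullet> b) x :> DV b x)) \<and>
      (\<forall>x\<in>half_ball. (\<Sum>b\<in>Basis. DV b x \<bullet> b) = 0))"

lemma solenoidal_const: "solenoidal (\<lambda>x. c)"
  unfolding solenoidal_def
  by (intro conjI exI[of _ "\<lambda>b x. 0"]) (auto simp: GDERIV_const)

lemma set_integrable_ball_support: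
  fixes f :: "'a::euclidean_space \<Rightarrow> real"
  assumes f: "continuous_on (ball 0 1) f" and b: "b < 1" and zero: "\<And>x. b \<le> norm x \<Longrightarrow> norm x < 1 \<Longrightarrow> f x = 0"
  shows "set_integrable lborel (ball 0 1) f"
proof -
  obtain C where C: "C \<ge> 0" "\<And>x. norm x \<le> b \<Longrightarrow> \<bar>f x\<bar> \<le> C" using continuous_ball_bounded[OF f b] by blast
  show ?thesis
  proof (rule set_integrable_bounded[where C = C])
    show "\<bar>f x\<bar> \<le> C" if "x \<in> ball 0 1" for x
      using C zero[of x] that by (cases "norm x \<le> b") auto
  qed (use f in \<open>auto intro: set_borel_measurable_continuous_borel\<close>)
qed

text \<open>Radial cutoffs. That \<open>\<phi>\<close> is constant up to the positive radius
  \<open>a\<close> removes the singularity of \<open>\<phi>' (norm x) / norm x\<close> at the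
  origin; that it vanishes from \<open>b < 1\<close> on means that no control near the unit sphere
  is required.\<close>

locale cutoff =
  fixes \<phi> \<phi>' :: "real \<Rightarrow> real" and a b :: real
  assumes deriv: "\<And>t. (\<phi> has_real_derivative \<phi>' t) (at t)"
    and cont: "continuous_on UNIV \<phi>'"
    and ab: "0 < a" "b < 1"
    and inner: "\<And>t. t \<le> a \<Longrightarrow> \<phi>' t = 0"
    and outer: "\<And>t. b \<le> t \<Longrightarrow> \<phi> t = 0" "\<And>t. b \<le> t \<Longrightarrow> \<phi>' t = 0"
    and nonneg: "\<And>t. 0 \<le> \<phi> t"
begin

lemma cont_\<phi>: "continuous_on UNIV \<phi>"
  using deriv by (meson DERIV_isCont continuous_at_imp_continuous_on)

lemma cont_norm: "continuous_on S (\<lambda>x. \<phi> (norm x))" "continuous_on S (\<lambda>x. \<phi>' (norm x))"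
  by (rule continuous_on_compose2[OF cont_\<phi>], auto intro!: continuous_intros)
     (rule continuous_on_compose2[OF cont], auto intro!: continuous_intros)

lemma cont_quotient: "continuous_on S (\<lambda>x::'a::real_normed_vector. \<phi>' (norm x) / norm x)"
proof (rule continuous_on_subset)
  have "continuous_on (ball 0 a \<union> - {0}) (\<lambda>x::'a. \<phi>' (norm x) / norm x)"
  proof (rule continuous_on_open_Un)
    show "continuous_on (ball 0 a) (\<lambda>x::'a. \<phi>' (norm x) / norm x)"
      by (rule continuous_on_eq[of _ "\<lambda>_. 0"]) (auto simp: inner)
    show "continuous_on (- {0}) (\<lambda>x::'a. \<phi>' (norm x) / norm x)"
      by (intro continuous_intros cont_norm) auto
  qed auto
  moreover have "ball 0 a \<union> - {0} = (UNIV :: 'a set)" using ab by auto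
  ultimately show "continuous_on UNIV (\<lambda>x::'a. \<phi>' (norm x) / norm x)" by simp
qed auto

text \<open>The field \<open>\<psi> \<phi> \<eta> V\<close> has compact support in the open half
  ball, so its divergence has integral zero. Since \<open>V\<close> is divergence free, only
  derivatives of \<open>\<psi>\<close>, \<open>\<phi>\<close> and \<open>\<eta>\<close> survive in
  the product rule, and these make sense up to the thin ball. Folding doubles the identity to the
  full ball.\<close>

lemma divergence_identity:
  fixes V :: "'m::finite space \<Rightarrow> 'm space"
  assumes V: "solenoidal V" and \<eta>: "C1_up_to_thin \<eta> g"
    and \<psi>: "\<And>t. (\<psi> has_real_derivative \<psi>' t) (at t)" "continuous_on UNIV \<psi>'"
    and \<epsilon>: "\<epsilon> > 0" and \<psi>0: "\<And>t. t \<le> \<epsilon> \<Longrightarrow> \<psi> t = 0" "\<And>t. t \<le> \<epsilon> \<Longrightarrow> \<psi>' t = 0"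
  shows "(LINT x:ball 0 1|lborel.
      \<psi> \<bar>snd x\<bar> * (\<phi> (norm x) * (V (fold_up x) \<bullet> g (fold_up x)) +
        \<phi>' (norm x) / norm x * (\<eta> (fold_up x) * (fold_up x \<bullet> V (fold_up x)))) +
      \<psi>' \<bar>snd x\<bar> * \<phi> (norm x) * (snd (V (fold_up x)) * \<eta> (fold_up x))) = 0"
proof -
  obtain DV where DV: "\<And>b. b \<in> Basis \<Longrightarrow> continuous_on half_ball (DV b)"
      "\<And>b x. b \<in> Basis \<Longrightarrow> x \<in> half_ball \<Longrightarrow> GDERIV (\<lambda>y. V y \<bullet> b) x :> DV b x"
      "\<And>x. x \<in> half_ball \<Longrightarrow> (\<Sum>b\<in>Basis. DV b x \<bullet> b) = 0"
    using V unfolding solenoidal_def by blast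
  have Vc: "continuous_on half_ball V"
    using V unfolding solenoidal_def by (blast intro: continuous_on_subset[OF _ half_ball_subset])
  have \<eta>c: "continuous_on half_ball \<eta>" "continuous_on half_ball g"
    and \<eta>d: "\<And>x. x \<in> half_ball \<Longrightarrow> GDERIV \<eta> x :> g x"
    using \<eta> unfolding C1_up_to_thin_def by (blast intro: continuous_on_subset[OF _ half_ball_subset])+
  have \<psi>c: "continuous_on UNIV \<psi>"
    using \<psi>(1) by (meson DERIV_isCont continuous_at_imp_continuous_on)
  define cut where "cut = (\<lambda>x::'m space. \<psi> (snd x) * \<phi> (norm x))"
  define gcut where "gcut = (\<lambda>x::'m space. \<psi> (snd x) *\<^sub>R (\<phi>' (norm x) *\<^sub>R sgn x) + \<phi> (norm x) *\<^sub>R (\<psi>' (snd x) *\<^sub>R (0, 1)))"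
  \<comment> \<open>\<open>G b\<close> is the gradient of the \<open>b\<close>-component of the
    field \<open>cut * \<eta> * V\<close>, so the sum of all \<open>G b x \<bullet> b\<close> is its
    divergence; \<open>F\<close> is this divergence after the divergence of \<open>V\<close> has
    dropped out.\<close>
  define G where "G = (\<lambda>b x. cut x *\<^sub>R (\<eta> x *\<^sub>R DV b x + (V x \<bullet> b) *\<^sub>R g x) + (\<eta> x * (V x \<bullet> b)) *\<^sub>R gcut x)"
  define F where "F = (\<lambda>x. \<psi> (snd x) * (\<phi> (norm x) * (V x \<bullet> g x) + \<phi>' (norm x) / norm x * (\<eta> x * (x \<bullet> V x))) +
      \<psi>' (snd x) * \<phi> (norm x) * (snd (V x) * \<eta> x))"
  have nz: "x \<noteq> 0" if "x \<in> half_ball" for x :: "'m space" using that by (auto simp: half_ball_def)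
  have cutd: "GDERIV cut x :> gcut x" if "x \<in> half_ball" for x
  proof -
    have "GDERIV snd x :> ((0, 1) :: 'm space)"
      unfolding gderiv_def by (auto simp: inner_prod_def intro!: derivative_eq_intros)
    then show ?thesis
      unfolding cut_def gcut_def using nz[OF that] \<psi>(1) deriv
      by (intro GDERIV_mult GDERIV_DERIV_compose[where g = \<psi>] GDERIV_DERIV_compose[where g = \<phi>] GDERIV_norm) auto
  qed
  have snc: "continuous_on half_ball (\<lambda>x::'m space. \<psi> (snd x))" "continuous_on half_ball (\<lambda>x::'m space. \<psi>' (snd x))"
    by (rule continuous_on_compose2[OF \<psi>c], auto intro!: continuous_intros)
       (rule continuous_on_compose2[OF \<psi>(2)], auto intro!: continuous_intros)
  have cutc: "continuous_on half_ball cut" "continuous_on half_ball gcut"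
    unfolding cut_def gcut_def using nz
    by (intro continuous_intros snc cont_norm; auto)+
  \<comment> \<open>A compact set outside of which the field vanishes: \<open>\<psi>\<close> keeps
    it away from the thin ball, \<open>\<phi>\<close> from the unit sphere.\<close>
  define K where "K = {x :: 'm space. norm x \<le> b \<and> \<epsilon> \<le> snd x}"
  have Kc: "compact K"
  proof -
    have "K = cball 0 b \<inter> {x. \<epsilon> \<le> snd x}" by (auto simp: K_def)
    moreover have "closed {x :: 'm space. \<epsilon> \<le> snd x}" by (intro closed_Collect_le continuous_intros)
    ultimately show ?thesis by (simp add: compact_Int_closed)
  qed
  have Ks: "K \<subseteq> half_ball" using \<epsilon> ab by (auto simp: K_def half_ball_def)
  have part: "(LINT x:half_ball|lborel. G b x \<bullet> b) = 0" "set_integrable lborel half_ball (\<lambda>x. G b x \<bullet> b)"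
    if b: "b \<in> Basis" for b
  proof -
    have d: "GDERIV (\<lambda>x. cut x * (\<eta> x * (V x \<bullet> b))) x :> G b x" if "x \<in> half_ball" for x
      unfolding G_def by (intro GDERIV_mult cutd \<eta>d DV b that)
    have c: "continuous_on half_ball (G b)"
      unfolding G_def by (intro continuous_intros cutc \<eta>c DV b Vc)
    have z: "cut x * (\<eta> x * (V x \<bullet> b)) = 0" if "x \<in> half_ball - K" for x
      using that \<psi>0 outer by (auto simp: cut_def K_def)
    show "(LINT x:half_ball|lborel. G b x \<bullet> b) = 0" "set_integrable lborel half_ball (\<lambda>x. G b x \<bullet> b)"
      using set_integral_directional_derivative_eq_0[OF open_half_ball Kc Ks d c z] by auto
  qed
  have sum: "(\<Sum>b\<in>Basis. G b x \<bullet> b) = F x" if "x \<in> half_ball" for x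
  proof -
    have "(\<Sum>b\<in>Basis. G b x \<bullet> b) = cut x * (\<eta> x * (\<Sum>b\<in>Basis. DV b x \<bullet> b) + (\<Sum>b\<in>Basis. (V x \<bullet> b) * (g x \<bullet> b)))
       + \<eta> x * (\<Sum>b\<in>Basis. (V x \<bullet> b) * (gcut x \<bullet> b))"
      by (simp add: G_def inner_add_left sum.distrib sum_distrib_left algebra_simps)
    also have "\<dots> = cut x * (V x \<bullet> g x) + \<eta> x * (V x \<bullet> gcut x)"
      using DV(3)[OF that] by (simp flip: euclidean_inner)
    also have "V x \<bullet> gcut x = \<psi> (snd x) * \<phi>' (norm x) / norm x * (x \<bullet> V x) + \<phi> (norm x) * \<psi>' (snd x) * snd (V x)"
    proof -
      have "V x \<bullet> (0, c) = c * snd (V x)" for c by (simp add: inner_prod_def)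
      then show ?thesis
        by (simp add: gcut_def inner_add_right sgn_div_norm divide_inverse inner_commute)
    qed
    finally show ?thesis by (simp add: cut_def F_def algebra_simps)
  qed
  have S: "indicator half_ball x *\<^sub>R F x = (\<Sum>b\<in>Basis. indicator half_ball x *\<^sub>R (G b x \<bullet> b))" for x
    using sum[of x] by (cases "x \<in> half_ball") auto
  have int: "set_integrable lborel half_ball F"
    unfolding set_integrable_def S using part(2) by (intro Bochner_Integration.integrable_sum) (simp add: set_integrable_def)
  have "(LINT x:half_ball|lborel. F x) = (\<Sum>b\<in>Basis. LINT x:half_ball|lborel. G b x \<bullet> b)"
    unfolding set_lebesgue_integral_def S
    using part(2) by (intro Bochner_Integration.integral_sum) (simp add: set_integrable_def)
  then have "(LINT x:half_ball|lborel. F x) = 0" using part(1) by simp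
  from integral_fold_up_eq_0[OF int this]
  have "(LINT x:ball 0 1|lborel. F (fold_up x)) = 0"
    using \<epsilon> \<psi>0 by (simp add: F_def)
  then show ?thesis by (simp add: F_def)
qed

text \<open>In \<open>divergence_identity\<close> let \<open>\<psi>\<close> tend to the indicator function of \<open>{0<..}\<close>. The term with \<open>\<psi>'\<close>
  concentrates on the thin ball, where the sign of \<open>V\<^sub>n \<eta>\<close> is known; the mass of \<open>\<psi>' \<phi>\<close> stays
  bounded by the same identity for the constant field \<open>(0, 1)\<close>.\<close>

lemma weak_inequality:
  fixes V :: "'m::finite space \<Rightarrow> 'm space"
  assumes V: "solenoidal V" and \<eta>: "C1_up_to_thin \<eta> g"
    and thin: "\<And>x. x \<in> upper \<Longrightarrow> snd x = 0 \<Longrightarrow> snd (V x) * \<eta> x \<le> 0"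
  shows "0 \<le> (LINT x:ball 0 1|lborel. \<phi> (norm x) * (V (fold_up x) \<bullet> g (fold_up x)) +
        \<phi>' (norm x) / norm x * (\<eta> (fold_up x) * (fold_up x \<bullet> V (fold_up x))))"
proof -
  define P where "P = (\<lambda>x::'m space. \<phi> (norm x) * (V (fold_up x) \<bullet> g (fold_up x)) +
        \<phi>' (norm x) / norm x * (\<eta> (fold_up x) * (fold_up x \<bullet> V (fold_up x))))"
  define Q where "Q = (\<lambda>x::'m space. \<phi>' (norm x) / norm x * \<bar>snd x\<bar>)"
  define R where "R = (\<lambda>x. snd (V x) * \<eta> x)"
  have c: "continuous_on upper V" "continuous_on upper \<eta>" "continuous_on upper g"
    using V \<eta> by (auto simp: solenoidal_def C1_up_to_thin_def)
  have Rc: "continuous_on upper R" unfolding R_def by (intro continuous_intros c)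
  have Rfc: "continuous_on (ball 0 1) (\<lambda>x. R (fold_up x))" by (rule continuous_on_compose_fold_up[OF Rc])
  have Pc: "continuous_on (ball 0 1) P"
  proof -
    have n1: "continuous_on (ball 0 1) (\<lambda>x. V (fold_up x) \<bullet> g (fold_up x))"
      by (rule continuous_on_compose_fold_up[where f = "\<lambda>x. V x \<bullet> g x"]) (intro continuous_intros c)
    have n2: "continuous_on (ball 0 1) (\<lambda>x. \<eta> (fold_up x) * (fold_up x \<bullet> V (fold_up x)))"
      by (rule continuous_on_compose_fold_up[where f = "\<lambda>x. \<eta> x * (x \<bullet> V x)"]) (intro continuous_intros c)
    show ?thesis
      unfolding P_def by (rule continuous_on_add[OF continuous_on_mult[OF cont_norm(1) n1] continuous_on_mult[OF cont_quotient n2]])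
  qed
  have Qc: "continuous_on (ball 0 1) Q"
    unfolding Q_def by (intro continuous_on_mult cont_quotient continuous_intros)
  have P0: "P x = 0" and Q0: "Q x = 0" if "b \<le> norm x" for x using that outer by (auto simp: P_def Q_def)
  obtain s s' :: "real \<Rightarrow> real" where s: "\<And>t. (s has_real_derivative s' t) (at t)" "continuous_on UNIV s'"
    "\<And>t. t \<le> 0 \<Longrightarrow> s t = 0" "\<And>t. t \<ge> 1 \<Longrightarrow> s t = 1"
    "\<And>t. t \<le> 0 \<Longrightarrow> s' t = 0" "\<And>t. t \<ge> 1 \<Longrightarrow> s' t = 0"
    "\<And>t. s' t \<ge> 0" "\<And>t. 0 \<le> s t" "\<And>t. s t \<le> 1"
    by (rule smooth_step_exists) blast
  \<comment> \<open>The shift by \<open>1\<close> makes \<open>\<psi> \<epsilon>\<close> vanish up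
    to \<open>\<epsilon>\<close>, so that the field stays off the thin ball; it equals one from
    \<open>2 * \<epsilon>\<close> on.\<close>
  define \<psi> where "\<psi> = (\<lambda>\<epsilon> t. s (t / \<epsilon> - 1))"
  define \<psi>' where "\<psi>' = (\<lambda>\<epsilon> t. s' (t / \<epsilon> - 1) / \<epsilon>)"
  have sc: "continuous_on UNIV s" using s(1) by (meson DERIV_isCont continuous_at_imp_continuous_on)
  have \<psi>d: "(\<psi> \<epsilon> has_real_derivative \<psi>' \<epsilon> t) (at t)" if "\<epsilon> > 0" for \<epsilon> t
  proof -
    have "((\<lambda>t. t / \<epsilon> - 1) has_real_derivative 1 / \<epsilon>) (at t)"
      using that by (auto intro!: derivative_eq_intros)
    from DERIV_chain2[OF s(1) this] show ?thesis by (simp add: \<psi>_def \<psi>'_def)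
  qed
  have \<psi>'c: "continuous_on S (\<psi>' \<epsilon>)" if "\<epsilon> > 0" for \<epsilon> and S
    unfolding \<psi>'_def
    by (intro continuous_on_divide continuous_on_compose2[OF s(2)] continuous_intros) (use that in auto)
  have \<psi>c: "continuous_on S (\<psi> \<epsilon>)" if "\<epsilon> > 0" for \<epsilon> and S
    unfolding \<psi>_def by (intro continuous_on_compose2[OF sc] continuous_intros) (use that in auto)
  have \<psi>0: "\<psi> \<epsilon> t = 0" "\<psi>' \<epsilon> t = 0" if "\<epsilon> > 0" "t \<le> \<epsilon>" for \<epsilon> t
    using that by (auto simp: \<psi>_def \<psi>'_def s)
  have sndc: "continuous_on (ball 0 1) (\<lambda>x::'m space. \<psi> \<epsilon> \<bar>snd x\<bar>)" "continuous_on (ball 0 1) (\<lambda>x::'m space. \<psi>' \<epsilon> \<bar>snd x\<bar>)"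
    if "\<epsilon> > 0" for \<epsilon>
    by (rule continuous_on_compose2[OF \<psi>c[OF that]], auto intro!: continuous_intros)
       (rule continuous_on_compose2[OF \<psi>'c[OF that]], auto intro!: continuous_intros)
  have outer_int: "set_integrable lborel (ball 0 1) f" if "continuous_on (ball 0 1) f" "\<And>x. b \<le> norm x \<Longrightarrow> f x = 0"
    for f :: "'m space \<Rightarrow> real"
    using that ab by (intro set_integrable_ball_support[where b = b])
  \<comment> \<open>For \<open>V = (0, 1)\<close> and \<open>\<eta> = 1\<close> the divergence
    identity says that the mass of \<open>\<psi>' \<phi>\<close> is minus the integral of
    \<open>\<psi> Q\<close>. As \<open>0 \<le> \<psi> \<le> 1\<close>, it is at most
    \<open>C0\<close>, whatever \<open>\<epsilon>\<close> is.\<close>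
  define C0 where "C0 = (LINT x:ball 0 1|lborel. \<bar>Q x\<bar>)"
  have intP: "set_integrable lborel (ball 0 1) (\<lambda>x. \<psi> \<epsilon> \<bar>snd x\<bar> * P x)"
    and intQ: "set_integrable lborel (ball 0 1) (\<lambda>x. \<psi> \<epsilon> \<bar>snd x\<bar> * Q x)"
    and intR: "set_integrable lborel (ball 0 1) (\<lambda>x. \<psi>' \<epsilon> \<bar>snd x\<bar> * \<phi> (norm x) * R (fold_up x))"
    and intS: "set_integrable lborel (ball 0 1) (\<lambda>x::'m space. \<psi>' \<epsilon> \<bar>snd x\<bar> * \<phi> (norm x))"
    if "\<epsilon> > 0" for \<epsilon>
    by (rule outer_int; (intro continuous_on_mult sndc that Pc Qc Rfc cont_norm)?; simp add: P0 Q0 outer)+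
  have intQ': "set_integrable lborel (ball 0 1) (\<lambda>x. \<bar>Q x\<bar>)"
    by (rule outer_int) (use Qc Q0 in \<open>auto intro: continuous_on_rabs\<close>)
  have C0: "C0 \<ge> 0" unfolding C0_def set_lebesgue_integral_def by (rule Bochner_Integration.integral_nonneg) auto
  have massb: "(LINT x:ball (0::'m space) 1|lborel. \<psi>' \<epsilon> \<bar>snd x\<bar> * \<phi> (norm x)) \<le> C0" if e: "\<epsilon> > 0" for \<epsilon>
  proof -
    have "C1_up_to_thin (\<lambda>x::'m space. 1) (\<lambda>x. 0)" by (simp add: C1_up_to_thin_def GDERIV_const)
    from divergence_identity[OF solenoidal_const[of "(0, 1)"] this \<psi>d[OF e] \<psi>'c[OF e] e \<psi>0[OF e]]
    have "(LINT x:ball (0::'m space) 1|lborel. \<psi> \<epsilon> \<bar>snd x\<bar> * Q x + \<psi>' \<epsilon> \<bar>snd x\<bar> * \<phi> (norm x)) = 0"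
      by (simp add: Q_def flip: snd_eq_inner)
    then have "(LINT x:ball (0::'m space) 1|lborel. \<psi>' \<epsilon> \<bar>snd x\<bar> * \<phi> (norm x)) = - (LINT x:ball 0 1|lborel. \<psi> \<epsilon> \<bar>snd x\<bar> * Q x)"
      using set_integral_add(2)[OF intQ[OF e] intS[OF e]] by simp
    also have "\<dots> = (LINT x:ball 0 1|lborel. - (\<psi> \<epsilon> \<bar>snd x\<bar> * Q x))"
      using intQ[OF e] by (simp add: set_lebesgue_integral_def)
    also have "\<dots> \<le> C0"
      unfolding C0_def
    proof (rule set_integral_mono)
      show "set_integrable lborel (ball 0 1) (\<lambda>x. - (\<psi> \<epsilon> \<bar>snd x\<bar> * Q x))"
        using intQ[OF e] by (simp add: set_integrable_def)
      show "- (\<psi> \<epsilon> \<bar>snd x\<bar> * Q x) \<le> \<bar>Q x\<bar>" for x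
      proof -
        have "\<bar>\<psi> \<epsilon> \<bar>snd x\<bar> * Q x\<bar> \<le> 1 * \<bar>Q x\<bar>"
          unfolding abs_mult using s(8,9)[of "\<bar>snd x\<bar> / \<epsilon> - 1"] by (intro mult_right_mono) (auto simp: \<psi>_def)
        then show ?thesis by linarith
      qed
    qed (rule intQ')
    finally show ?thesis .
  qed
  have lower: "\<exists>\<epsilon>0>0. \<forall>\<epsilon>. 0 < \<epsilon> \<longrightarrow> \<epsilon> < \<epsilon>0 \<longrightarrow> - (\<delta> * C0) \<le> (LINT x:ball 0 1|lborel. \<psi> \<epsilon> \<bar>snd x\<bar> * P x)"
    if \<delta>: "\<delta> > 0" for \<delta>
  proof -
    define K where "K = {x :: 'm space. norm x \<le> b \<and> 0 \<le> snd x}"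
    have "K = cball 0 b \<inter> {x. 0 \<le> snd x}" by (auto simp: K_def)
    moreover have "closed {x :: 'm space. 0 \<le> snd x}" by (intro closed_Collect_le continuous_intros)
    ultimately have "compact K" by (simp add: compact_Int_closed)
    moreover have "K \<subseteq> upper" using ab by (auto simp: K_def upper_def)
    ultimately have "uniformly_continuous_on K R"
      using Rc by (intro compact_uniformly_continuous) (auto intro: continuous_on_subset)
    then obtain \<epsilon>1 where \<epsilon>1: "\<epsilon>1 > 0" "\<And>x y. x \<in> K \<Longrightarrow> y \<in> K \<Longrightarrow> dist y x < \<epsilon>1 \<Longrightarrow> dist (R y) (R x) < \<delta>"
      using \<delta> unfolding uniformly_continuous_on_def by metis
    \<comment> \<open>Comparison with the foot point \<open>y\<close> of \<open>x\<close> on the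
      thin ball, where \<open>R\<close> is at most zero.\<close>
    have Rb: "R x \<le> \<delta>" if "norm x \<le> b" "0 \<le> snd x" "snd x < \<epsilon>1" for x
    proof -
      define y where "y = (fst x, 0 :: real)"
      have ny: "norm y \<le> norm x" by (cases x) (simp add: y_def norm_Pair)
      have "dist x y < \<epsilon>1" using that by (cases x) (simp add: y_def dist_Pair_Pair)
      then have "dist (R x) (R y) < \<delta>" by (intro \<epsilon>1(2)) (use that ny in \<open>auto simp: K_def y_def\<close>)
      moreover have "R y \<le> 0" unfolding R_def
        by (intro thin) (use that ny ab in \<open>auto simp: upper_def y_def\<close>)
      ultimately show ?thesis by (auto simp: dist_real_def)
    qed
    show ?thesis
    \<comment> \<open>\<open>\<psi>' \<epsilon>\<close> lives between \<open>\<epsilon>\<close> and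
      \<open>2 * \<epsilon>\<close>; with \<open>\<epsilon> < \<epsilon>1 / 2\<close> this lies in
      the strip where \<open>R \<le> \<delta>\<close> is known.\<close>
    proof (intro exI[of _ "\<epsilon>1 / 2"] conjI allI impI)
      fix \<epsilon> assume e: "0 < \<epsilon>" "\<epsilon> < \<epsilon>1 / 2"
      have "(LINT x:ball 0 1|lborel. \<psi>' \<epsilon> \<bar>snd x\<bar> * \<phi> (norm x) * R (fold_up x)) \<le>
          (LINT x:ball (0::'m space) 1|lborel. \<delta> * (\<psi>' \<epsilon> \<bar>snd x\<bar> * \<phi> (norm x)))"
      proof (rule set_integral_mono)
        show "set_integrable lborel (ball 0 1) (\<lambda>x. \<psi>' \<epsilon> \<bar>snd x\<bar> * \<phi> (norm x) * R (fold_up x))" by (rule intR[OF e(1)])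
        show "set_integrable lborel (ball (0::'m space) 1) (\<lambda>x. \<delta> * (\<psi>' \<epsilon> \<bar>snd x\<bar> * \<phi> (norm x)))"
          using intS[OF e(1)] by simp
        fix x :: "'m space" assume x: "x \<in> ball 0 1"
        show "\<psi>' \<epsilon> \<bar>snd x\<bar> * \<phi> (norm x) * R (fold_up x) \<le> \<delta> * (\<psi>' \<epsilon> \<bar>snd x\<bar> * \<phi> (norm x))"
        proof (cases "norm x \<le> b \<and> \<bar>snd x\<bar> < \<epsilon>1")
          case True
          then have "R (fold_up x) \<le> \<delta>" by (intro Rb) auto
          moreover have "0 \<le> \<psi>' \<epsilon> \<bar>snd x\<bar> * \<phi> (norm x)" using nonneg s(7) e by (simp add: \<psi>'_def)
          ultimately show ?thesis by (metis mult.commute mult_left_mono)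
        next
          case False
          then have "\<phi> (norm x) = 0 \<or> \<psi>' \<epsilon> \<bar>snd x\<bar> = 0"
          proof (cases "norm x \<le> b")
            case True
            then have "\<bar>snd x\<bar> / \<epsilon> - 1 \<ge> 1" using False e by (simp add: divide_simps)
            then show ?thesis by (simp add: \<psi>'_def s)
          qed (simp add: outer)
          then show ?thesis by auto
        qed
      qed
      also have "\<dots> = \<delta> * (LINT x:ball (0::'m space) 1|lborel. (\<psi>' \<epsilon> \<bar>snd x\<bar> * \<phi> (norm x)))" by simp
      also have "\<dots> \<le> \<delta> * C0" using massb[OF e(1)] \<delta> by (intro mult_left_mono) auto
      finally have 1: "(LINT x:ball 0 1|lborel. \<psi>' \<epsilon> \<bar>snd x\<bar> * \<phi> (norm x) * R (fold_up x)) \<le> \<delta> * C0" .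
      have "(LINT x:ball 0 1|lborel. \<psi> \<epsilon> \<bar>snd x\<bar> * P x + \<psi>' \<epsilon> \<bar>snd x\<bar> * \<phi> (norm x) * R (fold_up x)) = 0"
        unfolding P_def R_def
        by (rule divergence_identity[OF V \<eta> \<psi>d[OF e(1)] \<psi>'c[OF e(1)] e(1) \<psi>0[OF e(1)]])
      then show "- (\<delta> * C0) \<le> (LINT x:ball 0 1|lborel. \<psi> \<epsilon> \<bar>snd x\<bar> * P x)"
        using 1 set_integral_add(2)[OF intP[OF e(1)] intR[OF e(1)]] by simp
    qed (use \<epsilon>1 in auto)
  qed
  obtain C where C: "C \<ge> 0" "\<And>x. norm x \<le> b \<Longrightarrow> \<bar>P x\<bar> \<le> C" using continuous_ball_bounded[OF Pc ab(2)] by blast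
  have Pb: "\<bar>P x\<bar> \<le> C" for x using C P0[of x] by (cases "norm x \<le> b") auto
  have "((\<lambda>\<epsilon>. \<integral>x. indicator (ball 0 1) x *\<^sub>R (\<psi> \<epsilon> \<bar>snd x\<bar> * P x) \<partial>lborel) \<longlongrightarrow>
      (\<integral>x. indicator (ball 0 1) x *\<^sub>R P x \<partial>lborel)) (at 0 within {0<..})"
  proof (rule tendsto_integral_bounded[where A = "ball 0 1" and C = C])
    show "emeasure lborel (ball (0::'m space) 1) < \<infinity>" by (rule emeasure_bounded_finite) auto
    show "(\<lambda>x. indicator (ball 0 1) x *\<^sub>R (\<psi> \<epsilon> \<bar>snd x\<bar> * P x)) \<in> borel_measurable lborel" if "\<epsilon> \<in> {0<..}" for \<epsilon>
      using intP[of \<epsilon>] that unfolding set_integrable_def by auto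
    show "(\<lambda>x. indicator (ball 0 1) x *\<^sub>R P x) \<in> borel_measurable lborel"
      using borel_measurable_continuous_on_indicator[OF _ Pc] by simp
    show "AE x in lborel. x \<in> ball 0 1 \<longrightarrow> \<bar>indicator (ball 0 1) x *\<^sub>R (\<psi> \<epsilon> \<bar>snd x\<bar> * P x)\<bar> \<le> C" if "\<epsilon> \<in> {0<..}" for \<epsilon>
    proof (intro AE_I2 impI)
      fix x :: "'m space" assume "x \<in> ball 0 1"
      have "\<bar>\<psi> \<epsilon> \<bar>snd x\<bar>\<bar> * \<bar>P x\<bar> \<le> 1 * C"
        using Pb[of x] s(8,9)[of "\<bar>snd x\<bar> / \<epsilon> - 1"] by (intro mult_mono) (auto simp: \<psi>_def)
      then show "\<bar>indicator (ball 0 1) x *\<^sub>R (\<psi> \<epsilon> \<bar>snd x\<bar> * P x)\<bar> \<le> C"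
        using C by (auto simp: abs_mult indicator_def)
    qed
    show "AE x in lborel. ((\<lambda>\<epsilon>. indicator (ball 0 1) x *\<^sub>R (\<psi> \<epsilon> \<bar>snd x\<bar> * P x)) \<longlongrightarrow> indicator (ball 0 1) x *\<^sub>R P x) (at 0 within {0<..})"
      using AE_snd_nonzero
    proof eventually_elim
      case (elim x)
      have "\<forall>\<^sub>F \<epsilon> in at_right 0. \<epsilon> \<in> {0<..<\<bar>snd x\<bar> / 2}"
        using elim by (intro eventually_at_right_real) auto
      then have "\<forall>\<^sub>F \<epsilon> in at_right 0. indicator (ball 0 1) x *\<^sub>R P x = indicator (ball 0 1) x *\<^sub>R (\<psi> \<epsilon> \<bar>snd x\<bar> * P x)"
      proof eventually_elim
        case (elim \<epsilon>)
        then have "\<bar>snd x\<bar> / \<epsilon> - 1 \<ge> 1" by (simp add: divide_simps)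
        then show ?case by (simp add: \<psi>_def s)
      qed
      then show ?case by (rule Lim_transform_eventually[OF tendsto_const])
    qed
  qed auto
  then have lim: "((\<lambda>\<epsilon>. LINT x:ball 0 1|lborel. \<psi> \<epsilon> \<bar>snd x\<bar> * P x) \<longlongrightarrow> (LINT x:ball 0 1|lborel. P x)) (at_right 0)"
    by (simp only: set_lebesgue_integral_def)
  have bound: "- (\<delta> * C0) \<le> (LINT x:ball 0 1|lborel. P x)" if "\<delta> > 0" for \<delta>
  proof (rule tendsto_lowerbound[OF lim])
    from lower[OF that] show "\<forall>\<^sub>F \<epsilon> in at_right 0. - (\<delta> * C0) \<le> (LINT x:ball 0 1|lborel. \<psi> \<epsilon> \<bar>snd x\<bar> * P x)"
      unfolding eventually_at_right_field by auto
  qed simp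
  have "0 \<le> (LINT x:ball 0 1|lborel. P x) + e" if "e > 0" for e
  proof -
    \<comment> \<open>The \<open>1\<close> in the denominator covers the case
      \<open>C0 = 0\<close>.\<close>
    have "- (e / (C0 + 1) * C0) \<le> (LINT x:ball 0 1|lborel. P x)"
      using that C0 by (intro bound divide_pos_pos) auto
    moreover have "e / (C0 + 1) * C0 \<le> e" using that C0 by (simp add: divide_simps mult_left_mono)
    ultimately show ?thesis by linarith
  qed
  then have "0 \<le> (LINT x:ball 0 1|lborel. P x)" by (rule field_le_epsilon)
  then show ?thesis by (simp only: P_def)
qed

end

text \<open>This is Green's formula in the half ball with the integral over the thin ball dropped. Radial
  cutoffs localized near \<open>r\<close> recover the sphere from the weak form.\<close>

theorem sphere_integral_le_ball_integral:
  fixes V :: "'m::finite space \<Rightarrow> 'm space"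
  assumes V: "solenoidal V" and \<eta>: "C1_up_to_thin \<eta> g"
    and thin: "\<And>x. x \<in> upper \<Longrightarrow> snd x = 0 \<Longrightarrow> snd (V x) * \<eta> x \<le> 0"
    and r: "0 < r" "r < 1"
  shows "sphere_integral r (\<lambda>x. \<eta> (fold_up x) * (fold_up x \<bullet> V (fold_up x)))
    \<le> r * (LINT x:ball 0 r|lborel. V (fold_up x) \<bullet> g (fold_up x))"
proof (rule ccontr)
  define A where "A = (\<lambda>x. V (fold_up x) \<bullet> g (fold_up x))"
  define B where "B = (\<lambda>x. \<eta> (fold_up x) * (fold_up x \<bullet> V (fold_up x)))"
  have c: "continuous_on upper V" "continuous_on upper \<eta>" "continuous_on upper g"
    using V \<eta> by (auto simp: solenoidal_def C1_up_to_thin_def)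
  have Ac: "continuous_on (ball 0 1) A" unfolding A_def
    by (rule continuous_on_compose_fold_up[where f = "\<lambda>x. V x \<bullet> g x"]) (intro continuous_intros c)
  have Bc: "continuous_on (ball 0 1) B" unfolding B_def
    by (rule continuous_on_compose_fold_up[where f = "\<lambda>x. \<eta> x * (x \<bullet> V x)"]) (intro continuous_intros c)
  \<comment> \<open>The claim reads \<open>\<beta> r \<le> \<alpha> r\<close>, with
    \<open>\<beta>\<close> the weighted flux through the sphere and \<open>\<alpha>\<close> the
    interior integral. If it fails at \<open>r\<close>, then by continuity it fails at all nearby
    radii, and a cutoff supported by these radii contradicts the weak inequality.\<close>
  define \<alpha> where "\<alpha> = (\<lambda>t. LINT x:ball 0 t|lborel. A x)"
  define \<beta> where "\<beta> = (\<lambda>t. sphere_integral t B / t)"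
  have \<alpha>d: "(\<alpha> has_real_derivative sphere_integral t A) (at t)" if "0 < t" "t < 1" for t
    unfolding \<alpha>_def using has_derivative_ball_integral[OF Ac that] .
  assume "\<not> ?thesis"
  then have "r * \<alpha> r < sphere_integral r B" by (simp add: A_def B_def \<alpha>_def)
  then have pos: "0 < \<beta> r - \<alpha> r" using r by (simp add: \<beta>_def field_simps)
  have "continuous_on {0<..<1} (\<lambda>t. \<beta> t - \<alpha> t)"
    unfolding \<beta>_def
    by (intro continuous_on_diff continuous_on_divide continuous_on_sphere_integral[OF Bc] continuous_on_id
        continuous_at_imp_continuous_on ballI DERIV_isCont[OF \<alpha>d]) auto
  then have "isCont (\<lambda>t. \<beta> t - \<alpha> t) r"
    using r by (intro continuous_on_interior) (auto simp: interior_open)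
  then have "\<forall>\<^sub>F t in at r. 0 < \<beta> t - \<alpha> t" using pos by (intro order_tendstoD(1)) (simp add: isCont_def)
  then obtain d where d: "d > 0" "\<And>t. t \<noteq> r \<Longrightarrow> dist t r < d \<Longrightarrow> 0 < \<beta> t - \<alpha> t"
    unfolding eventually_at by auto
  \<comment> \<open>All radii in the shell from \<open>r - h\<close> to \<open>r\<close> satisfy
    \<open>\<alpha> < \<beta>\<close>; the bound \<open>r / 2\<close> keeps the inner radius
    positive.\<close>
  define h where "h = min (d / 2) (r / 2)"
  have h: "0 < h" "h < d" "h < r" using d r by (auto simp: h_def)
  obtain s s' :: "real \<Rightarrow> real" where s: "\<And>t. (s has_real_derivative s' t) (at t)" "continuous_on UNIV s'"
    "\<And>t. t \<le> 0 \<Longrightarrow> s t = 0" "\<And>t. t \<ge> 1 \<Longrightarrow> s t = 1"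
    "\<And>t. t \<le> 0 \<Longrightarrow> s' t = 0" "\<And>t. t \<ge> 1 \<Longrightarrow> s' t = 0"
    "\<And>t. 0 < t \<Longrightarrow> t < 1 \<Longrightarrow> s' t > 0" "\<And>t. 0 \<le> s t"
    by (rule smooth_step_exists) blast
  define \<phi> where "\<phi> = (\<lambda>t. s ((r - t) / h))"
  define \<phi>' where "\<phi>' = (\<lambda>t. - s' ((r - t) / h) / h)"
  have out1: "(r - t) / h \<le> 0" if "r \<le> t" for t using that h by (simp add: divide_le_0_iff)
  have in1: "(r - t) / h \<ge> 1" if "t \<le> r - h" for t using that h by (simp add: divide_simps)
  interpret cutoff \<phi> \<phi>' "r - h" r
  proof
    show "(\<phi> has_real_derivative \<phi>' t) (at t)" for t
    proof -
      have "((\<lambda>t. (r - t) / h) has_real_derivative - 1 / h) (at t)"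
        using h by (auto intro!: derivative_eq_intros)
      from DERIV_chain2[OF s(1) this] show ?thesis by (simp add: \<phi>_def \<phi>'_def)
    qed
    show "continuous_on UNIV \<phi>'"
      unfolding \<phi>'_def using h
      by (intro continuous_on_divide continuous_on_minus continuous_on_compose2[OF s(2)] continuous_intros) auto
  qed (use h r s out1 in1 in \<open>auto simp: \<phi>_def \<phi>'_def\<close>)
  define P where "P = (\<lambda>x. \<phi> (norm x) * A x + \<phi>' (norm x) / norm x * B x)"
  have Pc: "continuous_on (ball 0 1) P"
    unfolding P_def by (intro continuous_on_add continuous_on_mult cont_norm cont_quotient Ac Bc)
  have weak: "0 \<le> (LINT x:ball 0 1|lborel. P x)"
    unfolding P_def A_def B_def using weak_inequality[OF V \<eta> thin] .
  \<comment> \<open>At \<open>r - h\<close> this is zero, since \<open>P = A\<close> inside that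
    ball; at \<open>r\<close> it is the weak integral, since \<open>\<phi>\<close> vanishes there.
    The sphere integrals of \<open>A\<close> cancel in the derivative, leaving
    \<open>\<phi>' * (\<beta> - \<alpha>)\<close>, which is negative inside the shell. So the weak
    integral would be negative.\<close>
  define Y where "Y = (\<lambda>t. (LINT x:ball 0 t|lborel. P x) - \<phi> t * \<alpha> t)"
  have Yd: "(Y has_real_derivative \<phi>' t * (\<beta> t - \<alpha> t)) (at t)" if t: "0 < t" "t < 1" for t
  proof -
    have "(Y has_real_derivative sphere_integral t P - (\<phi>' t * \<alpha> t + sphere_integral t A * \<phi> t)) (at t)"
      unfolding Y_def using has_derivative_ball_integral[OF Pc t] by (intro DERIV_diff DERIV_mult deriv \<alpha>d t)
    moreover have "sphere_integral t P = sphere_integral t (\<lambda>x. \<phi> t * A x + (\<phi>' t / t) * B x)"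
      by (rule sphere_integral_cong) (simp add: P_def)
    moreover have "\<dots> = \<phi> t * sphere_integral t A + (\<phi>' t / t) * sphere_integral t B"
      by (rule sphere_integral_linear[OF Ac Bc t])
    ultimately show ?thesis by (simp add: \<beta>_def algebra_simps)
  qed
  have "Y r < Y (r - h)"
  proof (rule DERIV_neg_imp_decreasing_open[of "r - h" r Y])
    show "r - h < r" using h by simp
    show "\<exists>y. (Y has_real_derivative y) (at t) \<and> y < 0" if "r - h < t" "t < r" for t
    proof (intro exI conjI)
      show "(Y has_real_derivative \<phi>' t * (\<beta> t - \<alpha> t)) (at t)" using that h r by (intro Yd) auto
      have "0 < \<beta> t - \<alpha> t" using that h by (intro d(2)) (auto simp: dist_real_def)
      moreover have "\<phi>' t < 0" using that h s(7)[of "(r - t) / h"] by (simp add: \<phi>'_def divide_simps)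
      ultimately show "\<phi>' t * (\<beta> t - \<alpha> t) < 0" by (simp add: mult_neg_pos)
    qed
    show "continuous_on {r - h..r} Y"
      by (intro continuous_at_imp_continuous_on ballI DERIV_isCont[OF Yd]) (use h r in auto)
  qed
  moreover have "Y (r - h) = 0"
  proof -
    have "(LINT x:ball 0 (r - h)|lborel. P x) = \<alpha> (r - h)"
      unfolding \<alpha>_def set_lebesgue_integral_def
      by (rule Bochner_Integration.integral_cong)
         (use h s(4)[OF in1] in \<open>auto simp: P_def inner \<phi>_def indicator_def\<close>)
    then show ?thesis using s(4)[OF in1, of "r - h"] by (simp add: Y_def \<phi>_def)
  qed
  moreover have "Y r = (LINT x:ball 0 1|lborel. P x)"
  proof -
    have "(LINT x:ball 0 r|lborel. P x) = (LINT x:ball 0 1|lborel. P x)"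
      unfolding set_lebesgue_integral_def
      by (rule Bochner_Integration.integral_cong)
         (use r outer in \<open>auto simp: P_def indicator_def\<close>)
    then show ?thesis by (simp add: Y_def outer)
  qed
  ultimately show False using weak by simp
qed

section \<open>Gradients of solutions and of polynomials\<close>

lemma GDERIV_unique:
  assumes "GDERIV f x :> D" "GDERIV f x :> D'"
  shows "D = D'"
proof -
  have "(\<lambda>h. h \<bullet> D) = (\<lambda>h. h \<bullet> D')"
    using assms unfolding gderiv_def by (rule has_derivative_unique)
  then have "(D - D') \<bullet> (D - D') = 0" by (metis inner_diff_right diff_self)
  then show ?thesis by simp
qed

lemma grad_eq: "GDERIV f x :> D \<Longrightarrow> grad f x = D"
  unfolding grad_def by (rule the_equality) (auto intro: GDERIV_unique)

lemma GDERIV_bounded_linear: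
  fixes f :: "'a::euclidean_space \<Rightarrow> real"
  assumes "bounded_linear f"
  shows "GDERIV f x :> adjoint f 1"
proof -
  have "f h = h \<bullet> adjoint f 1" for h
    using adjoint_works[OF bounded_linear.linear[OF assms], of h 1] by simp
  then have "f = (\<lambda>h. h \<bullet> adjoint f 1)" by (rule ext)
  with bounded_linear_imp_has_derivative[OF assms] show ?thesis
    by (metis gderiv_def)
qed

lemma differentiable_GDERIV:
  fixes f :: "'a::euclidean_space \<Rightarrow> real"
  assumes "f differentiable (at x)"
  shows "GDERIV f x :> grad f x"
proof -
  obtain F where F: "(f has_derivative F) (at x)" using assms by (auto simp: differentiable_def)
  have "F h = h \<bullet> adjoint F 1" for h
    using adjoint_works[OF has_derivative_linear[OF F], of h 1] by simp
  then have "F = (\<lambda>h. h \<bullet> adjoint F 1)" by (rule ext)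
  with F have "GDERIV f x :> adjoint F 1" by (metis gderiv_def)
  then show ?thesis using grad_eq by metis
qed

lemma C1_on_GDERIV:
  assumes "C1_on S f" "open S" "x \<in> S"
  shows "GDERIV f x :> grad f x"
  using assms by (intro differentiable_GDERIV) (simp add: C1_on_def differentiable_on_eq_differentiable_at)

lemma GDERIV_continuous_on:
  assumes "\<And>x. GDERIV f x :> G x"
  shows "continuous_on S f"
  using assms by (meson gderiv_def continuous_at_imp_continuous_on has_derivative_continuous)

lemma GDERIV_reflect:
  fixes f :: "'m::finite space \<Rightarrow> real"
  assumes "GDERIV f (reflect x) :> D"
  shows "GDERIV (\<lambda>y. f (reflect y)) x :> reflect D"
proof -
  have "(reflect has_derivative reflect) (at x)"
    unfolding reflect_def by (auto intro!: derivative_eq_intros)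
  from has_derivative_compose[OF this, of f "\<lambda>h. h \<bullet> D"] assms
  have "((\<lambda>y. f (reflect y)) has_derivative (\<lambda>h. reflect h \<bullet> D)) (at x)"
    by (simp add: gderiv_def)
  moreover have "reflect h \<bullet> D = h \<bullet> reflect D" for h by (simp add: reflect_def inner_prod_def)
  ultimately show ?thesis by (simp add: gderiv_def)
qed

text \<open>The components of the gradient are again polynomials, so a second application yields the
  second derivatives together with their continuity.\<close>

lemma real_polynomial_function_GDERIV:
  fixes p :: "'a::euclidean_space \<Rightarrow> real"
  assumes "real_polynomial_function p"
  shows "\<exists>G. (\<forall>x. GDERIV p x :> G x) \<and> (\<forall>b. real_polynomial_function (\<lambda>x. G x \<bullet> b))"
  using assms
proof (induction p rule: real_polynomial_function.induct)
  case (linear f)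
  then show ?case by (intro exI[of _ "\<lambda>_. adjoint f 1"]) (auto simp: GDERIV_bounded_linear)
next
  case (const c)
  then show ?case by (intro exI[of _ "\<lambda>_. 0"]) (auto simp: GDERIV_const)
next
  case (add f g)
  then obtain F G where "\<forall>x. GDERIV f x :> F x" "\<forall>b. real_polynomial_function (\<lambda>x. F x \<bullet> b)"
    "\<forall>x. GDERIV g x :> G x" "\<forall>b. real_polynomial_function (\<lambda>x. G x \<bullet> b)" by blast
  then show ?case
    by (intro exI[of _ "\<lambda>x. F x + G x"]) (auto simp: inner_add_left intro: GDERIV_add)
next
  case (mult f g)
  then obtain F G where "\<forall>x. GDERIV f x :> F x" "\<forall>b. real_polynomial_function (\<lambda>x. F x \<bullet> b)"
    "\<forall>x. GDERIV g x :> G x" "\<forall>b. real_polynomial_function (\<lambda>x. G x \<bullet> b)" by blast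
  with mult.hyps show ?case
    by (intro exI[of _ "\<lambda>x. f x *\<^sub>R G x + g x *\<^sub>R F x"])
       (auto simp: inner_add_left intro!: GDERIV_mult real_polynomial_function.intros(3,4))
qed

text \<open>Euler's identity comes from differentiating
  \<open>p (c *\<^sub>R x) = c ^ k * p x\<close> at \<open>c = 1\<close>. On the thin hyperplane
  evenness makes the gradient invariant under reflection, hence its last component vanishes.\<close>

lemma P_class_gradient:
  fixes p :: "'m::finite space \<Rightarrow> real"
  assumes p: "p \<in> P_class k"
  obtains gp where "C1_up_to_thin p gp" "solenoidal gp" "\<And>x. x \<bullet> gp x = real k * p x"
    "\<And>x. snd x = 0 \<Longrightarrow> snd (gp x) = 0" "\<And>x. p (fold_up x) = p x" "\<And>x. snd x = 0 \<Longrightarrow> p x \<ge> 0"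
proof -
  have poly: "real_polynomial_function p" and hom: "\<And>c x. p (c *\<^sub>R x) = c ^ k * p x"
    and lap: "\<And>x. laplacian p x = 0" and nn: "\<And>x'. p (x', 0) \<ge> 0" and even: "\<And>x' t. p (x', - t) = p (x', t)"
    using p by (auto simp: P_class_def homogeneous_polynomial_def)
  obtain G where G: "\<And>x. GDERIV p x :> G x" "\<And>b. real_polynomial_function (\<lambda>x. G x \<bullet> b)"
    using real_polynomial_function_GDERIV[OF poly] by blast
  have "\<forall>b. \<exists>D. (\<forall>x. GDERIV (\<lambda>x. G x \<bullet> b) x :> D x) \<and> (\<forall>c. real_polynomial_function (\<lambda>x. D x \<bullet> c))"
    using real_polynomial_function_GDERIV[OF G(2)] by blast
  then obtain D where D: "\<And>b x. GDERIV (\<lambda>x. G x \<bullet> b) x :> D b x"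
      "\<And>b c. real_polynomial_function (\<lambda>x. D b x \<bullet> c)"
    by metis
  have pc: "continuous_on S q" if "real_polynomial_function q" for S and q :: "'m space \<Rightarrow> real"
    using real_polynomial_function_GDERIV[OF that] GDERIV_continuous_on by blast
  have gradG: "grad p = G" using grad_eq[OF G(1)] by (intro ext)
  have Gc: "continuous_on S G" for S
    using pc[OF G(2)] by (simp add: continuous_on_componentwise[of S G])
  have Dc: "continuous_on S (D b)" for S b
    using pc[OF D(2)] by (simp add: continuous_on_componentwise[of S "D b"])
  have reflp: "p (reflect x) = p x" for x by (cases x) (simp add: reflect_def even)
  show ?thesis
  proof (rule that[of G])
    show "C1_up_to_thin p G"
      unfolding C1_up_to_thin_def using G(1) Gc pc[OF poly] by auto
    have "(\<Sum>b\<in>Basis. D b x \<bullet> b) = 0" for x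
    proof -
      have "laplacian p x = (\<Sum>b\<in>Basis. D b x \<bullet> b)"
        unfolding laplacian_def gradG using grad_eq[OF D(1)] by simp
      then show ?thesis using lap by simp
    qed
    then show "solenoidal G" unfolding solenoidal_def using D(1) Gc Dc by blast
    show "x \<bullet> G x = real k * p x" for x
    proof -
      have "((\<lambda>c. p (c *\<^sub>R x)) has_derivative (\<lambda>h. (h *\<^sub>R x) \<bullet> G x)) (at 1)"
        by (rule has_derivative_compose[where f = "\<lambda>c. c *\<^sub>R x" and g = p])
           (use G(1)[of x] in \<open>auto simp: gderiv_def intro!: derivative_eq_intros\<close>)
      then have "((\<lambda>c. p (c *\<^sub>R x)) has_real_derivative x \<bullet> G x) (at 1)"
        by (simp add: has_field_derivative_def mult_commute_abs)
      moreover have "((\<lambda>c. c ^ k * p x) has_real_derivative real k * p x) (at 1)"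
        by (auto intro!: derivative_eq_intros)
      ultimately show ?thesis unfolding hom by (rule DERIV_unique)
    qed
    show "snd (G x) = 0" if "snd x = 0" for x
    proof -
      have x: "reflect x = x" using that by (simp add: reflect_def prod_eq_iff)
      have "GDERIV (\<lambda>y. p (reflect y)) x :> reflect (G x)"
        using G(1)[of x] x by (intro GDERIV_reflect) simp
      then have "reflect (G x) = G x" using G(1)[of x] GDERIV_unique by (simp add: reflp)
      then show ?thesis by (simp add: reflect_def prod_eq_iff)
    qed
    show "p (fold_up x) = p x" for x
      using reflp[of x] by (cases "snd x \<ge> 0") (simp_all add: fold_up_nonneg fold_up_nonpos)
    show "p x \<ge> 0" if "snd x = 0" for x using nn[of "fst x"] that by (cases x) simp
  qed
qed

text \<open>The Hoelder bound is given on compact sets only. Each point \<open>x\<close> of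
  \<open>upper\<close> has a compact relative neighbourhood in it, namely the part with
  \<open>snd y \<ge> 0\<close> of the closed ball of radius \<open>(1 + norm x) / 2\<close>.\<close>

lemma continuous_on_locally_Hoelder:
  fixes g :: "'m::finite space \<Rightarrow> 'b::real_normed_vector"
  assumes "0 < \<alpha>"
    and H: "\<And>K. compact K \<Longrightarrow> K \<subseteq> upper \<Longrightarrow> \<exists>C. \<forall>x\<in>K. \<forall>y\<in>K. norm (g x - g y) \<le> C * dist x y powr \<alpha>"
  shows "continuous_on upper g"
  unfolding continuous_on_eq_continuous_within
proof
  fix x :: "'m space" assume x: "x \<in> upper"
  define s where "s = (1 + norm x) / 2"
  have s: "norm x < s" "s < 1" using x by (auto simp: s_def upper_def)
  define K where "K = cball 0 s \<inter> {y :: 'm space. 0 \<le> snd y}"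
  have "closed {y :: 'm space. 0 \<le> snd y}" by (intro closed_Collect_le continuous_intros)
  then have "compact K" by (simp add: K_def compact_Int_closed)
  moreover have "K \<subseteq> upper" using s by (auto simp: K_def upper_def)
  ultimately have "\<exists>C. \<forall>x\<in>K. \<forall>y\<in>K. norm (g x - g y) \<le> C * dist x y powr \<alpha>"
    by (rule H)
  then obtain C where "\<forall>x\<in>K. \<forall>y\<in>K. norm (g x - g y) \<le> C * dist x y powr \<alpha>" ..
  then have C: "norm (g x - g y) \<le> C * dist x y powr \<alpha>" if "x \<in> K" "y \<in> K" for x y
    using that by simp
  have xK: "x \<in> K" using x s by (auto simp: K_def upper_def)
  have "((\<lambda>y. g y - g x) \<longlongrightarrow> 0) (at x within upper)"
  proof (rule Lim_null_comparison)
    have "\<forall>\<^sub>F y in at x within upper. y \<in> ball 0 s"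
      using s by (intro topological_tendstoD[OF tendsto_ident_at]) auto
    moreover have "\<forall>\<^sub>F y in at x within upper. y \<in> upper" by (simp add: eventually_at_filter)
    ultimately show "\<forall>\<^sub>F y in at x within upper. norm (g y - g x) \<le> C * dist y x powr \<alpha>"
      by eventually_elim (intro C xK, auto simp: K_def upper_def)
    have "((\<lambda>y. dist y x) \<longlongrightarrow> 0) (at x within upper)"
      by (rule tendsto_dist_iff[THEN iffD1, OF tendsto_ident_at])
    then have "((\<lambda>y. dist y x powr \<alpha>) \<longlongrightarrow> 0) (at x within upper)"
      using assms(1) by (intro tendsto_zero_powrI[OF _ tendsto_const]) auto
    from tendsto_mult_right_zero[OF this]
    show "((\<lambda>y. C * dist y x powr \<alpha>) \<longlongrightarrow> 0) (at x within upper)" .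
  qed
  then show "continuous (at x within upper) g"
    unfolding continuous_within by (simp add: LIM_zero_iff)
qed

text \<open>\<open>g\<close> is the gradient from \<open>C1_alpha_loc\<close>, one-sided on the thin
  ball. It coincides with \<open>grad u\<close> in the open half ball, so its continuity identifies
  \<open>normal_deriv u\<close> with its last component. Below the thin ball the gradient of
  \<open>u\<close> is the mirror image of \<open>g\<close>, which gives equal norms off the thin
  hyperplane; that is all the frequency sees.\<close>

lemma signorini_gradient:
  fixes u :: "'m::finite space \<Rightarrow> real"
  assumes u: "u \<in> signorini_class"
  obtains g where "C1_up_to_thin u g" "solenoidal g"
    "\<And>x. x \<in> upper \<Longrightarrow> snd x = 0 \<Longrightarrow> 0 \<le> u x \<and> snd (g x) \<le> 0 \<and> snd (g x) * u x = 0"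
    "\<And>x. norm x < 1 \<Longrightarrow> u (fold_up x) = u x"
    "\<And>x. norm x < 1 \<Longrightarrow> snd x \<noteq> 0 \<Longrightarrow> norm (grad u x) = norm (g (fold_up x))"
proof -
  obtain \<alpha> where \<alpha>: "0 < \<alpha>" "C1_alpha_loc \<alpha> upper u"
    using u by (auto simp: signorini_class_def upper_eq)
  have harm: "harmonic_on half_ball u"
    and sign: "\<And>x. x \<in> thin_ball 1 \<Longrightarrow> u x \<ge> 0 \<and> - normal_deriv u x \<ge> 0 \<and> u x * normal_deriv u x = 0"
    and even: "\<And>x' t. (x', t) \<in> ball 0 1 \<Longrightarrow> u (x', - t) = u (x', t)"
    using u by (auto simp: signorini_class_def)
  obtain g where g0: "\<forall>x\<in>upper. (u has_derivative (\<lambda>h. g x \<bullet> h)) (at x within upper)"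
    and hoelder: "\<forall>K. compact K \<and> K \<subseteq> upper \<longrightarrow>
      (\<exists>C. \<forall>x\<in>K. \<forall>y\<in>K. norm (g x - g y) \<le> C * dist x y powr \<alpha>)"
    using \<alpha>(2)[unfolded C1_alpha_loc_def] by (elim exE conjE) (rule that, assumption, assumption)
  have g: "(u has_derivative (\<lambda>h. g x \<bullet> h)) (at x within upper)" if "x \<in> upper" for x
    using g0 that by (rule bspec)
  have gc: "continuous_on upper g" 
    by (rule continuous_on_locally_Hoelder[OF \<alpha>(1)]) (rule hoelder[rule_format], rule conjI)
  have uc: "continuous_on upper u"
    using g by (meson continuous_on_eq_continuous_within has_derivative_continuous)
  have gd: "GDERIV u x :> g x" if "x \<in> half_ball" for x
  proof -
    have "(u has_derivative (\<lambda>h. g x \<bullet> h)) (at x within half_ball)"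
      using g[of x] that half_ball_subset by (meson has_derivative_subset subsetD)
    then show ?thesis
      unfolding gderiv_def using at_within_open[OF that open_half_ball] by (simp add: inner_commute)
  qed
  have gradg: "grad u x = g x" if "x \<in> half_ball" for x using grad_eq[OF gd[OF that]] .
  have refl: "u (reflect x) = u x" if "norm x < 1" for x
    using even[of "fst x" "snd x"] that by (simp add: reflect_def)
  show ?thesis
  proof (rule that[of g])
    show "C1_up_to_thin u g" using uc gc gd by (simp add: C1_up_to_thin_def)
    define DV where "DV = (\<lambda>b. grad (\<lambda>y. grad u y \<bullet> b))"
    have C1: "C1_on half_ball (\<lambda>x. grad u x \<bullet> b)" if "b \<in> Basis" for b
      using harm that by (simp add: harmonic_on_def C2_on_def)
    have DVd: "GDERIV (\<lambda>y. g y \<bullet> b) x :> DV b x" if "b \<in> Basis" "x \<in> half_ball" for b x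
      using C1_on_GDERIV[OF C1[OF that(1)] open_half_ball that(2)] unfolding gderiv_def DV_def
      by (rule has_derivative_transform_within_open[OF _ open_half_ball that(2)]) (simp add: gradg)
    have "continuous_on half_ball (DV b)" if "b \<in> Basis" for b
      using C1[OF that] by (simp add: C1_on_def DV_def)
    moreover have "(\<Sum>b\<in>Basis. DV b x \<bullet> b) = 0" if "x \<in> half_ball" for x
      using harm that by (simp add: harmonic_on_def laplacian_def DV_def)
    ultimately show "solenoidal g" unfolding solenoidal_def using gc DVd by blast
    show "0 \<le> u x \<and> snd (g x) \<le> 0 \<and> snd (g x) * u x = 0" if x: "x \<in> upper" "snd x = 0" for x
    proof -
      let ?F = "at x within {y :: 'm space. snd y > 0}"
      have x1: "x \<in> ball 0 1" using x by (simp add: upper_def)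
      have F: "?F = at x within half_ball"
        by (rule at_within_nhd[OF x1]) (auto simp: half_ball_def)
      have "(g \<longlongrightarrow> g x) (at x within half_ball)"
        using gc x(1) half_ball_subset by (meson continuous_on_def tendsto_within_subset)
      then have "((\<lambda>y. g y \<bullet> (0, 1)) \<longlongrightarrow> g x \<bullet> (0, 1)) (at x within half_ball)"
        by (intro tendsto_inner tendsto_const)
      moreover have "\<forall>\<^sub>F y in at x within half_ball. g y \<bullet> (0, 1) = grad u y \<bullet> (0, 1)"
        by (simp add: eventually_at_filter gradg)
      ultimately have lim: "((\<lambda>y. grad u y \<bullet> (0, 1)) \<longlongrightarrow> g x \<bullet> (0, 1)) ?F"
        unfolding F by (rule Lim_transform_eventually)
      \<comment> \<open>\<open>Lim\<close> is determined by convergence only along a nontrivial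
        filter.\<close>
      have "x islimpt {y :: 'm space. snd y > 0}"
        unfolding islimpt_approachable
      proof (intro allI impI)
        fix e :: real assume "e > 0"
        then show "\<exists>y\<in>{y. snd y > 0}. y \<noteq> x \<and> dist y x < e"
          using x(2) by (intro bexI[of _ "(fst x, e / 2)"]) (cases x, auto simp: dist_Pair_Pair)
      qed
      then have "?F \<noteq> bot" by (simp add: trivial_limit_within)
      then have "normal_deriv u x = g x \<bullet> (0, 1)"
        unfolding normal_deriv_def using lim by (rule tendsto_Lim)
      then show ?thesis using sign[of x] x by (auto simp: thin_ball_def upper_def inner_prod_def mult.commute)
    qed
    show "u (fold_up x) = u x" if "norm x < 1" for x
      using refl[OF that] by (cases "snd x \<ge> 0") (simp_all add: fold_up_nonneg fold_up_nonpos)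
    show "norm (grad u x) = norm (g (fold_up x))" if x: "norm x < 1" "snd x \<noteq> 0" for x
    proof (cases "snd x > 0")
      case True
      then show ?thesis using x gradg[of x] by (simp add: fold_up_nonneg half_ball_def)
    next
      case False
      have "reflect x \<in> half_ball" using x False by (simp add: half_ball_def) (simp add: reflect_def)
      from GDERIV_reflect[OF gd[OF this]]
      have "GDERIV u x :> reflect (g (reflect x))"
        unfolding gderiv_def
        by (rule has_derivative_transform_within_open[of _ _ _ _ "ball 0 1"]) (use x refl in auto)
      from grad_eq[OF this] show ?thesis using False by (simp add: fold_up_nonpos)
    qed
  qed
qed

section \<open>Weiss monotonicity\<close>

definition homogeneous_ext :: "real \<Rightarrow> real \<Rightarrow> ('m::finite space \<Rightarrow> 'b::real_normed_vector) \<Rightarrow> 'm space \<Rightarrow> 'b"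
  where "homogeneous_ext r k f x = (norm x / r) powr k *\<^sub>R f ((r / norm x) *\<^sub>R x)"

lemma radial_upper:
  assumes "x \<in> upper" "0 < r" "r < 1" shows "(r / norm x) *\<^sub>R x \<in> upper"
  using assms by (auto simp: upper_def)

text \<open>Only the origin needs care: there the positive exponent beats the values of
  \<open>f\<close> on the half sphere, which are bounded by compactness. For the gradient the
  exponent is \<open>k - 1\<close>, which is the source of the condition \<open>k > 1\<close>
  below.\<close>

lemma continuous_on_homogeneous_ext:
  fixes f :: "'m::finite space \<Rightarrow> 'b::real_normed_vector"
  assumes f: "continuous_on upper f" and r: "0 < r" "r < 1" and k: "k > 0"
  shows "continuous_on upper (homogeneous_ext r k f)"
  unfolding continuous_on_eq_continuous_within
proof
  fix x :: "'m space" assume x: "x \<in> upper"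
  show "continuous (at x within upper) (homogeneous_ext r k f)"
  proof (cases "x = 0")
    case False
    have "continuous_on (upper - {0}) (\<lambda>x. f ((r / norm x) *\<^sub>R x))"
    proof (rule continuous_on_compose2[OF f])
      show "(\<lambda>x. (r / norm x) *\<^sub>R x) ` (upper - {0}) \<subseteq> upper" using radial_upper r by blast
    qed (intro continuous_intros, auto)
    moreover have "continuous_on (upper - {0}) (\<lambda>x. (norm x / r) powr k)"
      by (intro continuous_on_powr' continuous_intros) (use r in auto)
    ultimately have "continuous_on (upper - {0}) (homogeneous_ext r k f)"
      unfolding homogeneous_ext_def by (intro continuous_on_scaleR)
    then have "continuous (at x within upper - {0}) (homogeneous_ext r k f)"
      using x False by (simp add: continuous_on_eq_continuous_within)
    moreover have "at x within upper - {0} = at x within upper"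
      by (rule at_within_nhd[of x "- {0}"]) (use False in auto)
    ultimately show ?thesis by (simp add: continuous_within)
  next
    case True
    have "continuous_on (cball 0 r \<inter> {y. 0 \<le> snd y}) f"
      by (rule continuous_on_subset[OF f]) (use r in \<open>auto simp: upper_def\<close>)
    moreover have "compact (cball 0 r \<inter> {y :: 'm space. 0 \<le> snd y})"
      by (intro compact_Int_closed closed_Collect_le continuous_intros) auto
    ultimately have "compact (f ` (cball 0 r \<inter> {y. 0 \<le> snd y}))" by (intro compact_continuous_image)
    then obtain C where C: "\<And>y. y \<in> cball 0 r \<inter> {y. 0 \<le> snd y} \<Longrightarrow> norm (f y) \<le> C"
      by (meson bounded_iff compact_imp_bounded imageI)
    have "(homogeneous_ext r k f \<longlongrightarrow> 0) (at 0 within upper)"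
    proof (rule Lim_null_comparison)
      show "\<forall>\<^sub>F y in at 0 within upper. norm (homogeneous_ext r k f y) \<le> (norm y / r) powr k * C"
        unfolding eventually_at_filter
      proof (intro always_eventually allI impI)
        fix y :: "'m space" assume "y \<in> upper"
        then have "norm (f ((r / norm y) *\<^sub>R y)) \<le> C" using r by (intro C) (auto simp: upper_def)
        then show "norm (homogeneous_ext r k f y) \<le> (norm y / r) powr k * C"
          by (simp add: homogeneous_ext_def mult_left_mono)
      qed
      have "((\<lambda>y::'m space. norm y / r) \<longlongrightarrow> 0) (at 0 within upper)"
        using r by (intro tendsto_eq_intros refl) auto
      then have "((\<lambda>y::'m space. (norm y / r) powr k) \<longlongrightarrow> 0) (at 0 within upper)"
        using k r by (intro tendsto_zero_powrI[OF _ tendsto_const]) auto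
      from tendsto_mult_left_zero[OF this]
      show "((\<lambda>y::'m space. (norm y / r) powr k * C) \<longlongrightarrow> 0) (at 0 within upper)" .
    qed
    then show ?thesis using True k by (simp add: continuous_within homogeneous_ext_def)
  qed
qed

text \<open>On the sphere the extension keeps the tangential part of the gradient
  \<open>g y\<close>, while Euler's relation prescribes \<open>k * f y\<close> in place of the
  radial derivative \<open>y \<bullet> g y\<close>. The multiple of \<open>y\<close> makes exactly
  this correction, and homogeneity of degree \<open>k - 1\<close> carries it to other radii.\<close>

lemma GDERIV_homogeneous_ext:
  fixes f :: "'m::finite space \<Rightarrow> real"
  assumes r: "r > 0" and x: "x \<noteq> 0"
    and f: "GDERIV f ((r / norm x) *\<^sub>R x) :> g ((r / norm x) *\<^sub>R x)"
  shows "GDERIV (homogeneous_ext r k f) x :>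
    homogeneous_ext r (k - 1) (\<lambda>y. g y - ((y \<bullet> g y - k * f y) / r\<^sup>2) *\<^sub>R y) x"
proof -
  define N where "N = norm x"
  have N: "N > 0" using x by (simp add: N_def)
  define y where "y = (r / N) *\<^sub>R x"
  have xy: "x = (N / r) *\<^sub>R y" using N r by (simp add: y_def)
  have yd: "((\<lambda>x. (r / norm x) *\<^sub>R x) has_derivative
      (\<lambda>h. (r / N) *\<^sub>R h - (r * (x \<bullet> h) / N ^ 3) *\<^sub>R x)) (at x)"
  proof -
    have "GDERIV norm x :> sgn x" by (rule GDERIV_norm[OF x])
    then have nd: "(norm has_derivative (\<lambda>h. h \<bullet> sgn x)) (at x)" by (simp add: gderiv_def)
    have "((\<lambda>x. (r / norm x) *\<^sub>R x) has_derivative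
        (\<lambda>h. (r / N) *\<^sub>R h + ((0 * N - r * (h \<bullet> sgn x)) / (N * N)) *\<^sub>R x)) (at x)"
      unfolding N_def using x
      by (intro has_derivative_scaleR has_derivative_divide' has_derivative_const nd has_derivative_ident) auto
    moreover have "(0 * N - r * (h \<bullet> sgn x)) / (N * N) = - (r * (x \<bullet> h) / N ^ 3)" for h
      using N by (simp add: sgn_div_norm N_def[symmetric] inner_commute power3_eq_cube divide_simps)
    ultimately show ?thesis by simp
  qed
  have "((\<lambda>x. f ((r / norm x) *\<^sub>R x)) has_derivative
      (\<lambda>h. ((r / N) *\<^sub>R h - (r * (x \<bullet> h) / N ^ 3) *\<^sub>R x) \<bullet> g y)) (at x)"
    using f unfolding gderiv_def
    by (intro has_derivative_compose[OF yd]) (simp add: y_def N_def)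
  then have d1: "GDERIV (\<lambda>x. f ((r / norm x) *\<^sub>R x)) x :> (r / N) *\<^sub>R g y - (r * (x \<bullet> g y) / N ^ 3) *\<^sub>R x"
    unfolding gderiv_def by (simp add: inner_diff_left inner_diff_right inner_commute mult_ac)
  have "((\<lambda>t. (t / r) powr k) has_real_derivative (k * (N / r) powr (k - 1) * (1 / r))) (at N)"
    using N r by (auto intro!: derivative_eq_intros)
  from GDERIV_DERIV_compose[OF GDERIV_norm[OF x] this[unfolded N_def]]
  have d2: "GDERIV (\<lambda>x. (norm x / r) powr k) x :> (k * (N / r) powr (k - 1) * (1 / r)) *\<^sub>R sgn x"
    by (simp add: N_def)
  have "GDERIV (\<lambda>x. (norm x / r) powr k * f ((r / norm x) *\<^sub>R x)) x :>
      (N / r) powr k *\<^sub>R ((r / N) *\<^sub>R g y - (r * (x \<bullet> g y) / N ^ 3) *\<^sub>R x) +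
      f y *\<^sub>R ((k * (N / r) powr (k - 1) * (1 / r)) *\<^sub>R sgn x)"
    using GDERIV_mult[OF d2 d1] by (simp add: N_def y_def)
  moreover have "(N / r) powr k *\<^sub>R ((r / N) *\<^sub>R g y - (r * (x \<bullet> g y) / N ^ 3) *\<^sub>R x) +
      f y *\<^sub>R ((k * (N / r) powr (k - 1) * (1 / r)) *\<^sub>R sgn x) =
      (N / r) powr (k - 1) *\<^sub>R (g y - ((y \<bullet> g y - k * f y) / r\<^sup>2) *\<^sub>R y)"
  proof -
    have p: "(N / r) powr k = (N / r) powr (k - 1) * (N / r)"
      using N r by (simp add: powr_diff)
    have s: "sgn x = (1 / r) *\<^sub>R y" using N r by (simp add: sgn_div_norm y_def N_def divide_inverse)
    have e: "(r * (x \<bullet> g y) / N ^ 3) *\<^sub>R x = ((y \<bullet> g y) / (r * N)) *\<^sub>R y"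
      using N r by (subst (1 2) xy) (simp add: divide_simps power3_eq_cube power2_eq_square)
    show ?thesis
      unfolding p s e using N r
      by (simp add: algebra_simps scaleR_diff_right scaleR_add_right power2_eq_square diff_divide_distrib)
  qed
  ultimately show ?thesis
    by (simp add: homogeneous_ext_def[abs_def] y_def N_def)
qed

text \<open>Pythagoras: the correction leaves the part of \<open>v\<close> orthogonal to
  \<open>y\<close> alone and replaces the radial component \<open>(y \<bullet> v) / r\<close> by
  \<open>c / r\<close>.\<close>

lemma norm_square_radial_correction:
  fixes y v :: "'a::real_inner"
  assumes "norm y = r" "r > 0"
  shows "(norm (v - ((y \<bullet> v - c) / r\<^sup>2) *\<^sub>R y))\<^sup>2 = (norm v)\<^sup>2 - (y \<bullet> v)\<^sup>2 / r\<^sup>2 + c\<^sup>2 / r\<^sup>2"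
proof -
  define s where "s = (y \<bullet> v - c) / r\<^sup>2"
  have yy: "y \<bullet> y = r\<^sup>2" using assms by (simp flip: power2_norm_eq_inner)
  have "(norm (v - s *\<^sub>R y))\<^sup>2 = (norm v)\<^sup>2 - 2 * s * (y \<bullet> v) + s\<^sup>2 * r\<^sup>2"
    unfolding power2_norm_eq_inner
    by (simp add: inner_diff_left inner_diff_right yy inner_commute power2_eq_square algebra_simps)
  also have "s\<^sup>2 * r\<^sup>2 = s * (y \<bullet> v - c)"
    using assms by (simp add: s_def power2_eq_square)
  also have "(norm v)\<^sup>2 - 2 * s * (y \<bullet> v) + s * (y \<bullet> v - c) = (norm v)\<^sup>2 - s * (y \<bullet> v + c)"
    by (simp add: algebra_simps)
  also have "s * (y \<bullet> v + c) = ((y \<bullet> v)\<^sup>2 - c\<^sup>2) / r\<^sup>2"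
    by (simp add: s_def power2_eq_square algebra_simps)
  finally show ?thesis by (simp add: s_def diff_divide_distrib)
qed

text \<open>By scaling, the ball integral is a constant times \<open>t powr (n + d)\<close> with
  \<open>n\<close> the dimension. Its derivative at \<open>r\<close> is also the sphere integral,
  and comparing the two gives the relation.\<close>

lemma ball_integral_homogeneous:
  fixes F :: "'a::euclidean_space \<Rightarrow> real"
  assumes F: "continuous_on (ball 0 1) F" and hom: "\<And>s x. s > 0 \<Longrightarrow> F (s *\<^sub>R x) = s powr d * F x"
    and r: "0 < r" "r < 1"
  shows "(real DIM('a) + d) * (LINT x:ball 0 r|lborel. F x) = r * sphere_integral r F"
proof -
  define G where "G = (LINT x:ball (0::'a) 1|lborel. F x)"
  have scale: "(LINT x:ball 0 t|lborel. F x) = t powr (real DIM('a) + d) * G" if t: "0 < t" "t < 1" for t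
  proof -
    have "(LINT x:ball 0 (t * 1)|lborel. F x) = t ^ DIM('a) * (LINT x:ball 0 1|lborel. F (t *\<^sub>R x))"
      by (rule integral_scale_ball[OF t(1)], rule set_borel_measurable_continuous_borel)
         (use t F in \<open>auto intro: continuous_on_subset\<close>)
    also have "\<dots> = t ^ DIM('a) * (t powr d * G)" using t by (simp add: hom G_def)
    also have "t ^ DIM('a) = t powr real DIM('a)" using t by (simp add: powr_realpow)
    finally show ?thesis by (simp add: powr_add)
  qed
  have "((\<lambda>t. t powr (real DIM('a) + d) * G) has_real_derivative
      (real DIM('a) + d) * r powr (real DIM('a) + d - 1) * G) (at r)"
    using r by (auto intro!: derivative_eq_intros)
  then have "((\<lambda>t. LINT x:ball 0 t|lborel. F x) has_real_derivative
      (real DIM('a) + d) * r powr (real DIM('a) + d - 1) * G) (at r)"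
    by (rule has_field_derivative_transform_within_open[where S = "{0<..<1}"]) (use r scale in auto)
  with has_derivative_ball_integral[OF F r]
  have "sphere_integral r F = (real DIM('a) + d) * r powr (real DIM('a) + d - 1) * G"
    by (rule DERIV_unique)
  moreover have "r * r powr (real DIM('a) + d - 1) = r powr (real DIM('a) + d)"
    using r by (simp add: powr_diff)
  ultimately show ?thesis using scale[OF r] by (simp add: mult_ac)
qed

text \<open>The properties of a solution on which both monotonicity formulas rest. Everything is
  evaluated through \<open>fold_up\<close>, so \<open>u\<close> and \<open>g\<close> matter on
  \<open>upper\<close> only.\<close>

locale signorini =
  fixes u :: "'m::finite space \<Rightarrow> real" and g :: "'m space \<Rightarrow> 'm space"
  assumes C1: "C1_up_to_thin u g" and sol: "solenoidal g"
    and thin: "\<And>x. x \<in> upper \<Longrightarrow> snd x = 0 \<Longrightarrow> 0 \<le> u x \<and> snd (g x) \<le> 0 \<and> snd (g x) * u x = 0"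
begin

definition E :: "'m space \<Rightarrow> real"
  where "E x = fold_up x \<bullet> g (fold_up x)"

definition U :: "'m space \<Rightarrow> real"
  where "U x = u (fold_up x)"

definition D :: "real \<Rightarrow> real"
  where "D r = (LINT x:ball 0 r|lborel. (norm (g (fold_up x)))\<^sup>2)"

lemma cont: "continuous_on upper u" "continuous_on upper g"
  using C1 by (auto simp: C1_up_to_thin_def)

lemma cont_E: "continuous_on (ball 0 1) E"
  unfolding E_def by (rule continuous_on_compose_fold_up[where f = "\<lambda>x. x \<bullet> g x"]) (intro continuous_intros cont)

lemma cont_U: "continuous_on (ball 0 1) U"
  unfolding U_def by (rule continuous_on_compose_fold_up[OF cont(1)])

lemma cont_Q: "continuous_on (ball 0 1) (\<lambda>x. (norm (g (fold_up x)))\<^sup>2)"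
  by (rule continuous_on_compose_fold_up[where f = "\<lambda>x. (norm (g x))\<^sup>2"]) (intro continuous_intros cont)

text \<open>The right-hand side is \<open>real DIM('m space) - 2 + 2 * k\<close> times the energy of the \<open>k\<close>-homogeneous
  extension \<open>z\<close> of \<open>u\<close> from the sphere. Its energy dominates that of \<open>u\<close> because \<open>z - u\<close> vanishes
  on the sphere and \<open>(z - u) \<partial>\<^sub>nu \<le> 0\<close> on the thin ball.\<close>

lemma energy_comparison:
  assumes r: "0 < r" "r < 1" and k: "k > 1"
  shows "(real DIM('m space) - 2 + 2 * k) * D r \<le>
    r * sphere_integral r (\<lambda>x. (norm (g (fold_up x)))\<^sup>2) - sphere_integral r (\<lambda>x. (E x)\<^sup>2) / r +
    k\<^sup>2 * sphere_integral r (\<lambda>x. (U x)\<^sup>2) / r"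
proof -
  \<comment> \<open>On the sphere of radius \<open>r\<close> this is the gradient of the extension
    \<open>z\<close>; \<open>gz\<close> continues it with degree \<open>k - 1\<close>.\<close>
  define w where "w = (\<lambda>y. g y - ((y \<bullet> g y - k * u y) / r\<^sup>2) *\<^sub>R y)"
  define z where "z = homogeneous_ext r k u"
  define gz where "gz = homogeneous_ext r (k - 1) w"
  have wc: "continuous_on upper w" unfolding w_def using r by (intro continuous_intros cont) auto
  have C1z: "C1_up_to_thin z gz"
    unfolding C1_up_to_thin_def
  proof (intro conjI ballI)
    show "continuous_on upper z" unfolding z_def using k by (intro continuous_on_homogeneous_ext cont r) auto
    show "continuous_on upper gz" unfolding gz_def using k by (intro continuous_on_homogeneous_ext wc r) auto
    fix x :: "'m space" assume x: "x \<in> half_ball"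
    then have x0: "x \<noteq> 0" by (auto simp: half_ball_def)
    have "(r / norm x) *\<^sub>R x \<in> half_ball" using x x0 r by (auto simp: half_ball_def)
    then show "GDERIV z x :> gz x"
      unfolding z_def gz_def w_def using C1 r x0
      by (intro GDERIV_homogeneous_ext) (auto simp: C1_up_to_thin_def)
  qed
  define \<eta> where "\<eta> = (\<lambda>x. z x - u x)"
  have C1\<eta>: "C1_up_to_thin \<eta> (\<lambda>x. gz x - g x)"
    using C1 C1z unfolding C1_up_to_thin_def \<eta>_def by (auto intro!: continuous_on_diff GDERIV_diff)
  have \<eta>thin: "snd (g x) * \<eta> x \<le> 0" if x: "x \<in> upper" "snd x = 0" for x
  proof -
    have "0 \<le> u ((r / norm x) *\<^sub>R x)" using thin[OF radial_upper[OF x(1) r]] x by simp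
    then have "0 \<le> z x" by (simp add: z_def homogeneous_ext_def)
    then have "snd (g x) * z x \<le> 0" using thin[OF x] by (intro mult_nonpos_nonneg) auto
    moreover have "snd (g x) * u x = 0" using thin[OF x] by blast
    ultimately show ?thesis by (simp only: \<eta>_def right_diff_distrib diff_zero)
  qed
  have "sphere_integral r (\<lambda>x. \<eta> (fold_up x) * (fold_up x \<bullet> g (fold_up x))) = sphere_integral r (\<lambda>x::'m space. 0)"
    by (rule sphere_integral_cong) (use r in \<open>auto simp: \<eta>_def z_def homogeneous_ext_def\<close>)
  then have "0 \<le> r * (LINT x:ball 0 r|lborel. g (fold_up x) \<bullet> (gz (fold_up x) - g (fold_up x)))"
    using sphere_integral_le_ball_integral[OF sol C1\<eta> \<eta>thin r]
    by (simp add: sphere_integral_def)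
  then have min: "0 \<le> (LINT x:ball 0 r|lborel. g (fold_up x) \<bullet> (gz (fold_up x) - g (fold_up x)))"
    using r by (simp add: zero_le_mult_iff)
  define F where "F = (\<lambda>x. (norm (gz (fold_up x)))\<^sup>2)"
  have gzc: "continuous_on upper gz" using C1z by (simp add: C1_up_to_thin_def)
  have Fc: "continuous_on (ball 0 1) F" unfolding F_def
    by (rule continuous_on_compose_fold_up[where f = "\<lambda>x. (norm (gz x))\<^sup>2"]) (intro continuous_intros gzc)
  have Ic: "continuous_on (ball 0 1) (\<lambda>x. 2 * (g (fold_up x) \<bullet> (gz (fold_up x) - g (fold_up x))))"
    by (rule continuous_on_compose_fold_up[where f = "\<lambda>x. 2 * (g x \<bullet> (gz x - g x))"]) (intro continuous_intros gzc cont)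
  note int = set_integrable_ball[OF cont_Q r(2)] set_integrable_ball[OF Fc r(2)] set_integrable_ball[OF Ic r(2)]
  \<comment> \<open>Convexity of the energy: the squared norm of \<open>gz\<close> is at least that
    of \<open>g\<close> plus \<open>2 * (g \<bullet> (gz - g))\<close>, and the cross term has
    nonnegative integral by the Green inequality.\<close>
  have "D r \<le> D r + (LINT x:ball 0 r|lborel. 2 * (g (fold_up x) \<bullet> (gz (fold_up x) - g (fold_up x))))"
    using min by simp
  also have "\<dots> = (LINT x:ball 0 r|lborel. (norm (g (fold_up x)))\<^sup>2 + 2 * (g (fold_up x) \<bullet> (gz (fold_up x) - g (fold_up x))))"
    unfolding D_def using int by (intro set_integral_add(2)[symmetric])
  also have "\<dots> \<le> (LINT x:ball 0 r|lborel. F x)"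
  proof (rule set_integral_mono)
    show "(norm (g (fold_up x)))\<^sup>2 + 2 * (g (fold_up x) \<bullet> (gz (fold_up x) - g (fold_up x))) \<le> F x" for x
    proof -
      have "0 \<le> (norm (gz (fold_up x) - g (fold_up x)))\<^sup>2" by simp
      then show ?thesis
        unfolding F_def power2_norm_eq_inner
        by (simp add: inner_diff_left inner_diff_right inner_commute algebra_simps)
    qed
  qed (use int in \<open>auto intro: set_integral_add(1)\<close>)
  finally have DF: "D r \<le> (LINT x:ball 0 r|lborel. F x)" .
  \<comment> \<open>The squared gradient is homogeneous of degree \<open>2 * k - 2\<close>; this
    degree plus the dimension is the factor in front of the energy.\<close>
  have hom: "F (s *\<^sub>R x) = s powr (2 * k - 2) * F x" if s: "s > 0" for s x
  proof -
    have "gz (fold_up (s *\<^sub>R x)) = s powr (k - 1) *\<^sub>R gz (fold_up x)"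
      using s r by (simp add: gz_def homogeneous_ext_def fold_up_scaleR powr_mult powr_divide)
    then have "F (s *\<^sub>R x) = (s powr (k - 1) * s powr (k - 1)) * F x"
      by (simp add: F_def power_mult_distrib power2_eq_square)
    also have "s powr (k - 1) * s powr (k - 1) = s powr (2 * k - 2)"
      using s by (simp flip: powr_add)
    finally show ?thesis .
  qed
  have SF: "sphere_integral r F = sphere_integral r (\<lambda>x. (norm (g (fold_up x)))\<^sup>2) - sphere_integral r (\<lambda>x. (E x)\<^sup>2) / r\<^sup>2 +
      k\<^sup>2 * sphere_integral r (\<lambda>x. (U x)\<^sup>2) / r\<^sup>2"
  proof -
    have c2: "continuous_on (ball 0 1) (\<lambda>x. (E x)\<^sup>2)" "continuous_on (ball 0 1) (\<lambda>x. (U x)\<^sup>2)"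
      by (intro continuous_intros cont_E cont_U)+
    have c3: "continuous_on (ball 0 1) (\<lambda>x. (- 1 / r\<^sup>2) * (E x)\<^sup>2 + (k\<^sup>2 / r\<^sup>2) * (U x)\<^sup>2)"
      by (intro continuous_on_add continuous_on_mult continuous_on_const c2)
    have "sphere_integral r F = sphere_integral r (\<lambda>x. 1 * (norm (g (fold_up x)))\<^sup>2 +
        1 * ((- 1 / r\<^sup>2) * (E x)\<^sup>2 + (k\<^sup>2 / r\<^sup>2) * (U x)\<^sup>2))"
    proof (rule sphere_integral_cong)
      fix x :: "'m space" assume x: "norm x = r"
      have "gz (fold_up x) = g (fold_up x) - ((fold_up x \<bullet> g (fold_up x) - k * u (fold_up x)) / r\<^sup>2) *\<^sub>R fold_up x"
        using x r by (simp add: gz_def homogeneous_ext_def w_def)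
      then show "F x = 1 * (norm (g (fold_up x)))\<^sup>2 + 1 * ((- 1 / r\<^sup>2) * (E x)\<^sup>2 + (k\<^sup>2 / r\<^sup>2) * (U x)\<^sup>2)"
        using norm_square_radial_correction[of "fold_up x" r "g (fold_up x)" "k * u (fold_up x)"] x r
        by (simp add: F_def E_def U_def power_mult_distrib)
    qed
    also have "\<dots> = 1 * sphere_integral r (\<lambda>x. (norm (g (fold_up x)))\<^sup>2) +
        1 * sphere_integral r (\<lambda>x. (- 1 / r\<^sup>2) * (E x)\<^sup>2 + (k\<^sup>2 / r\<^sup>2) * (U x)\<^sup>2)"
      by (rule sphere_integral_linear[OF cont_Q c3 r])
    also have "sphere_integral r (\<lambda>x. (- 1 / r\<^sup>2) * (E x)\<^sup>2 + (k\<^sup>2 / r\<^sup>2) * (U x)\<^sup>2) =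
        (- 1 / r\<^sup>2) * sphere_integral r (\<lambda>x. (E x)\<^sup>2) + (k\<^sup>2 / r\<^sup>2) * sphere_integral r (\<lambda>x. (U x)\<^sup>2)"
      by (rule sphere_integral_linear[OF c2 r])
    finally show ?thesis by simp
  qed
  have "(real DIM('m space) - 2 + 2 * k) * D r \<le> (real DIM('m space) - 2 + 2 * k) * (LINT x:ball 0 r|lborel. F x)"
    using k by (intro mult_left_mono DF) auto
  also have "\<dots> = r * sphere_integral r F"
    using ball_integral_homogeneous[OF Fc hom r] by (simp add: algebra_simps)
  also have "\<dots> = r * sphere_integral r (\<lambda>x. (norm (g (fold_up x)))\<^sup>2) - sphere_integral r (\<lambda>x. (E x)\<^sup>2) / r +
    k\<^sup>2 * sphere_integral r (\<lambda>x. (U x)\<^sup>2) / r"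
    unfolding SF using r by (simp add: field_simps power2_eq_square)
  finally show ?thesis .
qed

text \<open>With \<open>n\<close> the dimension and \<open>H\<close> the sphere integral of
  \<open>U\<^sup>2\<close>, this is the usual \<open>r powr - (n - 2 + 2 * k) * D r - k * r powr -
  (n - 1 + 2 * k) * H r\<close>, written with a positive factor pulled out so that its sign is that
  of \<open>r * D r - k * H r\<close>.\<close>

definition weiss :: "real \<Rightarrow> real \<Rightarrow> real"
  where "weiss k r = r powr - (real DIM('m space) - 1 + 2 * k) * (r * D r - k * sphere_integral r (\<lambda>x. (U x)\<^sup>2))"

text \<open>The energy comparison bounds the terms \<open>t * SQ - (n - 2 + 2 * k) * D t\<close> of
  the derivative from below by \<open>SE / t - k\<^sup>2 * SU / t\<close>. Together with the
  remaining terms this completes a square: the sphere integral of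
  \<open>(E - k * U)\<^sup>2\<close>, divided by \<open>t\<close>.\<close>

lemma weiss_mono:
  assumes k: "k > 1" and rs: "0 < r" "r \<le> s" "s < 1"
  shows "weiss k r \<le> weiss k s"
proof (rule DERIV_nonneg_imp_nondecreasing[OF rs(2)])
  define n where "n = real DIM('m space)"
  have c2: "continuous_on (ball 0 1) (\<lambda>x. (E x)\<^sup>2)" "continuous_on (ball 0 1) (\<lambda>x. (U x)\<^sup>2)"
      "continuous_on (ball 0 1) (\<lambda>x. U x * E x)"
    by (intro continuous_intros cont_E cont_U)+
  \<comment> \<open>With cone integrals the weight \<open>t ^ (n - 1)\<close> of the sphere becomes
    explicit and cancels against the normalization, so the second term of \<open>weiss\<close> is
    \<open>t powr (- 2 * k)\<close> times an integral over a fixed domain.\<close>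
  have sph: "sphere_integral t f = n * t ^ (DIM('m space) - 1) * cone_integral t f"
    if "0 < t" "t < 1" "continuous_on (ball 0 1) f" for t and f :: "'m space \<Rightarrow> real"
    unfolding n_def using that by (intro sphere_integral_eq) (auto intro: continuous_on_subset)
  have n: "n \<ge> 1" unfolding n_def by simp
  have pw: "t ^ (DIM('m space) - 1) = t powr (n - 1)" if "t > 0" for t
    using that by (simp add: n_def powr_realpow[symmetric])
  fix t :: real assume "r \<le> t" "t \<le> s"
  then have t: "0 < t" "t < 1" using rs by auto
  define SQ where "SQ = sphere_integral t (\<lambda>x. (norm (g (fold_up x)))\<^sup>2)"
  define SE where "SE = sphere_integral t (\<lambda>x. (E x)\<^sup>2)"
  define SU where "SU = sphere_integral t (\<lambda>x. (U x)\<^sup>2)"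
  define SUE where "SUE = sphere_integral t (\<lambda>x. U x * E x)"
  define A where "A = t powr - (n - 1 + 2 * k)"
  have A: "A > 0" using t by (simp add: A_def)
  have C1sq: "C1_up_to_thin (\<lambda>x. u x * u x) (\<lambda>x. u x *\<^sub>R g x + u x *\<^sub>R g x)"
    using C1 unfolding C1_up_to_thin_def by (auto intro!: continuous_intros GDERIV_mult)
  have dD: "(D has_real_derivative SQ) (at t)"
    unfolding D_def[abs_def] SQ_def by (rule has_derivative_ball_integral[OF cont_Q t])
  have "cone_integral t (\<lambda>x. fold_up x \<bullet> (u (fold_up x) *\<^sub>R g (fold_up x) + u (fold_up x) *\<^sub>R g (fold_up x)))
     = 2 * cone_integral t (\<lambda>x. U x * E x)"
  proof -
    have "(\<lambda>x. fold_up x \<bullet> (u (fold_up x) *\<^sub>R g (fold_up x) + u (fold_up x) *\<^sub>R g (fold_up x))) = (\<lambda>x. 2 * (U x * E x))"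
      by (simp add: U_def E_def inner_add_right fun_eq_iff)
    then show ?thesis by (simp add: cone_integral_def)
  qed
  then have dH: "((\<lambda>t. cone_integral t (\<lambda>x. (U x)\<^sup>2)) has_real_derivative
      2 * cone_integral t (\<lambda>x. U x * E x) / t) (at t)"
    using has_derivative_cone_integral_fold_up[OF C1sq t] by (simp add: U_def power2_eq_square)
  have d: "((\<lambda>t. t powr - (n - 2 + 2 * k) * D t - k * n * (t powr (- 2 * k) * cone_integral t (\<lambda>x. (U x)\<^sup>2)))
      has_real_derivative
      (- (n - 2 + 2 * k) * t powr (- (n - 2 + 2 * k) - 1) * D t + SQ * t powr - (n - 2 + 2 * k)) -
      k * n * (- 2 * k * t powr (- 2 * k - 1) * cone_integral t (\<lambda>x. (U x)\<^sup>2) +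
        2 * cone_integral t (\<lambda>x. U x * E x) / t * t powr (- 2 * k))) (at t)"
    using t by (intro DERIV_diff DERIV_mult DERIV_cmult dD dH has_real_derivative_powr)
  have e1: "t powr (- (n - 2 + 2 * k) - 1) = A" "t powr - (n - 2 + 2 * k) = A * t"
  proof -
    show "t powr (- (n - 2 + 2 * k) - 1) = A" by (simp add: A_def algebra_simps)
    have "A * t = t powr - (n - 1 + 2 * k) * t powr 1" using t by (simp add: A_def)
    also have "\<dots> = t powr - (n - 2 + 2 * k)" unfolding powr_add[symmetric] by (simp add: algebra_simps)
    finally show "t powr - (n - 2 + 2 * k) = A * t" by simp
  qed
  have e2: "t powr (- 2 * k) = A * t ^ (DIM('m space) - 1)"
    unfolding A_def pw[OF t(1)] powr_add[symmetric] by simp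
  have e3: "t powr (- 2 * k - 1) = A * t ^ (DIM('m space) - 1) / t"
    using t e2 by (simp add: powr_diff)
  have "((\<lambda>t. t powr - (n - 2 + 2 * k) * D t - k * n * (t powr (- 2 * k) * cone_integral t (\<lambda>x. (U x)\<^sup>2)))
      has_real_derivative A * (t * SQ - (n - 2 + 2 * k) * D t + 2 * k\<^sup>2 * SU / t - 2 * k * SUE / t)) (at t)"
  proof (rule DERIV_cong[OF d])
    show "(- (n - 2 + 2 * k) * t powr (- (n - 2 + 2 * k) - 1) * D t + SQ * t powr - (n - 2 + 2 * k)) -
      k * n * (- 2 * k * t powr (- 2 * k - 1) * cone_integral t (\<lambda>x. (U x)\<^sup>2) +
        2 * cone_integral t (\<lambda>x. U x * E x) / t * t powr (- 2 * k)) =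
      A * (t * SQ - (n - 2 + 2 * k) * D t + 2 * k\<^sup>2 * SU / t - 2 * k * SUE / t)"
      unfolding e1 e2 e3 SU_def SUE_def sph[OF t c2(2)] sph[OF t c2(3)] using t
      by (simp add: field_simps power2_eq_square)
  qed
  then have W: "(weiss k has_real_derivative A * (t * SQ - (n - 2 + 2 * k) * D t + 2 * k\<^sup>2 * SU / t - 2 * k * SUE / t)) (at t)"
  proof (rule has_field_derivative_transform_within_open[where S = "{0<..<1}"])
    fix \<tau> :: real assume "\<tau> \<in> {0<..<1}"
    then have \<tau>: "0 < \<tau>" "\<tau> < 1" by auto
    have "\<tau> powr - (n - 2 + 2 * k) = \<tau> powr - (n - 1 + 2 * k) * \<tau> powr 1"
      "\<tau> powr (- 2 * k) = \<tau> powr - (n - 1 + 2 * k) * \<tau> powr (n - 1)"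
      unfolding powr_add[symmetric] by (simp_all add: algebra_simps)
    then show "\<tau> powr - (n - 2 + 2 * k) * D \<tau> - k * n * (\<tau> powr (- 2 * k) * cone_integral \<tau> (\<lambda>x. (U x)\<^sup>2)) = weiss k \<tau>"
      using \<tau> unfolding weiss_def sph[OF \<tau> c2(2)] pw[OF \<tau>(1)] n_def[symmetric] by (simp add: algebra_simps)
  qed (use t in auto)
  show "\<exists>y. (weiss k has_real_derivative y) (at t) \<and> 0 \<le> y"
  proof (intro exI conjI, rule W)
    have c4: "continuous_on (ball 0 1) (\<lambda>x. (- 2 * k) * (U x * E x) + k\<^sup>2 * (U x)\<^sup>2)"
      by (intro continuous_on_add continuous_on_mult continuous_on_const c2)
    have two: "2 * k\<^sup>2 * SU / t = 2 * (k\<^sup>2 * SU / t)" by simp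
    have aux: "a - b + 2 * b - c \<le> d - e + 2 * b - c" if "e \<le> d - a + b" for a b c d e :: real
      using that by simp
    have c5: "continuous_on (ball 0 1) (\<lambda>x. (E x - k * U x)\<^sup>2)"
      by (intro continuous_intros cont_E cont_U)
    have "0 \<le> sphere_integral t (\<lambda>x. (E x - k * U x)\<^sup>2)"
      using t by (intro sphere_integral_nonneg continuous_on_subset[OF c5]) auto
    also have "\<dots> = sphere_integral t (\<lambda>x. 1 * (E x)\<^sup>2 + 1 * ((- 2 * k) * (U x * E x) + k\<^sup>2 * (U x)\<^sup>2))"
      by (rule sphere_integral_cong) (simp add: power2_eq_square algebra_simps)
    also have "\<dots> = 1 * SE + 1 * ((- 2 * k) * SUE + k\<^sup>2 * SU)"
      unfolding sphere_integral_linear[OF c2(1) c4 t] sphere_integral_linear[OF c2(3) c2(2) t] SE_def SUE_def SU_def ..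
    finally have "0 \<le> (SE - 2 * k * SUE + k\<^sup>2 * SU) / t" using t by simp
    also have "\<dots> = SE / t - 2 * k * SUE / t + k\<^sup>2 * SU / t" by (simp add: diff_divide_distrib add_divide_distrib)
    also have "\<dots> = SE / t - k\<^sup>2 * SU / t + 2 * k\<^sup>2 * SU / t - 2 * k * SUE / t" by simp
    also have "\<dots> \<le> t * SQ - (n - 2 + 2 * k) * D t + 2 * k\<^sup>2 * SU / t - 2 * k * SUE / t"
      using energy_comparison[OF t k] unfolding n_def[symmetric] SQ_def[symmetric] SE_def[symmetric] SU_def[symmetric]
      unfolding two by (rule aux)
    finally show "0 \<le> A * (t * SQ - (n - 2 + 2 * k) * D t + 2 * k\<^sup>2 * SU / t - 2 * k * SUE / t)"
      using A by simp
  qed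
qed

end

section \<open>Monneau monotonicity\<close>

context signorini
begin

lemma weiss_nonneg:
  assumes k: "k > 1" and r: "0 < r" "r < 1"
    and freq: "((\<lambda>r. r * D r / sphere_integral r (\<lambda>x. (U x)\<^sup>2)) \<longlongrightarrow> \<kappa>) (at_right 0)" and "k < \<kappa>"
  shows "k * sphere_integral r (\<lambda>x. (U x)\<^sup>2) \<le> r * D r"
proof -
  have "\<forall>\<^sub>F t in at_right 0. k < t * D t / sphere_integral t (\<lambda>x. (U x)\<^sup>2)"
    using order_tendstoD(1)[OF freq \<open>k < \<kappa>\<close>] .
  moreover have "\<forall>\<^sub>F t in at_right 0. t \<in> {0<..<r}"
    using r by (intro eventually_at_right_real)
  ultimately have "\<forall>\<^sub>F t in at_right 0. k < t * D t / sphere_integral t (\<lambda>x. (U x)\<^sup>2) \<and> t \<in> {0<..<r}"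
    by (rule eventually_conj)
  from eventually_happens'[OF _ this]
  obtain t where t: "k < t * D t / sphere_integral t (\<lambda>x. (U x)\<^sup>2)" "0 < t" "t < r" by auto
  define H where "H = sphere_integral t (\<lambda>x. (U x)\<^sup>2)"
  have "0 \<le> H" unfolding H_def
    using t r by (intro sphere_integral_nonneg continuous_on_power continuous_on_subset[OF cont_U]) auto
  \<comment> \<open>Division by zero would make the quotient \<open>0\<close>, which does not exceed
    the positive \<open>k\<close>.\<close>
  moreover have "H \<noteq> 0" using t(1) k by (auto simp: H_def)
  ultimately have "k * H < t * D t" using t(1) by (simp add: H_def pos_less_divide_eq)
  then have "0 \<le> weiss k t" by (simp add: weiss_def H_def)
  also have "\<dots> \<le> weiss k r" using t r by (intro weiss_mono k) auto
  finally show ?thesis using r by (simp add: weiss_def zero_le_mult_iff)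
qed

lemma frequency_lower_bound:
  assumes \<kappa>: "\<kappa> > 1" and r: "0 < r" "r < 1"
    and freq: "((\<lambda>r. r * D r / sphere_integral r (\<lambda>x. (U x)\<^sup>2)) \<longlongrightarrow> \<kappa>) (at_right 0)"
  shows "\<kappa> * sphere_integral r (\<lambda>x. (U x)\<^sup>2) \<le> r * D r"
proof (rule tendsto_upperbound)
  show "((\<lambda>k. k * sphere_integral r (\<lambda>x. (U x)\<^sup>2)) \<longlongrightarrow> \<kappa> * sphere_integral r (\<lambda>x. (U x)\<^sup>2)) (at_left \<kappa>)"
    by (intro tendsto_intros)
  show "\<forall>\<^sub>F k in at_left \<kappa>. k * sphere_integral r (\<lambda>x. (U x)\<^sup>2) \<le> r * D r"
    \<comment> \<open>As \<open>\<kappa> > 1\<close>, all \<open>k\<close> close enough to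
      \<open>\<kappa>\<close> from the left lie in \<open>(1, \<kappa>)\<close>.\<close>
    using eventually_at_left_real[OF \<kappa>]
    by eventually_elim (rule weiss_nonneg[OF _ r freq], auto)
qed simp

text \<open>The integrands agree off the thin hyperplane, a null set. Nothing is known about
  \<open>grad v\<close> on it, so measurability is transferred from the folded integrand through
  completeness of \<open>lebesgue\<close>.\<close>

lemma ball_gradient_integral:
  assumes grad: "\<And>x. norm x < 1 \<Longrightarrow> snd x \<noteq> 0 \<Longrightarrow> norm (grad v x) = norm (g (fold_up x))"
    and r: "r < 1"
  shows "(LINT x:ball 0 r|lebesgue. (norm (grad v x))\<^sup>2) = D r"
proof -
  define F where "F = (\<lambda>x. indicator (ball 0 r) x *\<^sub>R (norm (g (fold_up x)))\<^sup>2)"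
  have Fm: "F \<in> borel_measurable lborel"
    using set_integrable_ball[OF cont_Q r] by (auto simp: F_def set_integrable_def)
  have ae: "AE x in lebesgue. F x = indicator (ball 0 r) x *\<^sub>R (norm (grad v x))\<^sup>2"
    using AE_completion[OF AE_snd_nonzero]
    by eventually_elim (use grad r in \<open>auto simp: F_def indicator_def\<close>)
  have Fm': "F \<in> borel_measurable lebesgue" using Fm by (rule measurable_completion)
  have Gm: "(\<lambda>x. indicator (ball 0 r) x *\<^sub>R (norm (grad v x))\<^sup>2) \<in> borel_measurable lebesgue"
    by (rule borel_measurable_AE[OF Fm' ae])
  have "(LINT x:ball 0 r|lebesgue. (norm (grad v x))\<^sup>2) = (\<integral>x. F x \<partial>lebesgue)"
    unfolding set_lebesgue_integral_def
    using ae Fm' Gm by (intro integral_cong_AE) auto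
  also have "\<dots> = (\<integral>x. F x \<partial>lborel)" using Fm by (rule integral_completion)
  finally show ?thesis by (simp add: D_def F_def set_lebesgue_integral_def)
qed

text \<open>The Green inequality is applied to \<open>g\<close> with \<open>- u\<close>, to
  \<open>g\<close> with \<open>p\<close>, and to \<open>gp\<close> with \<open>- u\<close>. Writing
  integrals over the sphere, this and the frequency bound give
  \<open>\<integral> U E \<ge> t D \<ge> k \<integral> U\<^sup>2\<close> and
  \<open>\<integral> P E \<le> t I \<le> k \<integral> P U\<close>. The mixed energy
  \<open>I\<close> drops out, and subtracting the two chains gives the sign of the
  derivative.\<close>

lemma monneau_monotone:
  fixes p :: "'m space \<Rightarrow> real" and gp :: "'m space \<Rightarrow> 'm space" and k :: nat
  assumes k: "real k > 1"
    and freq: "((\<lambda>r. r * D r / sphere_integral r (\<lambda>x. (U x)\<^sup>2)) \<longlongrightarrow> real k) (at_right 0)"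
    and C1p: "C1_up_to_thin p gp" and solp: "solenoidal gp" and euler: "\<And>x. x \<bullet> gp x = real k * p x"
    and gp_thin: "\<And>x. snd x = 0 \<Longrightarrow> snd (gp x) = 0" and p_thin: "\<And>x. snd x = 0 \<Longrightarrow> p x \<ge> 0"
    and rs: "0 < r" "r \<le> s" "s < 1"
  shows "monneau k r (\<lambda>x. u (fold_up x)) (\<lambda>x. p (fold_up x)) \<le> monneau k s (\<lambda>x. u (fold_up x)) (\<lambda>x. p (fold_up x))"
proof (rule DERIV_nonneg_imp_nondecreasing[OF rs(2)])
  define P where "P = (\<lambda>x. p (fold_up x))"
  define n where "n = real DIM('m space)"
  have n: "n > 0" by (simp add: n_def)
  have pc: "continuous_on upper p" "continuous_on upper gp" using C1p by (auto simp: C1_up_to_thin_def)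
  have cont_P: "continuous_on (ball 0 1) P" unfolding P_def by (rule continuous_on_compose_fold_up[OF pc(1)])
  have c: "continuous_on (ball 0 1) (\<lambda>x. (U x)\<^sup>2)" "continuous_on (ball 0 1) (\<lambda>x. U x * E x)"
    "continuous_on (ball 0 1) (\<lambda>x. P x * E x)" "continuous_on (ball 0 1) (\<lambda>x. P x * U x)"
    "continuous_on (ball 0 1) (\<lambda>x. (U x - P x)\<^sup>2)" "continuous_on (ball 0 1) (\<lambda>x. (U x - P x) * (E x - real k * U x))"
    by (intro continuous_intros cont_E cont_U cont_P)+
  have sph: "sphere_integral t f = n * t ^ (DIM('m space) - 1) * cone_integral t f"
    if "0 < t" "t < 1" "continuous_on (ball 0 1) f" for t and f :: "'m space \<Rightarrow> real"
    unfolding n_def using that by (intro sphere_integral_eq) (auto intro: continuous_on_subset)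
  fix t assume "r \<le> t" "t \<le> s"
  then have t: "0 < t" "t < 1" using rs by auto
  define I where "I = (LINT x:ball 0 t|lborel. g (fold_up x) \<bullet> gp (fold_up x))"
  have C1neg: "C1_up_to_thin (\<lambda>x. - 1 * u x) (\<lambda>x. - g x)"
    using C1 unfolding C1_up_to_thin_def by (auto intro!: continuous_on_minus GDERIV_minus)
  have neg: "sphere_integral t (\<lambda>x. - f x) = - sphere_integral t f" for f :: "'m space \<Rightarrow> real"
    by (simp add: sphere_integral_def set_lebesgue_integral_def)
  have neg_ball: "(LINT x:ball 0 t|lborel. - f x) = - (LINT x:ball 0 t|lborel. f x)" for f :: "'m space \<Rightarrow> real"
    by (simp add: set_lebesgue_integral_def)
  have 1: "t * D t \<le> sphere_integral t (\<lambda>x. U x * E x)"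
  proof -
    have "sphere_integral t (\<lambda>x. - 1 * u (fold_up x) * (fold_up x \<bullet> g (fold_up x)))
      \<le> t * (LINT x:ball 0 t|lborel. g (fold_up x) \<bullet> - g (fold_up x))"
    proof (rule sphere_integral_le_ball_integral[OF sol C1neg _ t])
      show "snd (g x) * (- 1 * u x) \<le> 0" if "x \<in> upper" "snd x = 0" for x
        using thin[OF that] by auto
    qed
    then have "- sphere_integral t (\<lambda>x. U x * E x) \<le> - (t * D t)"
      by (simp add: neg neg_ball U_def E_def D_def power2_norm_eq_inner)
    then show ?thesis by simp
  qed
  have 2: "sphere_integral t (\<lambda>x. P x * E x) \<le> t * I"
    unfolding P_def E_def I_def
  proof (rule sphere_integral_le_ball_integral[OF sol C1p _ t])
    show "snd (g x) * p x \<le> 0" if "x \<in> upper" "snd x = 0" for x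
      using thin[OF that] p_thin[OF that(2)] by (simp add: mult_nonpos_nonneg)
  qed
  have 3: "t * I \<le> real k * sphere_integral t (\<lambda>x. P x * U x)"
  proof -
    have "sphere_integral t (\<lambda>x. - 1 * u (fold_up x) * (fold_up x \<bullet> gp (fold_up x)))
      \<le> t * (LINT x:ball 0 t|lborel. gp (fold_up x) \<bullet> - g (fold_up x))"
      by (rule sphere_integral_le_ball_integral[OF solp C1neg _ t]) (simp add: gp_thin)
    then have "- sphere_integral t (\<lambda>x. real k * (P x * U x)) \<le> - (t * I)"
      by (simp add: neg neg_ball U_def P_def I_def euler inner_commute mult_ac)
    moreover have "sphere_integral t (\<lambda>x. real k * (P x * U x)) = real k * sphere_integral t (\<lambda>x. P x * U x)"
      using sphere_integral_linear[OF c(4) c(4) t, of "real k" 0] by simp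
    ultimately show ?thesis by simp
  qed
  have 4: "real k * sphere_integral t (\<lambda>x. (U x)\<^sup>2) \<le> t * D t"
    by (rule frequency_lower_bound[OF k t freq])
  have nonneg: "0 \<le> sphere_integral t (\<lambda>x. (U x - P x) * (E x - real k * U x))"
  proof -
    have c1: "continuous_on (ball 0 1) (\<lambda>x. 1 * (U x * E x) + (- real k) * (U x)\<^sup>2)"
      and c2: "continuous_on (ball 0 1) (\<lambda>x. real k * (P x * U x) + (- 1) * (P x * E x))"
      by (intro continuous_on_add continuous_on_mult continuous_on_const c)+
    have "sphere_integral t (\<lambda>x. (U x - P x) * (E x - real k * U x)) = sphere_integral t
        (\<lambda>x. 1 * (1 * (U x * E x) + (- real k) * (U x)\<^sup>2) + 1 * (real k * (P x * U x) + (- 1) * (P x * E x)))"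
      by (rule sphere_integral_cong) (simp add: power2_eq_square algebra_simps)
    also have "\<dots> = 1 * (1 * sphere_integral t (\<lambda>x. U x * E x) + (- real k) * sphere_integral t (\<lambda>x. (U x)\<^sup>2)) +
        1 * (real k * sphere_integral t (\<lambda>x. P x * U x) + (- 1) * sphere_integral t (\<lambda>x. P x * E x))"
      unfolding sphere_integral_linear[OF c1 c2 t] sphere_integral_linear[OF c(2) c(1) t]
        sphere_integral_linear[OF c(4) c(3) t] ..
    finally show ?thesis using 1 2 3 4 by simp
  qed
  then have nonneg': "0 \<le> cone_integral t (\<lambda>x. (U x - P x) * (E x - real k * U x))"
  proof -
    have "0 < n * t ^ (DIM('m space) - 1)" using n t by (intro mult_pos_pos zero_less_power)
    then show ?thesis using nonneg unfolding sph[OF t c(6)] zero_le_mult_iff by linarith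
  qed
  have C1sq: "C1_up_to_thin (\<lambda>x. (u x - p x) * (u x - p x)) (\<lambda>x. (u x - p x) *\<^sub>R (g x - gp x) + (u x - p x) *\<^sub>R (g x - gp x))"
    using C1 C1p unfolding C1_up_to_thin_def by (auto intro!: continuous_intros GDERIV_mult GDERIV_diff)
  define J where "J = cone_integral t (\<lambda>x. 2 * ((U x - P x) * (E x - real k * P x)))"
  have dH: "((\<lambda>t. cone_integral t (\<lambda>x. (U x - P x)\<^sup>2)) has_real_derivative J / t) (at t)"
  proof -
    have "(\<lambda>x. fold_up x \<bullet> ((u (fold_up x) - p (fold_up x)) *\<^sub>R (g (fold_up x) - gp (fold_up x)) +
        (u (fold_up x) - p (fold_up x)) *\<^sub>R (g (fold_up x) - gp (fold_up x)))) =
        (\<lambda>x. 2 * ((U x - P x) * (E x - real k * P x)))"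
      by (simp add: U_def E_def P_def inner_add_right inner_diff_right euler fun_eq_iff)
    then show ?thesis
      using has_derivative_cone_integral_fold_up[OF C1sq t] by (simp add: U_def P_def J_def power2_eq_square)
  qed
  \<comment> \<open>By Euler's identity \<open>u - p\<close> has the radial derivative
    \<open>E - k * P = (E - k * U) + k * (U - P)\<close>, up to the factor \<open>1 / t\<close>. The
    second summand cancels exactly against the derivative of \<open>t ^ (2 * k)\<close> in the
    denominator.\<close>
  have J: "J = 2 * cone_integral t (\<lambda>x. (U x - P x) * (E x - real k * U x)) + 2 * real k * cone_integral t (\<lambda>x. (U x - P x)\<^sup>2)"
  proof -
    have "J = cone_integral t (\<lambda>x. 2 * ((U x - P x) * (E x - real k * U x)) + 2 * real k * (U x - P x)\<^sup>2)"
      unfolding J_def by (rule arg_cong[where f = "cone_integral t"]) (simp add: fun_eq_iff power2_eq_square algebra_simps)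
    then show ?thesis
      using set_integrable_radial[OF c(5) t, of 1] set_integrable_radial[OF c(6) t, of 1]
      by (simp add: cone_integral_def set_integral_add)
  qed
  have "((\<lambda>t. n * (cone_integral t (\<lambda>x. (U x - P x)\<^sup>2) / t ^ (2 * k))) has_real_derivative
      n * ((J / t * t ^ (2 * k) - cone_integral t (\<lambda>x. (U x - P x)\<^sup>2) * (real (2 * k) * t ^ (2 * k - 1))) / (t ^ (2 * k) * t ^ (2 * k)))) (at t)"
    using t by (intro DERIV_cmult DERIV_divide dH DERIV_pow[THEN DERIV_cong]) auto
  moreover have "(J / t * t ^ (2 * k) - cone_integral t (\<lambda>x. (U x - P x)\<^sup>2) * (real (2 * k) * t ^ (2 * k - 1))) / (t ^ (2 * k) * t ^ (2 * k)) =
      2 * cone_integral t (\<lambda>x. (U x - P x) * (E x - real k * U x)) / (t * t ^ (2 * k))"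
  proof -
    have "t ^ (2 * k - 1) = t ^ (2 * k) / t" using t k by (simp add: power_diff)
    then show ?thesis unfolding J using t by (simp add: field_simps)
  qed
  ultimately have "((\<lambda>t. n * (cone_integral t (\<lambda>x. (U x - P x)\<^sup>2) / t ^ (2 * k))) has_real_derivative
      n * (2 * cone_integral t (\<lambda>x. (U x - P x) * (E x - real k * U x)) / (t * t ^ (2 * k)))) (at t)"
    by (simp only:)
  then have "((\<lambda>t. monneau k t (\<lambda>x. u (fold_up x)) (\<lambda>x. p (fold_up x))) has_real_derivative
      n * (2 * cone_integral t (\<lambda>x. (U x - P x) * (E x - real k * U x)) / (t * t ^ (2 * k)))) (at t)"
  proof (rule has_field_derivative_transform_within_open[where S = "{0<..<1}"])
    fix \<tau> :: real assume "\<tau> \<in> {0<..<1}"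
    then have \<tau>: "0 < \<tau>" "\<tau> < 1" by auto
    then show "n * (cone_integral \<tau> (\<lambda>x. (U x - P x)\<^sup>2) / \<tau> ^ (2 * k)) = monneau k \<tau> (\<lambda>x. u (fold_up x)) (\<lambda>x. p (fold_up x))"
      using sph[OF \<tau> c(5)] unfolding monneau_def U_def P_def by (simp add: power_add)
  qed (use t in auto)
  moreover have "0 \<le> n * (2 * cone_integral t (\<lambda>x. (U x - P x) * (E x - real k * U x)) / (t * t ^ (2 * k)))"
    using n t nonneg' by simp
  ultimately show "\<exists>y. ((\<lambda>t. monneau k t (\<lambda>x. u (fold_up x)) (\<lambda>x. p (fold_up x))) has_real_derivative y) (at t) \<and> 0 \<le> y"
    by blast
qed

end

theorem theorem1p4p3:
  fixes u p :: "'m::finite space \<Rightarrow> real" and m \<kappa> :: nat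
  assumes "m \<ge> 1" and "\<kappa> = 2 * m"
    and "u \<in> signorini_class"
    and "origin_in_Sigma (real \<kappa>) u"
    and "p \<in> P_class \<kappa>"
  shows "mono_on {0<..<1} (\<lambda>r. monneau \<kappa> r u p)"
proof -
  obtain g where g: "C1_up_to_thin u g" "solenoidal g"
    "\<And>x. x \<in> upper \<Longrightarrow> snd x = 0 \<Longrightarrow> 0 \<le> u x \<and> snd (g x) \<le> 0 \<and> snd (g x) * u x = 0"
    and even: "\<And>x. norm x < 1 \<Longrightarrow> u (fold_up x) = u x"
    and grad: "\<And>x. norm x < 1 \<Longrightarrow> snd x \<noteq> 0 \<Longrightarrow> norm (grad u x) = norm (g (fold_up x))"
    using signorini_gradient[OF assms(3)] by metis
  obtain gp where gp: "C1_up_to_thin p gp" "solenoidal gp" "\<And>x. x \<bullet> gp x = real \<kappa> * p x"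
    "\<And>x. snd x = 0 \<Longrightarrow> snd (gp x) = 0" and evenp: "\<And>x. p (fold_up x) = p x"
    and pnn: "\<And>x. snd x = 0 \<Longrightarrow> p x \<ge> 0"
    using P_class_gradient[OF assms(5)] by metis
  interpret signorini u g by unfold_locales (use g in auto)
  have "((\<lambda>r. frequency r u) \<longlongrightarrow> real \<kappa>) (at_right 0)"
    using assms(4) by (simp add: origin_in_Sigma_def)
  \<comment> \<open>The frequency is stated with \<open>u\<close> and \<open>grad u\<close>; for
    radii below one, \<open>u\<close> equals its folded version and the gradients have equal norms
    almost everywhere.\<close>
  moreover have "\<forall>\<^sub>F r in at_right 0. frequency r u = r * D r / sphere_integral r (\<lambda>x. (U x)\<^sup>2)"
  proof -
    have "\<forall>\<^sub>F r in at_right 0. r \<in> {0<..<1::real}" by (intro eventually_at_right_real) simp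
    then show ?thesis
    proof eventually_elim
      case (elim r)
      have "sphere_integral r (\<lambda>x. (u x)\<^sup>2) = sphere_integral r (\<lambda>x. (U x)\<^sup>2)"
        by (rule sphere_integral_cong) (use elim even in \<open>simp add: U_def\<close>)
      then show ?case using ball_gradient_integral[OF grad, of r] elim by (simp add: frequency_def)
    qed
  qed
  ultimately have freq: "((\<lambda>r. r * D r / sphere_integral r (\<lambda>x. (U x)\<^sup>2)) \<longlongrightarrow> real \<kappa>) (at_right 0)"
    by (rule Lim_transform_eventually)
  have eq: "monneau \<kappa> r u p = monneau \<kappa> r (\<lambda>x. u (fold_up x)) (\<lambda>x. p (fold_up x))" if "r \<in> {0<..<1}" for r
    unfolding monneau_def using that
    by (intro arg_cong2[where f = "(*)"] refl sphere_integral_cong) (simp add: even evenp)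
  \<comment> \<open>Here \<open>\<kappa> = 2 * m \<ge> 2\<close>, so there are exponents strictly
    between \<open>1\<close> and \<open>\<kappa>\<close>.\<close>
  have k: "real \<kappa> > 1" using assms(1,2) by simp
  show ?thesis
  proof (rule mono_onI)
    fix r s :: real assume rs: "r \<in> {0<..<1}" "s \<in> {0<..<1}" "r \<le> s"
    show "monneau \<kappa> r u p \<le> monneau \<kappa> s u p"
      unfolding eq[OF rs(1)] eq[OF rs(2)]
      by (rule monneau_monotone[OF k freq gp pnn]) (use rs in auto)
  qed
qed

end
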